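(* Let $V$ be a nonlocal vertex algebra. Assume that $V$ is of countable dimension over $\mathbb{C}$ and that $V$ as a $V$-module is irreducible. Then $B(V)$ is a differential bialgebra (with derivation $\partial=\frac{d}{dx}$) with comultiplication $\Delta$ and counit $\varepsilon$ uniquely determined by $$a(x)\mathbf{1}=\varepsilon(a(x))\mathbf{1},\qquad \Delta(a(x))=\sum a_{(1)}(x)\otimes a_{(2)}(x)\qquad\text{for } a(x)\in B(V),$$ where $\sum a_{(1)}(x)\otimes a_{(2)}(x)\in B(V)\otimes B(V)$ is such that $a(x_1)Y(v,x_2)=\sum Y(a_{(1)}(x_1-x_2)v,x_2)\,a_{(2)}(x_1)$ for all $v\in V$; and furthermore $$\mathrm{PDer}^{-}(V)=\{a\in B(V)\mid \Delta(a)=a\otimes 1+1\otimes a\},\qquad \mathrm{PEnd}^{-}(V)=\{a\in B(V)\mid a\ne0,\ \Delta(a)=a\otimes a\}.$$ In particular, all these assertions hold if $V$ is a simple vertex operator algebra.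
   Context: All vector spaces are over $\mathbb{C}$; $(x_1\pm x_2)^n$ is expanded in nonnegative powers of the second variable. A nonlocal vertex algebra is a vector space $V$ with a linear map $Y(\cdot,x):V\to\mathrm{Hom}(V,V((x)))$, $v\mapsto Y(v,x)=\sum_{n\in\mathbb{Z}}v_nx^{-n-1}$, and a vacuum vector $\mathbf{1}\in V$ such that $Y(\mathbf{1},x)=1$; $Y(v,x)\mathbf{1}\in V[[x]]$ with $\lim_{x\to0}Y(v,x)\mathbf{1}=v$; and for all $u,v,w\in V$ there is a nonnegative integer $l$ with $(x_0+x_2)^lY(u,x_0+x_2)Y(v,x_2)w=(x_0+x_2)^lY(Y(u,x_0)v,x_2)w$. $V$ is a module over itself via $Y$; it is irreducible if $V\ne0$ and the only subspaces stable under all $v_n$ ($v\in V,n\in\mathbb{Z}$) are $0$ and $V$. A vertex operator algebra is meant in the sense of Frenkel–Lepowsky–Meurman (a vertex algebra with a conformal vector, $\mathbb{Z}$-graded by $L(0)$-eigenvalues with finite-dimensional homogeneous subspaces that vanish in sufficiently negative degree, and with $L(-1)$ acting as the translation operator $v\mapsto v_{-2}\mathbf 1$); simple means irreducible as a module over itself. $\mathrm{Hom}_{\mathbb{C}}(V,V\otimes\mathbb{C}((x)))$ is identified with $\mathrm{End}_{\mathbb{C}((x))}(V\otimes\mathbb{C}((x)))$, an associative algebra with the $\mathbb{C}$-linear derivation $\partial=d/dx$; its elements are written $a(x)$. $Y$ is extended linearly over scalar Laurent series. A subset $U$ is $\Delta$-closed if for any $a(x)\in U$ there exist $a_{(1i)}(x),a_{(2i)}(x)\in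 U$, $i=1,\dots,r$, with $a(x_1)Y(v,x_2)=\sum_{i=1}^rY(a_{(1i)}(x_1-x_2)v,x_2)a_{(2i)}(x_1)$ for all $v\in V$. $B(V)$ is the sum of all $\Delta$-closed subspaces $U$ of $\mathrm{Hom}(V,V\otimes\mathbb{C}((x)))$ with $a(x)\mathbf{1}\in\mathbb{C}\mathbf{1}$ for all $a(x)\in U$; it is an associative subalgebra stable under $\partial$. A differential bialgebra is a bialgebra $(B,\Delta,\varepsilon)$ with a derivation $\partial$ such that $\varepsilon\circ\partial=0$ and $\Delta\partial=(\partial\otimes1+1\otimes\partial)\Delta$. $\mathrm{PDer}^{-}(V)$ is the space of $\psi(x)\in\mathrm{Hom}_{\mathbb{C}}(V,V\otimes\mathbb{C}((x)))$ with $[\psi(x_1),Y(v,x_2)]=Y(\psi(x_1-x_2)v,x_2)$ for all $v\in V$. $\mathrm{PEnd}^{-}(V)$ is the set of $\phi(x)\in\mathrm{Hom}_{\mathbb{C}}(V,V\otimes\mathbb{C}((x)))$ with $\phi(x)\mathbf{1}=\mathbf{1}$ and $\phi(x_1)Y(v,x_2)=Y(\phi(x_1-x_2)v,x_2)\phi(x_1)$ for all $v\in V$. *)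

theory Defs
  imports
    Complex_Main
    "HOL-Library.Function_Algebras"
    "HOL-Library.Groups_Big_Fun"
    "HOL-Library.Poly_Mapping"
    "HOL-Library.Countable_Set"
    "HOL-Computational_Algebra.Formal_Laurent_Series"
begin

section \<open>Complex vector spaces\<close>

class scaleC =
  fixes scaleC :: "complex \<Rightarrow> 'a \<Rightarrow> 'a"  (infixr "*\<^sub>C" 75)

class complex_vector = scaleC + ab_group_add +
  assumes scaleC_add_right: "c *\<^sub>C (x + y) = c *\<^sub>C x + c *\<^sub>C y"
    and scaleC_add_left: "(c + d) *\<^sub>C x = c *\<^sub>C x + d *\<^sub>C x"
    and scaleC_scaleC: "c *\<^sub>C d *\<^sub>C x = (c * d) *\<^sub>C x"
    and scaleC_one: "1 *\<^sub>C x = x"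

global_interpretation cvec: vector_space "scaleC :: complex \<Rightarrow> 'a::complex_vector \<Rightarrow> 'a"
  by unfold_locales (simp_all add: scaleC_add_right scaleC_add_left scaleC_scaleC scaleC_one)

abbreviation clinear :: "('a::complex_vector \<Rightarrow> 'b::complex_vector) \<Rightarrow> bool" where
  "clinear \<equiv> Vector_Spaces.linear scaleC scaleC"

instantiation complex :: complex_vector
begin
definition scaleC_complex :: "complex \<Rightarrow> complex \<Rightarrow> complex" where
  "scaleC_complex c z = c * z"
instance by standard (simp_all add: scaleC_complex_def algebra_simps)
end

instantiation "fun" :: (type, complex_vector) complex_vector
begin
definition scaleC_fun :: "complex \<Rightarrow> ('a \<Rightarrow> 'b) \<Rightarrow> 'a \<Rightarrow> 'b" where
  "scaleC_fun c f = (\<lambda>x. c *\<^sub>C f x)"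
instance
  by standard
    (simp_all add: scaleC_fun_def fun_eq_iff scaleC_add_right scaleC_add_left scaleC_scaleC scaleC_one)
end

instantiation poly_mapping :: (type, complex_vector) complex_vector
begin
definition scaleC_poly_mapping :: "complex \<Rightarrow> ('a \<Rightarrow>\<^sub>0 'b) \<Rightarrow> 'a \<Rightarrow>\<^sub>0 'b" where
  "scaleC_poly_mapping c = Poly_Mapping.map (scaleC c)"
instance
proof -
  have look: "Poly_Mapping.lookup (c *\<^sub>C p) k = c *\<^sub>C Poly_Mapping.lookup p k"
    for c and p :: "'a \<Rightarrow>\<^sub>0 'b" and k
    by (simp add: scaleC_poly_mapping_def Poly_Mapping.map.rep_eq when_def)
  show "OFCLASS('a \<Rightarrow>\<^sub>0 'b, complex_vector_class)"
    by standard
      (auto intro!: poly_mapping_eqI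
        simp: look lookup_add scaleC_add_right scaleC_add_left scaleC_scaleC scaleC_one)
qed
end

definition countable_dim :: "'a::complex_vector set \<Rightarrow> bool" where
  "countable_dim W \<longleftrightarrow> (\<exists>S. countable S \<and> cvec.independent S \<and> cvec.span S = W)"

definition linear_on :: "'a::complex_vector set \<Rightarrow> ('a \<Rightarrow> 'b::complex_vector) \<Rightarrow> bool" where
  "linear_on A f \<longleftrightarrow>
    (\<forall>x\<in>A. \<forall>y\<in>A. f (x + y) = f x + f y) \<and> (\<forall>c. \<forall>x\<in>A. f (c *\<^sub>C x) = c *\<^sub>C f x)"

section \<open>Tensor products\<close>

text \<open>The free vector space on pairs modulo the bilinearity relations.\<close>

definition tensor_null :: "(('a::complex_vector \<times> 'b::complex_vector) \<Rightarrow>\<^sub>0 complex) set" where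
  "tensor_null = cvec.span
    ({Poly_Mapping.single (a + a', b) 1 - Poly_Mapping.single (a, b) 1
        - Poly_Mapping.single (a', b) 1 | a a' b. True} \<union>
     {Poly_Mapping.single (a, b + b') 1 - Poly_Mapping.single (a, b) 1
        - Poly_Mapping.single (a, b') 1 | a b b'. True} \<union>
     {Poly_Mapping.single (c *\<^sub>C a, b) 1 - c *\<^sub>C Poly_Mapping.single (a, b) 1 | c a b. True} \<union>
     {Poly_Mapping.single (a, c *\<^sub>C b) 1 - c *\<^sub>C Poly_Mapping.single (a, b) 1 | c a b. True})"

definition tensor_eq ::
    "(('a::complex_vector \<times> 'b::complex_vector) \<Rightarrow>\<^sub>0 complex) \<Rightarrow> (('a \<times> 'b) \<Rightarrow>\<^sub>0 complex) \<Rightarrow> bool" where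
  "tensor_eq p q \<longleftrightarrow> p - q \<in> tensor_null"

lemma tensor_null_add: "p \<in> tensor_null \<Longrightarrow> q \<in> tensor_null \<Longrightarrow> p + q \<in> tensor_null"
  unfolding tensor_null_def by (rule cvec.span_add)

lemma tensor_null_uminus: "p \<in> tensor_null \<Longrightarrow> - p \<in> tensor_null"
  unfolding tensor_null_def by (rule cvec.span_neg)

lemma tensor_null_scale: "p \<in> tensor_null \<Longrightarrow> c *\<^sub>C p \<in> tensor_null"
  unfolding tensor_null_def by (rule cvec.span_scale)

lemma tensor_null_zero: "0 \<in> tensor_null"
  unfolding tensor_null_def by (rule cvec.span_zero)

lemma equivp_tensor_eq:
  "equivp (tensor_eq :: ('a::complex_vector \<times> 'b::complex_vector \<Rightarrow>\<^sub>0 complex) \<Rightarrow> _)"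
proof (rule equivpI)
  show "reflp (tensor_eq :: ('a \<times> 'b \<Rightarrow>\<^sub>0 complex) \<Rightarrow> _)"
    by (auto simp: reflp_def tensor_eq_def tensor_null_zero)
  show "symp (tensor_eq :: ('a \<times> 'b \<Rightarrow>\<^sub>0 complex) \<Rightarrow> _)"
  proof (rule sympI)
    fix p q :: "('a \<times> 'b) \<Rightarrow>\<^sub>0 complex"
    assume "tensor_eq p q"
    then have "- (p - q) \<in> tensor_null"
      unfolding tensor_eq_def by (rule tensor_null_uminus)
    then show "tensor_eq q p"
      by (simp add: tensor_eq_def)
  qed
  show "transp (tensor_eq :: ('a \<times> 'b \<Rightarrow>\<^sub>0 complex) \<Rightarrow> _)"
  proof (rule transpI)
    fix p q r :: "('a \<times> 'b) \<Rightarrow>\<^sub>0 complex"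
    assume "tensor_eq p q" "tensor_eq q r"
    then have "(p - q) + (q - r) \<in> tensor_null"
      unfolding tensor_eq_def by (rule tensor_null_add)
    then show "tensor_eq p r"
      by (simp add: tensor_eq_def)
  qed
qed

lemma tensor_eq_add: "tensor_eq p p' \<Longrightarrow> tensor_eq q q' \<Longrightarrow> tensor_eq (p + q) (p' + q')"
  using tensor_null_add[of "p - p'" "q - q'"] by (simp add: tensor_eq_def add_diff_add)

lemma tensor_eq_uminus: "tensor_eq p q \<Longrightarrow> tensor_eq (- p) (- q)"
  using tensor_null_uminus[of "p - q"] by (simp add: tensor_eq_def)

lemma tensor_eq_scale: "tensor_eq p q \<Longrightarrow> tensor_eq (c *\<^sub>C p) (c *\<^sub>C q)"
  using tensor_null_scale[of "p - q" c] by (simp add: tensor_eq_def cvec.scale_right_diff_distrib)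

quotient_type (overloaded) ('a, 'b) tensor =
  "('a::complex_vector \<times> 'b::complex_vector) \<Rightarrow>\<^sub>0 complex" / tensor_eq
  by (rule equivp_tensor_eq)

instantiation tensor :: (complex_vector, complex_vector) complex_vector
begin

lift_definition zero_tensor :: "('a, 'b) tensor" is 0 .

lift_definition plus_tensor :: "('a, 'b) tensor \<Rightarrow> ('a, 'b) tensor \<Rightarrow> ('a, 'b) tensor" is "(+)"
  by (rule tensor_eq_add)

lift_definition uminus_tensor :: "('a, 'b) tensor \<Rightarrow> ('a, 'b) tensor" is uminus
  by (rule tensor_eq_uminus)

definition minus_tensor :: "('a, 'b) tensor \<Rightarrow> ('a, 'b) tensor \<Rightarrow> ('a, 'b) tensor" where
  "minus_tensor s t = s + (- t)"

lift_definition scaleC_tensor :: "complex \<Rightarrow> ('a, 'b) tensor \<Rightarrow> ('a, 'b) tensor" is scaleC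
  by (rule tensor_eq_scale)

instance
proof
  fix a b c :: "('a, 'b) tensor" and z w :: complex
  show "a + b + c = a + (b + c)"
    by transfer (simp add: tensor_eq_def add.assoc tensor_null_zero)
  show "a + b = b + a"
    by transfer (simp add: tensor_eq_def add.commute tensor_null_zero)
  show "0 + a = a"
    by transfer (simp add: tensor_eq_def tensor_null_zero)
  show "- a + a = 0"
    by transfer (simp add: tensor_eq_def tensor_null_zero)
  show "a - b = a + - b"
    by (simp add: minus_tensor_def)
  show "z *\<^sub>C (a + b) = z *\<^sub>C a + z *\<^sub>C b"
    by transfer (simp add: tensor_eq_def scaleC_add_right tensor_null_zero)
  show "(z + w) *\<^sub>C a = z *\<^sub>C a + w *\<^sub>C a"
    by transfer (simp add: tensor_eq_def scaleC_add_left tensor_null_zero)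
  show "z *\<^sub>C w *\<^sub>C a = (z * w) *\<^sub>C a"
    by transfer (simp add: tensor_eq_def tensor_null_zero)
  show "1 *\<^sub>C a = a"
    by transfer (simp add: tensor_eq_def tensor_null_zero)
qed

end

lift_definition pure_tensor :: "'a::complex_vector \<Rightarrow> 'b::complex_vector \<Rightarrow> ('a, 'b) tensor"
    (infixl "\<otimes>" 76)
  is "\<lambda>a b. Poly_Mapping.single (a, b) 1" .

text \<open>For subspaces \<open>A\<close> and \<open>B\<close>, the tensor product of \<open>A\<close> and \<open>B\<close> is identified with its image in
  the tensor product of the ambient spaces (the natural map is injective over a field).\<close>

definition tensor_of :: "'a::complex_vector set \<Rightarrow> 'b::complex_vector set \<Rightarrow> ('a, 'b) tensor set" where
  "tensor_of A B = cvec.span {a \<otimes> b | a b. a \<in> A \<and> b \<in> B}"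

definition tensor_expansion ::
    "'a::complex_vector set \<Rightarrow> ('a, 'a) tensor \<Rightarrow> ('a \<times> 'a) list \<Rightarrow> bool" where
  "tensor_expansion B t xs \<longleftrightarrow> set xs \<subseteq> B \<times> B \<and> t = (\<Sum>(b, c)\<leftarrow>xs. b \<otimes> c)"

section \<open>Differential bialgebras\<close>

text \<open>All structures are carried by a subset \<open>B\<close> of an ambient vector space; nothing is required of
  the operations outside \<open>B\<close>.\<close>

locale algebra_on =
  fixes B :: "'a::complex_vector set"
    and mul :: "'a \<Rightarrow> 'a \<Rightarrow> 'a"
    and one :: 'a
  assumes subspace_carrier: "cvec.subspace B"
    and one_closed: "one \<in> B"
    and mul_closed: "a \<in> B \<Longrightarrow> b \<in> B \<Longrightarrow> mul a b \<in> B"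
    and mul_linear_left: "b \<in> B \<Longrightarrow> linear_on B (\<lambda>a. mul a b)"
    and mul_linear_right: "a \<in> B \<Longrightarrow> linear_on B (mul a)"
    and mul_assoc: "a \<in> B \<Longrightarrow> b \<in> B \<Longrightarrow> c \<in> B \<Longrightarrow> mul (mul a b) c = mul a (mul b c)"
    and mul_one_left: "a \<in> B \<Longrightarrow> mul one a = a"
    and mul_one_right: "a \<in> B \<Longrightarrow> mul a one = a"

text \<open>The axioms on the comultiplication are written in Sweedler form, quantified over all expansions
  of the tensors involved. In coassociativity, \<open>D b\<close> is an expansion of \<open>\<Delta> b\<close>, and
  the two sides are compared after the identification of \<open>(p \<otimes> q) \<otimes> c\<close> with \<open>p \<otimes> (q \<otimes> c)\<close>.\<close>

locale coalgebra_on =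
  fixes B :: "'a::complex_vector set"
    and \<Delta> :: "'a \<Rightarrow> ('a, 'a) tensor"
    and \<epsilon> :: "'a \<Rightarrow> complex"
  assumes coalgebra_subspace_carrier: "cvec.subspace B"
    and comult_closed: "a \<in> B \<Longrightarrow> \<Delta> a \<in> tensor_of B B"
    and comult_linear: "linear_on B \<Delta>"
    and counit_linear: "linear_on B \<epsilon>"
    and coassoc: "a \<in> B \<Longrightarrow> tensor_expansion B (\<Delta> a) xs \<Longrightarrow>
        (\<And>b. b \<in> B \<Longrightarrow> tensor_expansion B (\<Delta> b) (D b)) \<Longrightarrow>
        (\<Sum>(b, c)\<leftarrow>xs. \<Sum>(p, q)\<leftarrow>D b. p \<otimes> (q \<otimes> c)) = (\<Sum>(b, c)\<leftarrow>xs. \<Sum>(p, q)\<leftarrow>D c. b \<otimes> (p \<otimes> q))"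
    and counit_left: "a \<in> B \<Longrightarrow> tensor_expansion B (\<Delta> a) xs \<Longrightarrow> (\<Sum>(b, c)\<leftarrow>xs. \<epsilon> b *\<^sub>C c) = a"
    and counit_right: "a \<in> B \<Longrightarrow> tensor_expansion B (\<Delta> a) xs \<Longrightarrow> (\<Sum>(b, c)\<leftarrow>xs. \<epsilon> c *\<^sub>C b) = a"

locale bialgebra_on = algebra_on B mul one + coalgebra_on B \<Delta> \<epsilon>
  for B :: "'a::complex_vector set" and mul one \<Delta> \<epsilon> +
  assumes comult_mul: "a \<in> B \<Longrightarrow> b \<in> B \<Longrightarrow>
        tensor_expansion B (\<Delta> a) xs \<Longrightarrow> tensor_expansion B (\<Delta> b) ys \<Longrightarrow>
        \<Delta> (mul a b) = (\<Sum>(p, q)\<leftarrow>xs. \<Sum>(r, s)\<leftarrow>ys. mul p r \<otimes> mul q s)"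
    and comult_one: "\<Delta> one = one \<otimes> one"
    and counit_mul: "a \<in> B \<Longrightarrow> b \<in> B \<Longrightarrow> \<epsilon> (mul a b) = \<epsilon> a * \<epsilon> b"
    and counit_one: "\<epsilon> one = 1"

locale differential_bialgebra_on = bialgebra_on B mul one \<Delta> \<epsilon>
  for B :: "'a::complex_vector set" and mul one \<Delta> \<epsilon> +
  fixes d :: "'a \<Rightarrow> 'a"
  assumes deriv_closed: "a \<in> B \<Longrightarrow> d a \<in> B"
    and deriv_linear: "linear_on B d"
    and deriv_mul: "a \<in> B \<Longrightarrow> b \<in> B \<Longrightarrow> d (mul a b) = mul (d a) b + mul a (d b)"
    and counit_deriv: "a \<in> B \<Longrightarrow> \<epsilon> (d a) = 0"
    and comult_deriv: "a \<in> B \<Longrightarrow> tensor_expansion B (\<Delta> a) xs \<Longrightarrow>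
        \<Delta> (d a) = (\<Sum>(b, c)\<leftarrow>xs. d b \<otimes> c + b \<otimes> d c)"

section \<open>Nonlocal vertex algebras and vertex operator algebras\<close>

text \<open>A series in \<open>V((x))\<close> is a function \<open>int \<Rightarrow> 'v\<close>, sending \<open>n\<close> to the coefficient of \<open>x\<^sup>n\<close>; a
  two-variable series sends \<open>p\<close> and \<open>q\<close> to the coefficient of \<open>x\<^sub>1\<^sup>p x\<^sub>2\<^sup>q\<close>. The vertex operator map is given by its modes:
  \<open>Y v n\<close> is the coefficient \<open>v\<^sub>n\<close> of \<open>x\<^bsup>-n-1\<^esup>\<close>. Infinite-looking sums are written with
  \<open>Sum_any\<close>; truncation makes them finite wherever they are used.\<close>

locale vertex_structure =
  fixes Y :: "'v::complex_vector \<Rightarrow> int \<Rightarrow> 'v \<Rightarrow> 'v"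
    and vac :: 'v
  assumes linear_state: "clinear (\<lambda>u. Y u n v)"
    and linear_arg: "clinear (Y u n)"
    and truncation: "\<exists>N. \<forall>n\<ge>N. Y u n v = 0"
    and vacuum: "Y vac n v = (if n = -1 then v else 0)"
    and creation_regular: "n \<ge> 0 \<Longrightarrow> Y v n vac = 0"
    and creation_limit: "Y v (-1) vac = v"

text \<open>Coefficients of \<open>x\<^sub>0\<^sup>p x\<^sub>2\<^sup>q\<close> in \<open>Y(u, x\<^sub>0 + x\<^sub>2) Y(v, x\<^sub>2) w\<close> and in \<open>Y(Y(u, x\<^sub>0)v, x\<^sub>2) w\<close>,
  and multiplication by \<open>(x\<^sub>0 + x\<^sub>2)\<^sup>l\<close>.\<close>

definition shifted_product_coeff ::
    "('v::complex_vector \<Rightarrow> int \<Rightarrow> 'v \<Rightarrow> 'v) \<Rightarrow> 'v \<Rightarrow> 'v \<Rightarrow> 'v \<Rightarrow> int \<Rightarrow> int \<Rightarrow> 'v" where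
  "shifted_product_coeff Y u v w p q =
    Sum_any (\<lambda>i::nat. ((of_int (p + int i) :: complex) gchoose i) *\<^sub>C
      Y u (- (p + int i) - 1) (Y v (- (q - int i) - 1) w))"

definition iterate_coeff ::
    "('v::complex_vector \<Rightarrow> int \<Rightarrow> 'v \<Rightarrow> 'v) \<Rightarrow> 'v \<Rightarrow> 'v \<Rightarrow> 'v \<Rightarrow> int \<Rightarrow> int \<Rightarrow> 'v" where
  "iterate_coeff Y u v w p q = Y (Y u (- p - 1) v) (- q - 1) w"

definition binomial_mult :: "nat \<Rightarrow> (int \<Rightarrow> int \<Rightarrow> 'v::complex_vector) \<Rightarrow> int \<Rightarrow> int \<Rightarrow> 'v" where
  "binomial_mult l F p q =
    (\<Sum>j\<le>l. (of_nat (l choose j) :: complex) *\<^sub>C F (p - int (l - j)) (q - int j))"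

locale nonlocal_vertex_algebra = vertex_structure Y vac
  for Y :: "'v::complex_vector \<Rightarrow> int \<Rightarrow> 'v \<Rightarrow> 'v" and vac +
  assumes weak_associativity:
    "\<exists>l. binomial_mult l (shifted_product_coeff Y u v w) = binomial_mult l (iterate_coeff Y u v w)"

text \<open>The \<open>V\<close>-submodules of \<open>V\<close> are the subspaces stable under all modes.\<close>

definition adjoint_irreducible :: "('v::complex_vector \<Rightarrow> int \<Rightarrow> 'v \<Rightarrow> 'v) \<Rightarrow> bool" where
  "adjoint_irreducible Y \<longleftrightarrow>
    (UNIV :: 'v set) \<noteq> {0} \<and>
    (\<forall>W. cvec.subspace W \<and> (\<forall>v n. \<forall>w\<in>W. Y v n w \<in> W) \<longrightarrow> W = {0} \<or> W = UNIV)"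

text \<open>The Jacobi identity in components: the coefficient of
  \<open>x\<^sub>0\<^bsup>-k-1\<^esup> x\<^sub>1\<^bsup>-m-1\<^esup> x\<^sub>2\<^bsup>-n-1\<^esup>\<close> of the delta-function identity.\<close>

locale vertex_algebra = vertex_structure Y vac
  for Y :: "'v::complex_vector \<Rightarrow> int \<Rightarrow> 'v \<Rightarrow> 'v" and vac +
  assumes jacobi:
    "Sum_any (\<lambda>i::nat. ((of_int m :: complex) gchoose i) *\<^sub>C
        Y (Y u (k + int i) v) (m + n - int i) w) =
     Sum_any (\<lambda>i::nat. ((-1) ^ i * ((of_int k :: complex) gchoose i)) *\<^sub>C
        (Y u (m + k - int i) (Y v (n + int i) w)
          - ((-1) powi k) *\<^sub>C Y v (n + k - int i) (Y u (m + int i) w)))"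

locale vertex_operator_algebra = vertex_algebra Y vac
  for Y :: "'v::complex_vector \<Rightarrow> int \<Rightarrow> 'v \<Rightarrow> 'v" and vac +
  fixes \<omega> :: 'v
  assumes virasoro: "\<exists>c. \<forall>m n v.
      Y \<omega> (m + 1) (Y \<omega> (n + 1) v) - Y \<omega> (n + 1) (Y \<omega> (m + 1) v) =
        of_int (m - n) *\<^sub>C Y \<omega> (m + n + 1) v +
        (if m + n = 0 then (of_int (m ^ 3 - m) / 12 * c) *\<^sub>C v else 0)"
    and L0_grading: "cvec.span (\<Union>n::int. {v. Y \<omega> 1 v = of_int n *\<^sub>C v}) = UNIV"
    and finite_dimensional: "\<exists>S. finite S \<and> {v. Y \<omega> 1 v = of_int (n::int) *\<^sub>C v} \<subseteq> cvec.span S"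
    and bounded_below: "\<exists>N::int. \<forall>n<N. {v. Y \<omega> 1 v = of_int n *\<^sub>C v} = {0}"
    and translation: "Y \<omega> 0 v = Y v (-2) vac"

section \<open>The differential algebra of Laurent endomorphisms\<close>

text \<open>\<open>V \<otimes> \<complex>((x))\<close> is identified with its image in \<open>V((x))\<close>, the span of the series \<open>f(x) v\<close>.\<close>

definition laurent_tensor :: "(int \<Rightarrow> 'v::complex_vector) set" where
  "laurent_tensor = cvec.span {(\<lambda>n. fls_nth f n *\<^sub>C v) | (f :: complex fls) v. True}"

text \<open>For \<open>a\<close> in \<open>Hom(V, V \<otimes> \<complex>((x)))\<close>, \<open>a v m\<close> is the coefficient of \<open>x\<^sup>m\<close> in \<open>a(x) v\<close>.\<close>

definition laurent_hom :: "('v::complex_vector \<Rightarrow> int \<Rightarrow> 'v) set" where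
  "laurent_hom = {a. clinear a \<and> (\<forall>v. a v \<in> laurent_tensor)}"

text \<open>Composition after \<open>\<complex>((x))\<close>-linear extension: \<open>a(x) (x\<^sup>l w) = x\<^sup>l a(x) w\<close>.\<close>

definition lh_mult ::
    "('v::complex_vector \<Rightarrow> int \<Rightarrow> 'v) \<Rightarrow> ('v \<Rightarrow> int \<Rightarrow> 'v) \<Rightarrow> 'v \<Rightarrow> int \<Rightarrow> 'v" where
  "lh_mult a b w m = Sum_any (\<lambda>l. a (b w l) (m - l))"

definition lh_one :: "'v::complex_vector \<Rightarrow> int \<Rightarrow> 'v" where
  "lh_one w m = (if m = 0 then w else 0)"

definition lh_deriv :: "('v::complex_vector \<Rightarrow> int \<Rightarrow> 'v) \<Rightarrow> 'v \<Rightarrow> int \<Rightarrow> 'v" where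
  "lh_deriv a w m = of_int (m + 1) *\<^sub>C a w (m + 1)"

text \<open>Coefficient of \<open>x\<^sub>1\<^sup>m x\<^sub>2\<^sup>n\<close> in \<open>Y(a(x\<^sub>1 - x\<^sub>2) v, x\<^sub>2) w\<close>: the coefficient of \<open>x\<^sub>1\<^sup>m x\<^sub>2\<^sup>i\<close>
  in \<open>(x\<^sub>1 - x\<^sub>2)\<^bsup>m+i\<^esup>\<close> is \<open>(-1)\<^sup>i (m+i choose i)\<close>.\<close>

definition Y_shift_coeff ::
    "('v::complex_vector \<Rightarrow> int \<Rightarrow> 'v \<Rightarrow> 'v) \<Rightarrow> ('v \<Rightarrow> int \<Rightarrow> 'v) \<Rightarrow> 'v \<Rightarrow> 'v \<Rightarrow> int \<Rightarrow> int \<Rightarrow> 'v" where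
  "Y_shift_coeff Y a v w m n =
    Sum_any (\<lambda>i::nat. ((-1) ^ i * ((of_int (m + int i) :: complex) gchoose i)) *\<^sub>C
      Y (a v (m + int i)) (- (n - int i) - 1) w)"

text \<open>Coefficient of \<open>x\<^sub>1\<^sup>m x\<^sub>2\<^sup>n\<close> in \<open>Y(a(x\<^sub>1 - x\<^sub>2) v, x\<^sub>2) b(x\<^sub>1) w\<close>.\<close>

definition Y_shift_comp_coeff ::
    "('v::complex_vector \<Rightarrow> int \<Rightarrow> 'v \<Rightarrow> 'v) \<Rightarrow> ('v \<Rightarrow> int \<Rightarrow> 'v) \<Rightarrow> ('v \<Rightarrow> int \<Rightarrow> 'v) \<Rightarrow>
      'v \<Rightarrow> 'v \<Rightarrow> int \<Rightarrow> int \<Rightarrow> 'v" where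
  "Y_shift_comp_coeff Y a b v w m n = Sum_any (\<lambda>l. Y_shift_coeff Y a v (b w l) (m - l) n)"

text \<open>\<open>a(x\<^sub>1) Y(v, x\<^sub>2) = \<Sum>\<^sub>i Y(b\<^sub>i(x\<^sub>1 - x\<^sub>2) v, x\<^sub>2) c\<^sub>i(x\<^sub>1)\<close> for all \<open>v\<close>, where \<open>xs\<close> lists the
  pairs \<open>(b\<^sub>i, c\<^sub>i)\<close>.\<close>

definition commutes_via ::
    "('v::complex_vector \<Rightarrow> int \<Rightarrow> 'v \<Rightarrow> 'v) \<Rightarrow> ('v \<Rightarrow> int \<Rightarrow> 'v) \<Rightarrow>
      (('v \<Rightarrow> int \<Rightarrow> 'v) \<times> ('v \<Rightarrow> int \<Rightarrow> 'v)) list \<Rightarrow> bool" where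
  "commutes_via Y a xs \<longleftrightarrow>
    (\<forall>v w m n. a (Y v (- n - 1) w) m = (\<Sum>(b, c)\<leftarrow>xs. Y_shift_comp_coeff Y b c v w m n))"

definition Delta_closed ::
    "('v::complex_vector \<Rightarrow> int \<Rightarrow> 'v \<Rightarrow> 'v) \<Rightarrow> ('v \<Rightarrow> int \<Rightarrow> 'v) set \<Rightarrow> bool" where
  "Delta_closed Y U \<longleftrightarrow> (\<forall>a\<in>U. \<exists>xs. set xs \<subseteq> U \<times> U \<and> commutes_via Y a xs)"

text \<open>\<open>a(x) \<one> = c \<one>\<close>, a series concentrated in degree 0.\<close>

definition vacuum_eigenvalue ::
    "'v::complex_vector \<Rightarrow> ('v \<Rightarrow> int \<Rightarrow> 'v) \<Rightarrow> complex \<Rightarrow> bool" where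
  "vacuum_eigenvalue vac a c \<longleftrightarrow> a vac = (\<lambda>m. if m = 0 then c *\<^sub>C vac else 0)"

definition BV ::
    "('v::complex_vector \<Rightarrow> int \<Rightarrow> 'v \<Rightarrow> 'v) \<Rightarrow> 'v \<Rightarrow> ('v \<Rightarrow> int \<Rightarrow> 'v) set" where
  "BV Y vac = cvec.span (\<Union>{U. cvec.subspace U \<and> U \<subseteq> laurent_hom \<and> Delta_closed Y U \<and>
      (\<forall>a\<in>U. \<exists>c. vacuum_eigenvalue vac a c)})"

text \<open>\<open>t = \<Sum> a\<^sub>(\<^sub>1\<^sub>) \<otimes> a\<^sub>(\<^sub>2\<^sub>)\<close> in \<open>B(V) \<otimes> B(V)\<close> satisfies
  \<open>a(x\<^sub>1) Y(v, x\<^sub>2) = \<Sum> Y(a\<^sub>(\<^sub>1\<^sub>)(x\<^sub>1 - x\<^sub>2) v, x\<^sub>2) a\<^sub>(\<^sub>2\<^sub>)(x\<^sub>1)\<close>; the right-hand side is bilinear in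
  the two factors, so the choice of expansion is immaterial.\<close>

definition comult_relation ::
    "('v::complex_vector \<Rightarrow> int \<Rightarrow> 'v \<Rightarrow> 'v) \<Rightarrow> 'v \<Rightarrow> ('v \<Rightarrow> int \<Rightarrow> 'v) \<Rightarrow>
      ('v \<Rightarrow> int \<Rightarrow> 'v, 'v \<Rightarrow> int \<Rightarrow> 'v) tensor \<Rightarrow> bool" where
  "comult_relation Y vac a t \<longleftrightarrow> (\<exists>xs. tensor_expansion (BV Y vac) t xs \<and> commutes_via Y a xs)"

definition PDer_minus ::
    "('v::complex_vector \<Rightarrow> int \<Rightarrow> 'v \<Rightarrow> 'v) \<Rightarrow> ('v \<Rightarrow> int \<Rightarrow> 'v) set" where
  "PDer_minus Y = {\<psi>\<in>laurent_hom. \<forall>v w m n.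
      \<psi> (Y v (- n - 1) w) m - Y v (- n - 1) (\<psi> w m) = Y_shift_coeff Y \<psi> v w m n}"

definition PEnd_minus ::
    "('v::complex_vector \<Rightarrow> int \<Rightarrow> 'v \<Rightarrow> 'v) \<Rightarrow> 'v \<Rightarrow> ('v \<Rightarrow> int \<Rightarrow> 'v) set" where
  "PEnd_minus Y vac = {\<phi>\<in>laurent_hom. \<phi> vac = lh_one vac \<and>
      (\<forall>v w m n. \<phi> (Y v (- n - 1) w) m = Y_shift_comp_coeff Y \<phi> \<phi> v w m n)}"

end

(* Everything is computed over the field C((x)): an element a(x) acts on V tensor
C((x)), and by Taylor expansion Y(s(x1 - x2), x2) t(x1) becomes, for each power of x2, a
finite sum of products of derivatives of s with t.

The comultiplication is well defined because V is nondegenerate: an irreducible V of countable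
dimension has only scalar endomorphisms (Schur), so by the density theorem the modes separate
linearly independent vectors. A relation sum h_ij(x) Y(v_i, x) w_j = 0 persists, by weak
associativity, when all v_i are replaced by u_m v_i; separating the v_i and moving one of them to the
vacuum gives sum_j h_ij(x) w_j = 0, hence h = 0. A vanishing sum of f(x1 - x2) g(x1) forces the
corresponding tensor of the f and g to vanish.

For coassociativity, a(x) is applied to both sides of the weak associativity relation between
Y(u, x0 + x2) Y(v, x2) w and Y(Y(u, x0) v, x2) w, and the power of x0 + x2 is cancelled. *)
theory Submission
  imports Defs "HOL-Analysis.Continuum_Not_Denumerable"
    "HOL-Computational_Algebra.Fundamental_Theorem_Algebra"
begin

text \<open>A Taylor expansion of s(x1 - x2) is finite in each power of x2 only because an element
  of V tensor C((x)) involves finitely many vectors, so that one truncation bound serves all powers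
  of x1. The bounds mostly stay implicit: an expansion is stated for all large I, several of them
  are brought to a common length and compared term by term, and a conclusion that does not mention I
  then holds outright.

  The obstacle is the cancellation of powers of x0 + x2, since a doubly infinite series can be
  killed by x0 + x2. It is sound for series whose powers of x0 are bounded below. Iterates Y(Y(u,
  x0)v, x2)w have this property, products Y(u, x0 + x2)Y(v, x2)w in general do not. Both
  cancellations are therefore arranged to concern iterates alone: one combination vanishes, or two
  agree.

  Existence of a coproduct is built into B(V); uniqueness has to be proved. Compatibility with
  product, unit and derivation then follows by writing down an expansion that satisfies the defining
  relation.\<close>

unbundle fps_syntax

text \<open>These rules are not simp rules here: unification eta-expands series, and a sum of series would
  then be rewritten to its pointwise form.\<close>

lemmas fun_ops = plus_fun_apply zero_fun_apply

declare plus_fun_apply [simp del] zero_fun_apply [simp del]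

section \<open>Hasse derivatives of Laurent series\<close>

text \<open>The divided-power derivative: f(x + y) is the sum of \<open>hasse i f\<close> times y^i.
  This normalisation frees Leibniz' rule of binomial coefficients.\<close>

definition hasse :: "nat \<Rightarrow> complex fls \<Rightarrow> complex fls" where
  "hasse i f = fls_const (1 / fact i) * (fls_deriv ^^ i) f"

lemma hasse_0 [simp]: "hasse 0 f = f"
  by (simp add: hasse_def)

lemma fls_deriv_power_nth:
  "((fls_deriv ^^ i) f) $$ m = pochhammer (of_int m + 1) i * f $$ (m + int i)"
  for f :: "complex fls"
proof (induction i arbitrary: m)
  case (Suc i)
  show ?case
    by (simp add: Suc pochhammer_rec algebra_simps)
qed simp

lemma hasse_nth: "hasse i f $$ m = (of_int (m + int i) gchoose i) * f $$ (m + int i)"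
  by (simp add: hasse_def fls_deriv_power_nth gbinomial_pochhammer')

lemma hasse_const: "hasse i (fls_const c) = (if i = 0 then fls_const c else 0)"
proof (rule fls_eqI)
  fix m
  have "(of_int (m + int i) :: complex) gchoose i = 0" if "m + int i = 0" "i \<noteq> 0"
    unfolding that(1) using that(2) by (cases i) simp_all
  then show "hasse i (fls_const c) $$ m = (if i = 0 then fls_const c else 0) $$ m"
    by (auto simp: hasse_nth simp del: of_int_add)
qed

lemma hasse_const_mult: "hasse i (fls_const c * f) = fls_const c * hasse i f"
  by (rule fls_eqI) (simp add: hasse_nth)

lemma deriv_hasse: "fls_deriv (hasse i f) = of_nat (Suc i) * hasse (Suc i) f"
proof -
  have "fls_const (1 / fact i) = (of_nat (Suc i) * fls_const (1 / fact (Suc i)) :: complex fls)"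
    by (subst fls_of_nat) (simp add: divide_simps del: of_nat_Suc)
  then show ?thesis
    by (simp add: hasse_def mult.assoc del: of_nat_Suc fact_Suc)
qed

lemma hasse_deriv: "hasse i (fls_deriv f) = fls_deriv (hasse i f)"
  by (simp add: hasse_def flip: funpow_swap1)

text \<open>Differentiating the rule for n weights the term with i derivatives on f once by i and
  once by n + 1 - i; the common total n + 1 cancels in characteristic 0.\<close>

lemma hasse_mult: "hasse n (f * g) = (\<Sum>i\<le>n. hasse i f * hasse (n - i) g)"
proof (induction n)
  case (Suc n)
  have "of_nat (Suc n) * hasse (Suc n) (f * g) = fls_deriv (hasse n (f * g))"
    by (rule deriv_hasse [symmetric])
  also have "\<dots> = (\<Sum>i\<le>n. fls_deriv (hasse i f * hasse (n - i) g))"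
    unfolding Suc.IH by (rule fls_deriv_sum)
  also have "\<dots> = (\<Sum>i\<le>n. of_nat (Suc i) * (hasse (Suc i) f * hasse (n - i) g))
      + (\<Sum>i\<le>n. of_nat (Suc n - i) * (hasse i f * hasse (Suc n - i) g))"
    by (subst sum.distrib [symmetric], rule sum.cong)
       (simp_all add: deriv_hasse Suc_diff_le algebra_simps del: of_nat_Suc)
  also have "(\<Sum>i\<le>n. of_nat (Suc i) * (hasse (Suc i) f * hasse (n - i) g))
      = (\<Sum>i\<le>Suc n. of_nat i * (hasse i f * hasse (Suc n - i) g))"
    by (subst sum.atMost_Suc_shift) simp
  also have "(\<Sum>i\<le>n. of_nat (Suc n - i) * (hasse i f * hasse (Suc n - i) g))
      = (\<Sum>i\<le>Suc n. of_nat (Suc n - i) * (hasse i f * hasse (Suc n - i) g))"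
    by simp
  also have "(\<Sum>i\<le>Suc n. of_nat i * (hasse i f * hasse (Suc n - i) g)) + \<dots>
      = (\<Sum>i\<le>Suc n. of_nat (Suc n) * (hasse i f * hasse (Suc n - i) g))"
    unfolding sum.distrib [symmetric]
    by (rule sum.cong) (auto simp del: of_nat_Suc simp flip: distrib_right of_nat_add)
  finally have "of_nat (Suc n) * hasse (Suc n) (f * g)
      = of_nat (Suc n) * (\<Sum>i\<le>Suc n. hasse i f * hasse (Suc n - i) g)"
    by (simp only: sum_distrib_left)
  then show ?case
    by (simp del: of_nat_Suc)
qed simp

text \<open>This binomial coefficient later reassembles the powers of x0 + x3 in
  \<open>iterF_gen\<close>.\<close>

lemma hasse_hasse: "hasse j (hasse i f) = of_nat ((i + j) choose i) * hasse (i + j) f"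
proof -
  have *: "(fls_deriv ^^ j) (fls_const c * g) = fls_const c * (fls_deriv ^^ j) g" for c and g :: "complex fls"
    by (induction j) simp_all
  have c: "fls_const (1 / fact j) * fls_const (1 / fact i)
      = (of_nat ((i + j) choose i) * fls_const (1 / fact (i + j)) :: complex fls)"
    by (subst fls_of_nat) (simp add: binomial_fact mult.commute)
  show ?thesis
    unfolding hasse_def * using c
    by (simp add: funpow_add add.commute [of i j] mult.assoc [symmetric])
qed

lemma fls_bounded_below:
  fixes f :: "complex fls"
  obtains L where "\<And>m. m < L \<Longrightarrow> f $$ m = 0"
  using fls_nth_vanishes_belowE by blast

lemma finite_int_between: "(\<And>l. l \<in> A \<Longrightarrow> L \<le> l \<and> l \<le> U) \<Longrightarrow> finite A" for L U :: int
  by (rule finite_subset [of _ "{L..U}"]) auto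

lemma finite_fls_product:
  fixes f :: "complex fls"
  assumes "\<And>m. m < L \<Longrightarrow> h m = 0"
  shows "finite {l::int. f $$ l \<noteq> 0 \<and> h (m - l) \<noteq> 0}"
proof -
  obtain K where K: "\<And>m. m < K \<Longrightarrow> f $$ m = 0"
    using fls_bounded_below [of f] by blast
  show ?thesis
    by (rule finite_int_between [of _ K "m - L"]) (use assms K in force)
qed

lemma finite_fls_times: "finite {l. f $$ (m - l) \<noteq> 0 \<and> g $$ l \<noteq> 0}"
  for f g :: "complex fls"
proof -
  obtain K where K: "\<And>m. m < K \<Longrightarrow> f $$ m = 0"
    using fls_bounded_below [of f] by blast
  then show ?thesis
    using finite_fls_product [of K "fls_nth f" g m] by (simp add: conj_commute)
qed

lemma fls_times_nth_Sum_any: "(f * g) $$ m = Sum_any (\<lambda>l. f $$ (m - l) * g $$ l)"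
  for f g :: "complex fls"
proof -
  have "Sum_any (\<lambda>l. f $$ (m - l) * g $$ l)
      = (\<Sum>l = fls_subdegree g..m - fls_subdegree f. f $$ (m - l) * g $$ l)"
    by (rule Sum_any.expand_superset)
       (auto, (meson linorder_not_less fls_eq0_below_subdegree | smt (verit) fls_eq0_below_subdegree)+)
  also have "\<dots> = (\<Sum>l = fls_subdegree f..m - fls_subdegree g. f $$ l * g $$ (m - l))"
    by (rule sum.reindex_bij_witness [of _ "\<lambda>l. m - l" "\<lambda>l. m - l"]) auto
  finally show ?thesis
    by (simp add: fls_times_nth(2))
qed

lemma scaleC_fun_apply: "(c *\<^sub>C f) x = c *\<^sub>C f x"
  by (simp add: scaleC_fun_def)

section \<open>Series in one variable with coefficients in \<open>V\<close>\<close>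

text \<open>The series f(x)v. Partially applied, \<open>gen f\<close> is itself a Laurent
  endomorphism, multiplication by f(x), so scalars and operators act through the same
  \<open>act\<close>.\<close>

definition gen :: "complex fls \<Rightarrow> 'v::complex_vector \<Rightarrow> int \<Rightarrow> 'v" where
  "gen f v = (\<lambda>n. fls_nth f n *\<^sub>C v)"

definition deriv :: "(int \<Rightarrow> 'v::complex_vector) \<Rightarrow> int \<Rightarrow> 'v" where
  "deriv s m = of_int (m + 1) *\<^sub>C s (m + 1)"

lemma gen_nth: "gen f v m = fls_nth f m *\<^sub>C v"
  by (simp add: gen_def)

lemma gen_add_left: "gen (f + g) v = gen f v + gen g v"
  by (simp add: gen_def fun_eq_iff fun_ops scaleC_add_left)

lemma gen_add_right: "gen f (v + w) = gen f v + gen f w"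
  by (simp add: gen_def fun_eq_iff fun_ops scaleC_add_right)

lemma gen_0_left [simp]: "gen 0 v = 0"
  by (simp add: gen_def fun_eq_iff fun_ops)

lemma gen_0_right [simp]: "gen f 0 = 0"
  by (simp add: gen_def fun_eq_iff fun_ops)

lemma gen_sum_left: "gen (\<Sum>i\<in>A. f i) v = (\<Sum>i\<in>A. gen (f i) v)"
  by (induction A rule: infinite_finite_induct) (simp_all add: gen_add_left)

lemma gen_sum_right: "gen f (\<Sum>i\<in>A. v i) = (\<Sum>i\<in>A. gen f (v i))"
  by (induction A rule: infinite_finite_induct) (simp_all add: gen_add_right)

lemma gen_scaleC_right: "gen f (c *\<^sub>C v) = gen (fls_const c * f) v"
  by (simp add: gen_def fun_eq_iff fun_ops scaleC_scaleC mult.commute)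

lemma scaleC_gen: "c *\<^sub>C gen f v = gen (fls_const c * f) v"
  by (simp add: gen_def fun_eq_iff fun_ops scaleC_scaleC scaleC_fun_apply)

lemma clinearI:
  "(\<And>x y. f (x + y) = f x + f y) \<Longrightarrow> (\<And>c x. f (c *\<^sub>C x) = c *\<^sub>C f x) \<Longrightarrow> clinear f"
  by (simp add: Vector_Spaces.linear_def module_hom_def module_hom_axioms_def
    cvec.vector_space_axioms cvec.module_axioms)

lemma clinear_gen: "clinear (gen f)"
  by (rule clinearI) (simp_all add: gen_add_right gen_scaleC_right scaleC_gen)

lemma deriv_gen: "deriv (gen f v) = gen (fls_deriv f) v"
  by (simp add: deriv_def gen_def fun_eq_iff fun_ops scaleC_scaleC)

lemma deriv_add: "deriv (s + t) = deriv s + deriv t"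
  by (simp add: deriv_def fun_eq_iff fun_ops scaleC_add_right)

lemma deriv_0 [simp]: "deriv 0 = 0"
  by (simp add: deriv_def fun_eq_iff fun_ops)

lemma deriv_scaleC: "deriv (c *\<^sub>C s) = c *\<^sub>C deriv s"
  by (simp add: deriv_def fun_eq_iff fun_ops scaleC_scaleC scaleC_fun_apply mult.commute)

lemma deriv_sum: "deriv (\<Sum>i\<in>A. s i) = (\<Sum>i\<in>A. deriv (s i))"
  by (induction A rule: infinite_finite_induct) (simp_all add: deriv_add)

lemma subspace_laurent_tensor: "cvec.subspace laurent_tensor"
  unfolding laurent_tensor_def by (rule cvec.subspace_span)

lemma gen_in [simp]: "gen f v \<in> laurent_tensor"
  unfolding laurent_tensor_def gen_def by (rule cvec.span_base) auto

lemma laurent_tensor_add [simp]: "s \<in> laurent_tensor \<Longrightarrow> t \<in> laurent_tensor \<Longrightarrow> s + t \<in> laurent_tensor"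
  using subspace_laurent_tensor by (rule cvec.subspace_add)

lemma laurent_tensor_0 [simp]: "0 \<in> laurent_tensor"
  using subspace_laurent_tensor by (rule cvec.subspace_0)

lemma laurent_tensor_scaleC [simp]: "s \<in> laurent_tensor \<Longrightarrow> c *\<^sub>C s \<in> laurent_tensor"
  using subspace_laurent_tensor by (rule cvec.subspace_scale)

lemma laurent_tensor_sum: "(\<And>i. i \<in> A \<Longrightarrow> s i \<in> laurent_tensor) \<Longrightarrow> (\<Sum>i\<in>A. s i) \<in> laurent_tensor"
  using subspace_laurent_tensor by (rule cvec.subspace_sum)

lemma laurent_tensor_sum_list: "(\<And>x. x \<in> set xs \<Longrightarrow> s x \<in> laurent_tensor) \<Longrightarrow> (\<Sum>x\<leftarrow>xs. s x) \<in> laurent_tensor"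
  by (induction xs) simp_all

text \<open>There is no case for scalar multiples: a scalar is absorbed into the Laurent series f of
  a generator.\<close>

lemma laurent_tensor_induct [consumes 1, case_names zero add gen]:
  assumes "s \<in> laurent_tensor"
    and "P 0"
    and "\<And>s t. s \<in> laurent_tensor \<Longrightarrow> t \<in> laurent_tensor \<Longrightarrow> P s \<Longrightarrow> P t \<Longrightarrow> P (s + t)"
    and "\<And>f v. P (gen f v)"
  shows "P s"
proof -
  have "s \<in> cvec.span {gen f v | f v. True}"
    using assms(1) by (simp add: laurent_tensor_def gen_def)
  then have "s \<in> laurent_tensor \<and> P s"
  proof (induction rule: cvec.span_induct_alt)
    case (step c x y)
    then obtain f v where "x = gen f v"
      by blast
    then show ?case
      using step assms(3) assms(4) by (simp add: scaleC_gen)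
  qed (simp add: assms(2))
  then show ?thesis ..
qed

lemma deriv_in [simp]: "s \<in> laurent_tensor \<Longrightarrow> deriv s \<in> laurent_tensor"
  by (induction rule: laurent_tensor_induct) (simp_all add: deriv_add deriv_gen)

lemma laurent_tensor_bounded_below:
  assumes "s \<in> laurent_tensor"
  shows "\<exists>L. \<forall>m<L. s m = 0"
  using assms
proof (induction rule: laurent_tensor_induct)
  case (add s t)
  then obtain K L where "\<forall>m<K. s m = 0" "\<forall>m<L. t m = 0"
    by blast
  then show ?case
    by (intro exI [of _ "min K L"]) (simp add: fun_ops)
next
  case (gen f v)
  show ?case
    using fls_bounded_below [of f] by (metis gen_nth cvec.scale_zero_left)
qed (simp add: fun_ops)

section \<open>The action of Laurent endomorphisms\<close>

text \<open>Application of a(x), extended linearly over C((x)). \<open>Sum_any\<close> returns 0 on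
  an infinite support, so the rules below carry the hypotheses that make \<open>finite_act\<close>
  available.\<close>

definition act :: "('v::complex_vector \<Rightarrow> int \<Rightarrow> 'v) \<Rightarrow> (int \<Rightarrow> 'v) \<Rightarrow> int \<Rightarrow> 'v" where
  "act a s m = Sum_any (\<lambda>l. a (s l) (m - l))"

lemma lh_mult_eq: "lh_mult a b w = act a (b w)"
  by (simp add: lh_mult_def act_def fun_eq_iff fun_ops)

lemma lh_deriv_eq: "lh_deriv a w = deriv (a w)"
  by (simp add: lh_deriv_def deriv_def fun_eq_iff fun_ops)

lemma lh_one_eq: "lh_one w = gen 1 w"
  by (simp add: lh_one_def gen_def fun_eq_iff fun_ops)

lemma laurent_homD: "a \<in> laurent_hom \<Longrightarrow> a v \<in> laurent_tensor"
  by (simp add: laurent_hom_def)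

lemma laurent_hom_clinear: "a \<in> laurent_hom \<Longrightarrow> clinear a"
  by (simp add: laurent_hom_def)

lemma clinear_add: "clinear f \<Longrightarrow> f (x + y) = f x + f y"
  by (simp add: Vector_Spaces.linear_def module_hom_def module_hom_axioms_def)

lemma clinear_scaleC: "clinear f \<Longrightarrow> f (c *\<^sub>C x) = c *\<^sub>C f x"
  by (simp add: Vector_Spaces.linear_def module_hom_def module_hom_axioms_def)

lemma clinear_0: "clinear f \<Longrightarrow> f 0 = 0"
  using clinear_scaleC [of f 0 0] by simp

lemma clinear_sum: "clinear f \<Longrightarrow> f (\<Sum>i\<in>A. x i) = (\<Sum>i\<in>A. f (x i))"
  by (induction A rule: infinite_finite_induct) (simp_all add: clinear_0 clinear_add)

lemma clinear_sum_list: "clinear f \<Longrightarrow> f (\<Sum>i\<leftarrow>xs. x i) = (\<Sum>i\<leftarrow>xs. f (x i))"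
  by (induction xs) (simp_all add: clinear_0 clinear_add)

lemma gen_laurent_hom [simp]: "gen f \<in> laurent_hom"
  by (simp add: laurent_hom_def clinear_gen)

lemma finite_act:
  assumes a: "a \<in> laurent_hom" and "s \<in> laurent_tensor"
  shows "finite {l. a (s l) (m - l) \<noteq> 0}"
  using assms(2)
proof (induction rule: laurent_tensor_induct)
  case zero
  show ?case
    by (simp add: clinear_0 laurent_hom_clinear [OF a] fun_ops)
next
  case (add s t)
  show ?case
    by (rule finite_subset [OF _ finite_UnI [OF add(3,4)]])
       (auto simp: clinear_add laurent_hom_clinear [OF a] fun_ops)
next
  case (gen f v)
  obtain L where "\<forall>m<L. a v m = 0"
    using laurent_tensor_bounded_below [OF laurent_homD [OF a]] by blast
  then have "finite {l. f $$ l \<noteq> 0 \<and> a v (m - l) \<noteq> 0}"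
    by (intro finite_fls_product [of L]) simp
  then show ?case
    by (rule rev_finite_subset)
       (auto simp: gen_nth clinear_scaleC [OF laurent_hom_clinear [OF a]] scaleC_fun_apply)
qed

lemma act_add:
  assumes "a \<in> laurent_hom" "s \<in> laurent_tensor" "t \<in> laurent_tensor"
  shows "act a (s + t) = act a s + act a t"
  using assms
  by (simp add: act_def fun_eq_iff fun_ops clinear_add laurent_hom_clinear Sum_any.distrib finite_act)

lemma act_0 [simp]: "a \<in> laurent_hom \<Longrightarrow> act a 0 = 0"
  by (simp add: act_def fun_eq_iff fun_ops clinear_0 laurent_hom_clinear)

lemma act_gen_gen: "act (gen f) (gen g v) = gen (f * g) v"
proof
  fix m
  have "act (gen f) (gen g v) m = Sum_any (\<lambda>l. (f $$ (m - l) * g $$ l) *\<^sub>C v)"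
    by (simp add: act_def gen_nth scaleC_scaleC)
  also have "\<dots> = (\<Sum>l | f $$ (m - l) * g $$ l \<noteq> 0. (f $$ (m - l) * g $$ l) *\<^sub>C v)"
    by (rule Sum_any.expand_superset) (auto simp: finite_fls_times)
  also have "\<dots> = gen (f * g) v m"
    by (simp add: gen_nth fls_times_nth_Sum_any Sum_any.expand_set cvec.scale_sum_left)
  finally show "act (gen f) (gen g v) m = gen (f * g) v m" .
qed

lemma act_gen_right: "a \<in> laurent_hom \<Longrightarrow> act a (gen f v) = act (gen f) (a v)"
proof
  fix m
  assume a: "a \<in> laurent_hom"
  have "act a (gen f v) m = Sum_any (\<lambda>l. (f $$ l) *\<^sub>C a v (m - l))"
    by (simp add: act_def gen_nth clinear_scaleC [OF laurent_hom_clinear [OF a]] scaleC_fun_apply)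
  also have "\<dots> = Sum_any (\<lambda>l. (f $$ (m - l)) *\<^sub>C a v l)"
    by (rule Sum_any.reindex_cong [of "\<lambda>l. m - l"])
       (auto intro!: bij_betw_byWitness [where f' = "\<lambda>l. m - l"])
  finally show "act a (gen f v) m = act (gen f) (a v) m"
    by (simp add: act_def gen_nth)
qed

lemma act_sum:
  "a \<in> laurent_hom \<Longrightarrow> (\<And>i. i \<in> A \<Longrightarrow> s i \<in> laurent_tensor) \<Longrightarrow> act a (\<Sum>i\<in>A. s i) = (\<Sum>i\<in>A. act a (s i))"
  by (induction A rule: infinite_finite_induct) (simp_all add: act_add laurent_tensor_sum)

lemma act_sum_list:
  "a \<in> laurent_hom \<Longrightarrow> (\<And>x. x \<in> set xs \<Longrightarrow> s x \<in> laurent_tensor) \<Longrightarrow> act a (\<Sum>x\<leftarrow>xs. s x) = (\<Sum>x\<leftarrow>xs. act a (s x))"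
  by (induction xs) (simp_all add: act_add laurent_tensor_sum_list)

lemma act_in [simp]:
  assumes a: "a \<in> laurent_hom" and "s \<in> laurent_tensor"
  shows "act a s \<in> laurent_tensor"
proof -
  \<comment> \<open>Multiplication by f(x) comes first: \<open>act_gen_right\<close> reduces a
    general a to it.\<close>
  have *: "act (gen f) t \<in> laurent_tensor" if "t \<in> laurent_tensor" for f and t :: "int \<Rightarrow> 'a"
    using that by (induction rule: laurent_tensor_induct) (simp_all add: act_add act_gen_gen)
  show ?thesis
    using assms(2)
    by (induction rule: laurent_tensor_induct)
       (simp_all add: a act_add act_gen_right * laurent_homD)
qed

lemma act_mult_gen: "s \<in> laurent_tensor \<Longrightarrow> act (gen (f * g)) s = act (gen f) (act (gen g) s)"
  by (induction rule: laurent_tensor_induct) (simp_all add: act_add act_gen_gen mult.assoc)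

lemma act_gen_commute:
  assumes a: "a \<in> laurent_hom" and "s \<in> laurent_tensor"
  shows "act a (act (gen f) s) = act (gen f) (act a s)"
  using assms(2)
  by (induction rule: laurent_tensor_induct)
     (simp_all add: a act_add act_gen_gen act_gen_right act_mult_gen laurent_homD)

lemma act_const: "s \<in> laurent_tensor \<Longrightarrow> act (gen (fls_const c)) s = c *\<^sub>C s"
  by (induction rule: laurent_tensor_induct)
     (simp_all add: act_add act_gen_gen scaleC_gen scaleC_add_right)

lemma act_one: "s \<in> laurent_tensor \<Longrightarrow> act (gen 1) s = s"
  using act_const [of s 1] by (simp add: scaleC_one)

lemma act_scaleC: "a \<in> laurent_hom \<Longrightarrow> s \<in> laurent_tensor \<Longrightarrow> act a (c *\<^sub>C s) = c *\<^sub>C act a s"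
  using act_gen_commute [of a s "fls_const c"] by (simp add: act_const)

lemma act_lh_mult:
  assumes a: "a \<in> laurent_hom" and b: "b \<in> laurent_hom" and "s \<in> laurent_tensor"
  shows "act (\<lambda>w. act a (b w)) s = act a (act b s)" and "(\<lambda>w. act a (b w)) \<in> laurent_hom"
proof -
  show h: "(\<lambda>w. act a (b w)) \<in> laurent_hom"
    unfolding laurent_hom_def
    by (auto intro!: clinearI simp: a b laurent_homD act_add act_scaleC clinear_add clinear_scaleC
      laurent_hom_clinear)
  show "act (\<lambda>w. act a (b w)) s = act a (act b s)"
    using assms(3)
    by (induction rule: laurent_tensor_induct)
       (simp_all add: a b h act_add act_gen_right act_gen_commute laurent_homD)
qed

lemma deriv_act_gen:
  "s \<in> laurent_tensor \<Longrightarrow> deriv (act (gen f) s) = act (gen (fls_deriv f)) s + act (gen f) (deriv s)"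
  by (induction rule: laurent_tensor_induct)
     (simp_all add: act_add act_gen_gen deriv_add deriv_gen gen_add_left algebra_simps)

lemma lh_deriv_laurent_hom: "a \<in> laurent_hom \<Longrightarrow> (\<lambda>w. deriv (a w)) \<in> laurent_hom"
  unfolding laurent_hom_def
  by (auto intro!: clinearI simp: deriv_add deriv_scaleC clinear_add clinear_scaleC)

lemma deriv_act:
  assumes a: "a \<in> laurent_hom" and "s \<in> laurent_tensor"
  shows "deriv (act a s) = act (\<lambda>w. deriv (a w)) s + act a (deriv s)"
  using assms(2)
  by (induction rule: laurent_tensor_induct)
     (simp_all add: a act_add deriv_add act_gen_right lh_deriv_laurent_hom deriv_act_gen laurent_homD deriv_gen
       algebra_simps)

lemma act_add_left:
  assumes "a \<in> laurent_hom" "b \<in> laurent_hom" "s \<in> laurent_tensor"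
  shows "act (a + b) s = act a s + act b s"
  using assms by (simp add: act_def fun_eq_iff fun_ops Sum_any.distrib finite_act)

lemma subspace_laurent_hom: "cvec.subspace laurent_hom"
  unfolding cvec.subspace_def laurent_hom_def
  by (auto intro!: clinearI simp: clinear_add clinear_scaleC scaleC_fun_apply fun_ops scaleC_add_right
    algebra_simps scaleC_scaleC mult.commute)

lemma act_scaleC_left:
  assumes a: "a \<in> laurent_hom" and "s \<in> laurent_tensor"
  shows "act (c *\<^sub>C a) s = c *\<^sub>C act a s"
  using assms(2)
proof (induction rule: laurent_tensor_induct)
  have ca: "c *\<^sub>C a \<in> laurent_hom"
    using subspace_laurent_hom a by (rule cvec.subspace_scale)
  note lin = act_add [OF a] act_add [OF ca]
  {
    case zero
    show ?case
      by (simp add: a ca)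
  next
    case (add s t)
    then show ?case
      by (simp add: lin scaleC_add_right)
  next
    case (gen f v)
    show ?case
      unfolding act_gen_right [OF ca] act_gen_right [OF a]
      by (simp add: scaleC_fun_apply laurent_homD [OF a] act_scaleC)
  }
qed

section \<open>Shifted products\<close>

abbreviation alt :: "nat \<Rightarrow> complex fls" where
  "alt i \<equiv> fls_const ((-1) ^ i)"

abbreviation ichoose :: "int \<Rightarrow> nat \<Rightarrow> complex" where
  "ichoose n i \<equiv> of_int n gchoose i"

text \<open>\<open>sh Y s t n\<close> is the coefficient of \<open>x\<^sub>2\<^bsup>-n-1\<^esup>\<close> in \<open>Y(s(x\<^sub>1 - x\<^sub>2), x\<^sub>2) t(x\<^sub>1)\<close>, a series in \<open>x\<^sub>1\<close>.\<close>

definition shiftY :: "('v::complex_vector \<Rightarrow> int \<Rightarrow> 'v \<Rightarrow> 'v) \<Rightarrow> (int \<Rightarrow> 'v) \<Rightarrow> int \<Rightarrow> 'v \<Rightarrow> int \<Rightarrow> 'v" where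
  "shiftY Y s n w m = Sum_any (\<lambda>i::nat. ((-1) ^ i * (ichoose (m + int i) i)) *\<^sub>C
      Y (s (m + int i)) (n + int i) w)"

definition sh :: "('v::complex_vector \<Rightarrow> int \<Rightarrow> 'v \<Rightarrow> 'v) \<Rightarrow> (int \<Rightarrow> 'v) \<Rightarrow> (int \<Rightarrow> 'v) \<Rightarrow> int \<Rightarrow> int \<Rightarrow> 'v" where
  "sh Y s t n = act (shiftY Y s n) t"

lemma Y_shift_coeff_eq: "Y_shift_coeff Y a v w m (- n - 1) = shiftY Y (a v) n w m"
  by (simp add: Y_shift_coeff_def shiftY_def algebra_simps)

lemma Y_shift_comp_coeff_eq: "Y_shift_comp_coeff Y b c v w m (- n - 1) = sh Y (b v) (c w) n m"
  by (simp add: Y_shift_comp_coeff_def Y_shift_coeff_eq sh_def act_def)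

text \<open>The definitions number coefficients by the exponent of x2, the proofs by modes; the
  involution n to -n - 1 exchanges the two.\<close>

lemma all_int_reflect: "(\<forall>n::int. P (- n - 1)) \<longleftrightarrow> (\<forall>n. P n)"
  by (metis add.inverse_inverse add_diff_cancel diff_conv_add_uminus minus_diff_eq add_diff_cancel_left' uminus_add_conv_diff)

lemma sum_list_apply: "(\<Sum>x\<leftarrow>xs. f x) m = (\<Sum>x\<leftarrow>xs. f x m)"
  for f :: "'a \<Rightarrow> 'b \<Rightarrow> 'c::ab_group_add"
  by (induction xs) (simp_all add: fun_ops)

lemma sum_apply: "(\<Sum>x\<in>A. f x) m = (\<Sum>x\<in>A. f x m)"
  for f :: "'a \<Rightarrow> 'b \<Rightarrow> 'c::ab_group_add"
  by (induction A rule: infinite_finite_induct) (simp_all add: fun_ops)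

lemma commutes_via_eq:
  "commutes_via Y a xs \<longleftrightarrow> (\<forall>v w n. a (Y v n w) = (\<Sum>(b, c)\<leftarrow>xs. sh Y (b v) (c w) n))"
proof -
  have "commutes_via Y a xs \<longleftrightarrow>
      (\<forall>v w m n. a (Y v n w) m = (\<Sum>(b, c)\<leftarrow>xs. Y_shift_comp_coeff Y b c v w m (- n - 1)))"
    unfolding commutes_via_def
    by (subst all_int_reflect [symmetric, of "\<lambda>n. a (Y _ n _) _ = _ n"]) simp
  then show ?thesis
    by (auto simp: fun_eq_iff Y_shift_comp_coeff_eq sum_list_apply split_def)
qed

text \<open>A square truncation comes from two separate expansions, a triangle from a product rule;
  they differ by terms with p + q at least I.\<close>

lemma sum_triangle:
  fixes X :: "nat \<Rightarrow> nat \<Rightarrow> 'a::comm_monoid_add"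
  assumes "\<And>p q. p + q \<ge> I \<Longrightarrow> X p q = 0"
  shows "(\<Sum>p<I. \<Sum>q<I. X p q) = (\<Sum>i<I. \<Sum>p\<le>i. X p (i - p))"
proof -
  have "(\<Sum>p<I. \<Sum>q<I. X p q) = (\<Sum>(p, q)\<in>{..<I} \<times> {..<I}. X p q)"
    by (rule sum.cartesian_product)
  also have "\<dots> = (\<Sum>(p, q)\<in>{(p, q). p + q < I}. X p q)"
    by (rule sum.mono_neutral_right) (auto intro!: assms)
  also have "\<dots> = (\<Sum>i<I. \<Sum>p\<le>i. X p (i - p))"
    by (rule sum.triangle_reindex)
  finally show ?thesis .
qed

lemma eventually_nat_ge: "(\<And>i. i \<ge> I \<Longrightarrow> P i) \<Longrightarrow> eventually P sequentially" for I :: nat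
  unfolding eventually_sequentially by blast

context vertex_structure
begin

lemmas Y_add_state = clinear_add [OF linear_state]
  and Y_scaleC_state = clinear_scaleC [OF linear_state]
  and Y_0_state [simp] = clinear_0 [OF linear_state]
  and Y_add_arg = clinear_add [OF linear_arg]
  and Y_scaleC_arg = clinear_scaleC [OF linear_arg]
  and Y_0_arg [simp] = clinear_0 [OF linear_arg]
  and Y_sum_arg = clinear_sum [OF linear_arg]

lemma Y_vanishes: "\<forall>\<^sub>F i in sequentially. \<forall>j\<ge>i. Y u (n + int j) v = 0"
proof -
  obtain N where "\<forall>k\<ge>N. Y u k v = 0"
    using truncation by blast
  then show ?thesis
    by (intro eventually_nat_ge [of "nat (N - n)"]) auto
qed

text \<open>The bound does not depend on m, because s involves only finitely many vectors; for a
  general element of V((x)) it could.\<close>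

lemma shift_vanishes:
  assumes "s \<in> laurent_tensor"
  shows "\<forall>\<^sub>F i in sequentially. \<forall>j\<ge>i. \<forall>m. Y (s m) (n + int j) w = 0"
  using assms
proof (induction rule: laurent_tensor_induct)
  case (add s t)
  from add(3,4) show ?case
    by eventually_elim (simp add: fun_ops Y_add_state)
next
  case (gen f v)
  from Y_vanishes [of v n w] show ?case
    by eventually_elim (simp add: gen_nth Y_scaleC_state)
qed (simp add: fun_ops)

lemma shiftY_eventually:
  assumes "s \<in> laurent_tensor"
  shows "\<forall>\<^sub>F I in sequentially. \<forall>m. shiftY Y s n w m =
    (\<Sum>i<I. ((-1) ^ i * (ichoose (m + int i) i)) *\<^sub>C Y (s (m + int i)) (n + int i) w)"
  using shift_vanishes [OF assms, of n w]
proof eventually_elim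
  case (elim I)
  then show ?case
    unfolding shiftY_def
    by (intro allI Sum_any.expand_superset) (auto simp: not_less [symmetric])
qed

text \<open>Each factor x2^i in the Taylor expansion of f(x1 - x2) raises the mode of v by i, and
  truncation in the mode ends the sum.\<close>

lemma shiftY_gen:
  "\<forall>\<^sub>F I in sequentially. shiftY Y (gen f v) n w =
    (\<Sum>i<I. gen (alt i * hasse i f) (Y v (n + int i) w))"
  using shiftY_eventually [OF gen_in, of f v n w]
proof eventually_elim
  case (elim I)
  then show ?case
    by (simp add: fun_eq_iff sum_apply gen_nth hasse_nth Y_scaleC_state scaleC_scaleC mult.assoc)
qed

lemma shiftY_add:
  assumes "s \<in> laurent_tensor" "t \<in> laurent_tensor"
  shows "shiftY Y (s + t) n w = shiftY Y s n w + shiftY Y t n w"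
proof -
  have "\<forall>\<^sub>F I::nat in sequentially. ?thesis"
    using shiftY_eventually [OF laurent_tensor_add [OF assms], of n w]
      shiftY_eventually [OF assms(1), of n w] shiftY_eventually [OF assms(2), of n w]
    by eventually_elim
       (simp add: fun_eq_iff fun_ops Y_add_state scaleC_add_right sum.distrib)
  then show ?thesis
    by simp
qed

lemma shiftY_0 [simp]: "shiftY Y 0 n w = 0"
  by (simp add: shiftY_def fun_eq_iff fun_ops)

lemma shiftY_add_arg:
  assumes "s \<in> laurent_tensor"
  shows "shiftY Y s n (w + w') = shiftY Y s n w + shiftY Y s n w'"
proof -
  have "\<forall>\<^sub>F I::nat in sequentially. ?thesis"
    using shiftY_eventually [OF assms, of n w] shiftY_eventually [OF assms, of n w']
      shiftY_eventually [OF assms, of n "w + w'"]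
    by eventually_elim
       (simp add: fun_eq_iff fun_ops Y_add_arg scaleC_add_right sum.distrib)
  then show ?thesis
    by simp
qed

lemma shiftY_scaleC_arg:
  assumes "s \<in> laurent_tensor"
  shows "shiftY Y s n (c *\<^sub>C w) = c *\<^sub>C shiftY Y s n w"
proof -
  have "\<forall>\<^sub>F I::nat in sequentially. ?thesis"
    using shiftY_eventually [OF assms, of n w] shiftY_eventually [OF assms, of n "c *\<^sub>C w"]
    by eventually_elim
       (simp add: fun_eq_iff scaleC_fun_apply Y_scaleC_arg cvec.scale_sum_right scaleC_scaleC mult.commute)
  then show ?thesis
    by simp
qed

lemma shiftY_in:
  assumes "s \<in> laurent_tensor"
  shows "shiftY Y s n w \<in> laurent_tensor"
  using assms
proof (induction rule: laurent_tensor_induct)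
  case (gen f v)
  have "\<forall>\<^sub>F I::nat in sequentially. ?case"
    using shiftY_gen [of f v n w]
    by eventually_elim (simp add: laurent_tensor_sum)
  then show ?case
    by simp
qed (simp_all add: shiftY_add)

lemma shiftY_laurent_hom [simp]: "s \<in> laurent_tensor \<Longrightarrow> shiftY Y s n \<in> laurent_hom"
  unfolding laurent_hom_def
  by (auto intro!: clinearI simp: shiftY_add_arg shiftY_scaleC_arg shiftY_in)

lemma sh_in [simp]: "s \<in> laurent_tensor \<Longrightarrow> t \<in> laurent_tensor \<Longrightarrow> sh Y s t n \<in> laurent_tensor"
  by (simp add: sh_def)

lemma sh_add_right:
  "s \<in> laurent_tensor \<Longrightarrow> t \<in> laurent_tensor \<Longrightarrow> t' \<in> laurent_tensor \<Longrightarrow>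
    sh Y s (t + t') n = sh Y s t n + sh Y s t' n"
  by (simp add: sh_def act_add)

lemma sh_add_left:
  assumes "s \<in> laurent_tensor" "s' \<in> laurent_tensor" "t \<in> laurent_tensor"
  shows "sh Y (s + s') t n = sh Y s t n + sh Y s' t n"
proof -
  have "shiftY Y (s + s') n = shiftY Y s n + shiftY Y s' n"
    by (rule ext) (simp add: fun_ops shiftY_add assms)
  then show ?thesis
    by (simp add: sh_def act_add_left assms)
qed

lemma sh_0_right [simp]: "s \<in> laurent_tensor \<Longrightarrow> sh Y s 0 n = 0"
  by (simp add: sh_def)

lemma sh_0_left [simp]:
  assumes "t \<in> laurent_tensor"
  shows "sh Y 0 t n = 0"
  using sh_add_left [of 0 0 t n] assms by simp

lemma sh_gen:
  "\<forall>\<^sub>F I in sequentially. sh Y (gen f v) (gen g w) n =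
    (\<Sum>i<I. gen (alt i * (hasse i f * g)) (Y v (n + int i) w))"
  using shiftY_gen [of f v n w]
  by eventually_elim
     (simp add: sh_def act_gen_right act_sum act_gen_gen mult_ac)

lemma sh_scaleC_right:
  "s \<in> laurent_tensor \<Longrightarrow> t \<in> laurent_tensor \<Longrightarrow> sh Y s (c *\<^sub>C t) n = c *\<^sub>C sh Y s t n"
  by (simp add: sh_def act_scaleC)

lemma sh_scaleC_left:
  assumes "s \<in> laurent_tensor" "t \<in> laurent_tensor"
  shows "sh Y (c *\<^sub>C s) t n = c *\<^sub>C sh Y s t n"
  using assms(1)
proof (induction rule: laurent_tensor_induct)
  case zero
  show ?case
    by (simp add: assms)
next
  case (add s s')
  then show ?case
    by (simp add: sh_add_left scaleC_add_right assms)
next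
  case (gen f v)
  show ?case
    using assms(2)
  proof (induction rule: laurent_tensor_induct)
    case (gen g w)
    have "\<forall>\<^sub>F I::nat in sequentially. ?case"
      unfolding scaleC_gen
      using sh_gen [of "fls_const c * f" v g w n] sh_gen [of f v g w n]
      by eventually_elim (simp add: cvec.scale_sum_right scaleC_gen hasse_const_mult mult.assoc mult.left_commute [of "fls_const c"])
    then show ?case
      by simp
  qed (simp_all add: sh_add_right scaleC_add_right)
qed

lemma sh_sum_right:
  "s \<in> laurent_tensor \<Longrightarrow> (\<And>i. i \<in> A \<Longrightarrow> t i \<in> laurent_tensor) \<Longrightarrow>
    sh Y s (\<Sum>i\<in>A. t i) n = (\<Sum>i\<in>A. sh Y s (t i) n)"
  by (simp add: sh_def act_sum)

lemma sh_sum_left: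
  "t \<in> laurent_tensor \<Longrightarrow> (\<And>i. i \<in> A \<Longrightarrow> s i \<in> laurent_tensor) \<Longrightarrow>
    sh Y (\<Sum>i\<in>A. s i) t n = (\<Sum>i\<in>A. sh Y (s i) t n)"
  by (induction A rule: infinite_finite_induct) (simp_all add: sh_add_left laurent_tensor_sum)

lemma sh_sum_list_left:
  "t \<in> laurent_tensor \<Longrightarrow> (\<And>x. x \<in> set xs \<Longrightarrow> s x \<in> laurent_tensor) \<Longrightarrow>
    sh Y (\<Sum>x\<leftarrow>xs. s x) t n = (\<Sum>x\<leftarrow>xs. sh Y (s x) t n)"
  by (induction xs) (simp_all add: sh_add_left laurent_tensor_sum_list)

lemma sh_sum_list_right:
  "s \<in> laurent_tensor \<Longrightarrow> (\<And>x. x \<in> set xs \<Longrightarrow> t x \<in> laurent_tensor) \<Longrightarrow>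
    sh Y s (\<Sum>x\<leftarrow>xs. t x) n = (\<Sum>x\<leftarrow>xs. sh Y s (t x) n)"
  by (induction xs) (simp_all add: sh_add_right laurent_tensor_sum_list)

lemma laurent_tensor_induct2 [consumes 2, case_names zero_left zero_right add_left add_right gen]:
  assumes "s \<in> laurent_tensor" "t \<in> laurent_tensor"
    and "\<And>t. t \<in> laurent_tensor \<Longrightarrow> P 0 t"
    and "\<And>f v. P (gen f v) 0"
    and "\<And>s s' t. s \<in> laurent_tensor \<Longrightarrow> s' \<in> laurent_tensor \<Longrightarrow> t \<in> laurent_tensor \<Longrightarrow>
      P s t \<Longrightarrow> P s' t \<Longrightarrow> P (s + s') t"
    and "\<And>f v t t'. t \<in> laurent_tensor \<Longrightarrow> t' \<in> laurent_tensor \<Longrightarrow>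
      P (gen f v) t \<Longrightarrow> P (gen f v) t' \<Longrightarrow> P (gen f v) (t + t')"
    and "\<And>f v g w. P (gen f v) (gen g w)"
  shows "P s t"
  using assms(1)
proof (induction rule: laurent_tensor_induct)
  case (gen f v)
  show ?case
    using assms(2) by (induction rule: laurent_tensor_induct) (use assms in blast)+
qed (use assms in blast)+

lemma sh_vanishes:
  assumes "s \<in> laurent_tensor" "t \<in> laurent_tensor"
  shows "\<exists>N. \<forall>n\<ge>N. sh Y s t n = 0"
  using assms
proof (induction s t rule: laurent_tensor_induct2)
  case (add_left s s' t)
  from add_left(4,5) obtain M N where "\<forall>n\<ge>M. sh Y s t n = 0" "\<forall>n\<ge>N. sh Y s' t n = 0"
    by blast
  then show ?case
    using add_left(1-3) by (intro exI [of _ "max M N"]) (simp add: sh_add_left)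
next
  case (add_right f v t t')
  from add_right(3,4) obtain M N where "\<forall>n\<ge>M. sh Y (gen f v) t n = 0" "\<forall>n\<ge>N. sh Y (gen f v) t' n = 0"
    by blast
  then show ?case
    using add_right(1,2) by (intro exI [of _ "max M N"]) (simp add: sh_add_right)
next
  case (gen f v g w)
  obtain N where N: "\<forall>k\<ge>N. Y v k w = 0"
    using truncation by blast
  have "sh Y (gen f v) (gen g w) n = 0" if "n \<ge> N" for n
  proof -
    have "\<forall>\<^sub>F I::nat in sequentially. ?thesis"
      using sh_gen [of f v g w n] by eventually_elim (use N that in simp)
    then show ?thesis
      by simp
  qed
  then show ?case
    by blast
qed simp_all

text \<open>Here \<open>f(x\<^sub>1 - x\<^sub>2) = \<Sum> (-x\<^sub>2)\<^sup>i hasse i f(x\<^sub>1)\<close>.\<close>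

lemma sh_act_gen:
  assumes "s \<in> laurent_tensor" "t \<in> laurent_tensor"
  shows "\<forall>\<^sub>F I in sequentially. sh Y (act (gen f) s) (act (gen g) t) n =
    (\<Sum>i<I. act (gen (alt i * (hasse i f * g))) (sh Y s t (n + int i)))"
  using assms
proof (induction s t rule: laurent_tensor_induct2)
  case (add_left s s' t)
  from add_left(4,5) show ?case
    by eventually_elim (use add_left(1-3) in \<open>simp add: act_add sh_add_left sum.distrib\<close>)
next
  case (add_right f v t t')
  from add_right(3,4) show ?case
    by eventually_elim (use add_right(1,2) in \<open>simp add: act_add sh_add_right sum.distrib\<close>)
next
  case (gen h v k w)
  \<comment> \<open>\<open>sh_gen\<close> gives each mode n + i its own length J. Since v and w have
    vanishing modes from N on, all terms with index at least I are 0, so a single I serves every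
    i.\<close>
  have ev: "\<forall>\<^sub>F I in sequentially. \<forall>i<I. sh Y (gen h v) (gen k w) (n + int i) =
      (\<Sum>j<I. gen (alt j * (hasse j h * k)) (Y v (n + int i + int j) w))"
  proof -
    obtain N where N: "\<forall>k\<ge>N. Y v k w = 0"
      using truncation by blast
    show ?thesis
    proof (rule eventually_nat_ge [of "nat (N - n)"], intro allI impI)
      fix I i :: nat
      assume I: "I \<ge> nat (N - n)" "i < I"
      have "\<forall>\<^sub>F J in sequentially. J \<ge> I"
        by (rule eventually_ge_at_top)
      then have "\<forall>\<^sub>F J in sequentially. sh Y (gen h v) (gen k w) (n + int i) =
        (\<Sum>j<I. gen (alt j * (hasse j h * k)) (Y v (n + int i + int j) w))"
        using sh_gen [of h v k w "n + int i"]
      proof eventually_elim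
        case (elim J)
        then show ?case
          by (simp only: elim(2), intro sum.mono_neutral_right) (use N I in auto)
      qed
      then show "sh Y (gen h v) (gen k w) (n + int i) =
        (\<Sum>j<I. gen (alt j * (hasse j h * k)) (Y v (n + int i + int j) w))"
        by simp
    qed
  qed
  from ev sh_gen [of "h * f" v "k * g" w n] Y_vanishes [of v n w] show ?case
  proof eventually_elim
    case (elim I)
    have "(\<Sum>i<I. act (gen (alt i * (hasse i f * g))) (sh Y (gen h v) (gen k w) (n + int i)))
        = (\<Sum>i<I. \<Sum>j<I. gen (alt (i + j) * (hasse i f * hasse j h * (g * k))) (Y v (n + int (i + j)) w))"
      by (rule sum.cong [OF refl])
         (simp add: elim(1) act_sum act_gen_gen power_add mult_ac add.assoc fls_const_mult_const [symmetric]
           del: fls_const_mult_const)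
    \<comment> \<open>Regrouping along diagonals makes the inner sum Leibniz' rule for f *
      h.\<close>
    also have "\<dots> = (\<Sum>i<I. \<Sum>p\<le>i. gen (alt i * (hasse p f * hasse (i - p) h * (g * k))) (Y v (n + int i) w))"
      by (subst sum_triangle) (use elim(3) in \<open>simp_all del: of_nat_add\<close>)
    also have "\<dots> = (\<Sum>i<I. gen (alt i * (hasse i (f * h) * (g * k))) (Y v (n + int i) w))"
      by (simp add: hasse_mult sum_distrib_left sum_distrib_right gen_sum_left)
    finally show ?case
      using elim(2) by (simp add: act_gen_gen mult_ac)
  qed
qed (simp_all add: act_add)

text \<open>The commutation rule for vectors passes to Laurent coefficients because both sides
  expand with the same Taylor coefficients. This allows a second operator to be applied to the
  outcome of a first.\<close>

lemma act_sh:
  assumes a: "a \<in> laurent_hom" and xs: "set xs \<subseteq> laurent_hom \<times> laurent_hom" and via: "commutes_via Y a xs"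
    and "s \<in> laurent_tensor" "t \<in> laurent_tensor"
  shows "act a (sh Y s t n) = (\<Sum>(b, c)\<leftarrow>xs. sh Y (act b s) (act c t) n)"
  using assms(4,5)
proof (induction s t rule: laurent_tensor_induct2)
  case (add_left s s' t)
  have "(\<Sum>(b, c)\<leftarrow>xs. sh Y (act b (s + s')) (act c t) n) =
      (\<Sum>(b, c)\<leftarrow>xs. sh Y (act b s) (act c t) n) + (\<Sum>(b, c)\<leftarrow>xs. sh Y (act b s') (act c t) n)"
    using xs add_left(1-3)
    by (induction xs) (auto simp: act_add sh_add_left algebra_simps)
  then show ?case
    using add_left a by (simp add: sh_add_left act_add)
next
  case (add_right f v t t')
  have "(\<Sum>(b, c)\<leftarrow>xs. sh Y (act b (gen f v)) (act c (t + t')) n) =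
      (\<Sum>(b, c)\<leftarrow>xs. sh Y (act b (gen f v)) (act c t) n) + (\<Sum>(b, c)\<leftarrow>xs. sh Y (act b (gen f v)) (act c t') n)"
    using xs add_right(1,2)
    by (induction xs) (auto simp: act_add sh_add_right algebra_simps)
  then show ?case
    using add_right a by (simp add: sh_add_right act_add)
next
  case (gen f v g w)
  have "\<forall>\<^sub>F I in sequentially. (\<Sum>(b, c)\<leftarrow>xs. sh Y (act b (gen f v)) (act c (gen g w)) n) =
    (\<Sum>i<I. act (gen (alt i * (hasse i f * g))) (\<Sum>(b, c)\<leftarrow>xs. sh Y (b v) (c w) (n + int i)))"
    (is "eventually (?P xs) _")
    using xs
  proof (induction xs)
    case (Cons x xs)
    obtain b c where x: "x = (b, c)"
      by force
    with Cons have bc: "b \<in> laurent_hom" "c \<in> laurent_hom"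
      and xs: "\<And>y. y \<in> set xs \<Longrightarrow> fst y \<in> laurent_hom \<and> snd y \<in> laurent_hom"
      by (auto simp: subset_iff)
    have "eventually (?P xs) sequentially"
      using Cons by simp
    then show ?case
      using sh_act_gen [OF laurent_homD [OF bc(1), of v] laurent_homD [OF bc(2), of w], of f g n]
      by eventually_elim
        (simp add: x split_def bc act_gen_right act_add sum.distrib laurent_homD laurent_tensor_sum_list xs)
  qed simp
  then have "\<forall>\<^sub>F I::nat in sequentially. ?case"
    using sh_gen [of f v g w n]
    by eventually_elim
      (use via in \<open>simp add: a act_sum act_gen_right commutes_via_eq\<close>)
  then show ?case
    by simp
qed (use xs in \<open>induction xs; auto simp: a\<close>)+

text \<open>The derivative is in x1 at fixed x2, so it meets both s(x1 - x2) and t(x1). This is the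
  source of the rule for the coproduct of a derivative.\<close>

lemma deriv_sh:
  assumes "s \<in> laurent_tensor" "t \<in> laurent_tensor"
  shows "deriv (sh Y s t n) = sh Y (deriv s) t n + sh Y s (deriv t) n"
  using assms
proof (induction s t rule: laurent_tensor_induct2)
  case (gen f v g w)
  have "\<forall>\<^sub>F I::nat in sequentially. ?case"
    unfolding deriv_gen
    using sh_gen [of f v g w n] sh_gen [of "fls_deriv f" v g w n] sh_gen [of f v "fls_deriv g" w n]
    by eventually_elim
      (simp add: deriv_sum deriv_gen hasse_deriv gen_add_left algebra_simps sum.distrib [symmetric])
  then show ?case
    by simp
qed (simp_all add: sh_add_left sh_add_right deriv_add algebra_simps)

text \<open>The higher Taylor terms disappear in two situations: f is constant, or w is the vacuum
  and n = -1. They lead to the two counit identities.\<close>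

lemma sh_gen_first:
  assumes "\<And>i. i > 0 \<Longrightarrow> hasse i f = 0 \<or> Y v (n + int i) w = 0"
  shows "sh Y (gen f v) (gen g w) n = gen (f * g) (Y v n w)"
proof -
  have "\<forall>\<^sub>F I::nat in sequentially. ?thesis"
    using sh_gen [of f v g w n] eventually_gt_at_top [of 0]
  proof eventually_elim
    case (elim I)
    have "(\<Sum>i<I. gen (alt i * (hasse i f * g)) (Y v (n + int i) w))
       = (\<Sum>i\<in>{0}. gen (alt i * (hasse i f * g)) (Y v (n + int i) w))"
      by (rule sum.mono_neutral_right) (use elim assms in force)+
    then show ?case
      using elim(1) by simp
  qed
  then show ?thesis
    by simp
qed

lemma sh_const: "sh Y (gen (fls_const c) v) (gen g w) n = gen (fls_const c * g) (Y v n w)"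
  by (rule sh_gen_first) (simp add: hasse_const)

lemma sh_vac_left: "t \<in> laurent_tensor \<Longrightarrow> sh Y (gen (fls_const c) vac) t (-1) = c *\<^sub>C t"
  by (induction rule: laurent_tensor_induct)
     (simp_all add: sh_add_right scaleC_add_right sh_const vacuum scaleC_gen)

lemma sh_vac_right: "s \<in> laurent_tensor \<Longrightarrow> sh Y s (gen (fls_const c) vac) (-1) = c *\<^sub>C s"
proof (induction rule: laurent_tensor_induct)
  case (gen f v)
  have "sh Y (gen f v) (gen (fls_const c) vac) (-1) = gen (f * fls_const c) (Y v (-1) vac)"
    by (rule sh_gen_first) (simp add: creation_regular)
  then show ?case
    by (simp add: creation_limit scaleC_gen mult.commute)
qed (simp_all add: sh_add_left scaleC_add_right)

end

lemma clinear_diff: "clinear f \<Longrightarrow> f (x - y) = f x - f y"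
  using clinear_add [of f "x - y" y] by simp

lemma clinear_subspace_image: "clinear f \<Longrightarrow> cvec.subspace S \<Longrightarrow> cvec.subspace (f ` S)"
  by (rule module_hom.subspace_image) (simp_all add: Vector_Spaces.linear_def)

section \<open>Schur's lemma and the density theorem\<close>

lemma span_finite_subset:
  assumes "x \<in> cvec.span S"
  obtains F where "finite F" "F \<subseteq> S" "x \<in> cvec.span F"
proof -
  from assms obtain F r where F: "finite F" "F \<subseteq> S" "x = (\<Sum>a\<in>F. r a *\<^sub>C a)"
    unfolding cvec.span_explicit by blast
  have "x \<in> cvec.span F"
    unfolding F(3) by (intro cvec.span_sum cvec.span_scale cvec.span_base)
  with F show ?thesis
    using that by blast
qed

text \<open>A countable spanning set has countably many finite subsets, and the span of each
  contains only finitely many elements of an independent set.\<close>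

lemma countable_independent:
  assumes "countable S" "cvec.independent T" "T \<subseteq> cvec.span S"
  shows "countable T"
proof -
  have "T \<subseteq> (\<Union>F\<in>{F. finite F \<and> F \<subseteq> S}. T \<inter> cvec.span F)"
  proof
    fix x
    assume "x \<in> T"
    with assms(3) obtain F where "finite F" "F \<subseteq> S" "x \<in> cvec.span F"
      using span_finite_subset by (metis subsetD)
    with \<open>x \<in> T\<close> show "x \<in> (\<Union>F\<in>{F. finite F \<and> F \<subseteq> S}. T \<inter> cvec.span F)"
      by blast
  qed
  moreover have "finite (T \<inter> cvec.span F)" if "finite F" for F
  proof -
    have "cvec.independent (T \<inter> cvec.span F)"
      using assms(2) by (rule cvec.independent_mono) simp
    then show ?thesis
      using cvec.independent_span_bound [OF that, of "T \<inter> cvec.span F"] by simp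
  qed
  then have "countable (\<Union>F\<in>{F. finite F \<and> F \<subseteq> S}. T \<inter> cvec.span F)"
    by (intro countable_UN countable_Collect_finite_subset assms(1)) (auto intro: countable_finite)
  ultimately show ?thesis
    by (rule countable_subset)
qed

section \<open>Polynomials in an endomorphism and its resolvents\<close>

definition poly_op :: "('v::complex_vector \<Rightarrow> 'v) \<Rightarrow> complex poly \<Rightarrow> 'v \<Rightarrow> 'v" where
  "poly_op \<phi> p v = (\<Sum>i\<le>degree p. coeff p i *\<^sub>C (\<phi> ^^ i) v)"

lemma poly_op_superset: "degree p \<le> n \<Longrightarrow> poly_op \<phi> p v = (\<Sum>i\<le>n. coeff p i *\<^sub>C (\<phi> ^^ i) v)"
  unfolding poly_op_def by (rule sum.mono_neutral_left) (auto simp: coeff_eq_0)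

lemma poly_op_add: "poly_op \<phi> (p + q) v = poly_op \<phi> p v + poly_op \<phi> q v"
proof -
  let ?n = "max (degree p) (degree q)"
  have "degree (p + q) \<le> ?n"
    by (rule degree_add_le) simp_all
  then show ?thesis
    by (simp add: poly_op_superset [of _ ?n] scaleC_add_left sum.distrib)
qed

lemma poly_op_smult: "poly_op \<phi> (smult c p) v = c *\<^sub>C poly_op \<phi> p v"
  using degree_smult_le [of c p]
  by (simp add: poly_op_superset [of _ "degree p"] cvec.scale_sum_right scaleC_scaleC)

lemma poly_op_sum: "poly_op \<phi> (\<Sum>i\<in>A. p i) v = (\<Sum>i\<in>A. poly_op \<phi> (p i) v)"
  by (induction A rule: infinite_finite_induct) (simp_all add: poly_op_add, simp_all add: poly_op_def)

lemma poly_op_const: "poly_op \<phi> [:c:] v = c *\<^sub>C v"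
  by (simp add: poly_op_def)

context
  fixes \<phi> :: "'v::complex_vector \<Rightarrow> 'v"
  assumes \<phi>: "clinear \<phi>"
begin

lemma funpow_clinear: "clinear (\<phi> ^^ i)"
  by (induction i) (auto intro!: clinearI simp: clinear_add clinear_scaleC \<phi>)

lemma poly_op_clinear: "clinear (poly_op \<phi> p)"
  by (rule clinearI)
     (simp_all add: poly_op_def clinear_add [OF funpow_clinear] clinear_scaleC [OF funpow_clinear]
       scaleC_add_right sum.distrib cvec.scale_sum_right scaleC_scaleC mult.commute)

lemma poly_op_commute: "poly_op \<phi> p (\<phi> v) = \<phi> (poly_op \<phi> p v)"
  by (simp add: poly_op_def clinear_sum [OF \<phi>] clinear_scaleC [OF \<phi>] funpow_swap1)

lemma poly_op_pCons_0: "poly_op \<phi> (pCons 0 p) v = \<phi> (poly_op \<phi> p v)"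
proof -
  have "poly_op \<phi> (pCons 0 p) v = (\<Sum>i\<le>Suc (degree p). coeff (pCons 0 p) i *\<^sub>C (\<phi> ^^ i) v)"
    by (rule poly_op_superset) (rule degree_pCons_le)
  then show ?thesis
    by (simp add: sum.atMost_Suc_shift poly_op_def clinear_sum [OF \<phi>] clinear_scaleC [OF \<phi>] del: sum.atMost_Suc)
qed

lemma poly_op_linear_factor: "poly_op \<phi> ([:- c, 1:] * p) v = \<phi> (poly_op \<phi> p v) - c *\<^sub>C poly_op \<phi> p v"
  by (simp add: poly_op_add poly_op_smult poly_op_pCons_0 flip: smult_minus_left)

text \<open>Over the complex numbers p splits into linear factors, and each \<phi> - c is injective
  when \<phi> has no eigenvector.\<close>

lemma poly_op_inj:
  assumes inj: "\<And>c x. \<phi> x = c *\<^sub>C x \<Longrightarrow> x = 0"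
  shows "p \<noteq> 0 \<Longrightarrow> poly_op \<phi> p v = 0 \<Longrightarrow> v = 0"
proof (induction "degree p" arbitrary: p)
  case 0
  then obtain c where "p = [:c:]"
    using degree_eq_zeroE [of p] by metis
  with 0(2,3) show ?case
    by (simp add: poly_op_const)
next
  case (Suc n)
  have "\<not> (\<exists>a l. a \<noteq> 0 \<and> l = 0 \<and> p = pCons a l)"
    using Suc.hyps(2) by auto
  then obtain c where "poly p c = 0"
    using fundamental_theorem_of_algebra_alt by blast
  then have "[:- c, 1:] dvd p"
    by (simp add: poly_eq_0_iff_dvd)
  then obtain q where q: "p = [:- c, 1:] * q"
    by (rule dvdE)
  with Suc.prems(1) have "q \<noteq> 0"
    by auto
  then have "degree p = Suc (degree q)"
    unfolding q by (subst degree_mult_eq) simp_all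
  with Suc.hyps(2) have "n = degree q"
    by simp
  moreover have "poly_op \<phi> q v = 0"
  proof (rule inj)
    show "\<phi> (poly_op \<phi> q v) = c *\<^sub>C poly_op \<phi> q v"
      using Suc.prems(2) unfolding q poly_op_linear_factor by simp
  qed
  ultimately show ?case
    using Suc.hyps(1) \<open>q \<noteq> 0\<close> by blast
qed

text \<open>If \<open>\<phi>\<close> had no eigenvalue, then the vectors \<open>(\<phi> - \<lambda>)\<^sup>-\<^sup>1 v\<close> for \<open>\<lambda> \<in> \<complex>\<close> would be linearly
  independent, as \<open>\<Prod>(\<phi> - \<lambda>)\<close> turns a relation into a nonzero polynomial in \<open>\<phi>\<close> killing \<open>v\<close>.\<close>

lemma resolvents_independent:
  assumes inj: "\<And>c x. \<phi> x = c *\<^sub>C x \<Longrightarrow> x = 0"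
    and e: "\<And>c. \<phi> (e c) - c *\<^sub>C e c = v" and "v \<noteq> 0"
  shows "inj e" and "cvec.independent (range e)"
proof -
  show inj_e: "inj e"
  proof (rule injI, rule ccontr)
    fix a b
    assume *: "e a = e b" "a \<noteq> b"
    have "\<phi> (e a) - a *\<^sub>C e a = \<phi> (e a) - b *\<^sub>C e a"
      using e [of a] e [of b] by (simp add: *(1))
    with * have "e a = 0"
      by simp
    with e [of a] have "v = 0"
      by (simp add: clinear_0 [OF \<phi>])
    with \<open>v \<noteq> 0\<close> show False ..
  qed
  show "cvec.independent (range e)"
    unfolding cvec.independent_explicit_module
  proof (intro allI impI)
    fix T u x
    assume T: "finite T" "T \<subseteq> range e" and rel: "(\<Sum>x\<in>T. u x *\<^sub>C x) = 0" and "x \<in> T"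
    obtain L where L: "finite L" "T = e ` L"
      using T by (meson finite_subset_image)
    \<comment> \<open>The common denominator of the resolvents indexed by M: for c in L,
      \<open>Q L\<close> applied to \<open>e c\<close> cancels the resolvent at c.\<close>
    define Q where "Q M = (\<Prod>c\<in>M. [:- c, 1:])" for M :: "complex set"
    have Q: "poly_op \<phi> (Q L) (e c) = poly_op \<phi> (Q (L - {c})) v" if "c \<in> L" for c
    proof -
      have "Q L = [:- c, 1:] * Q (L - {c})"
        unfolding Q_def by (rule prod.remove [OF L(1) that])
      then show ?thesis
        by (simp only: poly_op_linear_factor e [of c, symmetric] poly_op_commute
          clinear_diff [OF poly_op_clinear] clinear_scaleC [OF poly_op_clinear])
    qed
    have "(\<Sum>c\<in>L. u (e c) *\<^sub>C e c) = 0"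
      using rel by (simp add: L(2) sum.reindex [OF inj_on_subset [OF inj_e]])
    then have "poly_op \<phi> (Q L) (\<Sum>c\<in>L. u (e c) *\<^sub>C e c) = 0"
      by (simp add: clinear_0 [OF poly_op_clinear])
    then have "poly_op \<phi> (\<Sum>c\<in>L. smult (u (e c)) (Q (L - {c}))) v = 0"
      by (simp add: clinear_sum [OF poly_op_clinear] clinear_scaleC [OF poly_op_clinear]
        poly_op_sum poly_op_smult Q)
    then have zero: "(\<Sum>c\<in>L. smult (u (e c)) (Q (L - {c}))) = 0"
      using poly_op_inj [of _ v] inj \<open>v \<noteq> 0\<close> by blast
    obtain a where a: "a \<in> L" "x = e a"
      using \<open>x \<in> T\<close> L by blast
    \<comment> \<open>As in Lagrange interpolation, only the summand for a survives evaluation at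
      a.\<close>
    have "poly (Q (L - {c})) a = 0" if "c \<in> L - {a}" for c
      unfolding Q_def poly_prod by (rule prod_zero) (use that a L in auto)
    then have "(\<Sum>c\<in>L. u (e c) * poly (Q (L - {c})) a) = u (e a) * poly (Q (L - {a})) a"
      using a L by (simp add: sum.remove [of L a])
    moreover have "(\<Sum>c\<in>L. u (e c) * poly (Q (L - {c})) a) = poly (\<Sum>c\<in>L. smult (u (e c)) (Q (L - {c}))) a"
      by (simp add: poly_sum)
    moreover have "poly (Q (L - {a})) a \<noteq> 0"
      using L by (auto simp: Q_def poly_prod)
    ultimately show "u x = 0"
      by (simp add: zero a)
  qed
qed

end

definition submodule_of :: "('v::complex_vector \<Rightarrow> int \<Rightarrow> 'v \<Rightarrow> 'v) \<Rightarrow> 'v set \<Rightarrow> bool" where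
  "submodule_of Y W \<longleftrightarrow> cvec.subspace W \<and> (\<forall>v n. \<forall>w\<in>W. Y v n w \<in> W)"

lemma irreducible_submodule: "adjoint_irreducible Y \<Longrightarrow> submodule_of Y W \<Longrightarrow> W = {0} \<or> W = UNIV"
  by (auto simp: adjoint_irreducible_def submodule_of_def)

section \<open>Endomorphisms and tuples over an irreducible V\<close>

context vertex_structure
begin

lemma vac_nonzero:
  assumes "adjoint_irreducible Y"
  shows "vac \<noteq> 0"
proof
  assume "vac = 0"
  then have "v = 0" for v :: 'v
    using vacuum [of "-1" v] by simp
  then show False
    using assms by (auto simp: adjoint_irreducible_def)
qed

text \<open>Submodules of a power of V under the diagonal action of the modes.\<close>

definition stable_tuples :: "('i \<Rightarrow> 'v) set \<Rightarrow> bool" where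
  "stable_tuples N \<longleftrightarrow> cvec.subspace N \<and> (\<forall>t\<in>N. \<forall>u n. (\<lambda>j. Y u n (t j)) \<in> N)"

context
  assumes irr: "adjoint_irreducible Y" and dim: "countable_dim (UNIV :: 'v set)"
begin

text \<open>Dixmier's argument. Eigenspaces of \<phi> and images of \<phi> - c are submodules. If
  \<phi> is not a scalar, every \<phi> - c is therefore bijective, and the preimages of the vacuum
  are independent vectors indexed by the uncountable set of complex numbers.\<close>

lemma Schur:
  assumes \<phi>: "clinear \<phi>" and hom: "\<And>u n v. \<phi> (Y u n v) = Y u n (\<phi> v)"
  shows "\<exists>c. \<forall>v. \<phi> v = c *\<^sub>C v"
proof (rule ccontr)
  assume neg: "\<not> ?thesis"
  have diff: "clinear (\<lambda>v. \<phi> v - c *\<^sub>C v)" for c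
    by (rule clinearI) (simp_all add: clinear_add [OF \<phi>] clinear_scaleC [OF \<phi>] scaleC_add_right
      cvec.scale_right_diff_distrib scaleC_scaleC mult.commute)
  have Y_diff: "Y u n (\<phi> v - c *\<^sub>C v) = \<phi> (Y u n v) - c *\<^sub>C Y u n v" for u n v c
    by (simp add: clinear_diff [OF linear_arg] Y_scaleC_arg hom)
  have inj: "x = 0" if "\<phi> x = c *\<^sub>C x" for c x
  proof -
    have "submodule_of Y {v. \<phi> v = c *\<^sub>C v}"
      by (auto simp: submodule_of_def cvec.subspace_def hom Y_scaleC_arg scaleC_add_right
        clinear_0 [OF \<phi>] clinear_add [OF \<phi>] clinear_scaleC [OF \<phi>] scaleC_scaleC mult.commute)
    then have "{v. \<phi> v = c *\<^sub>C v} = {0}"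
      using irreducible_submodule [OF irr] neg by blast
    then show ?thesis
      using that by blast
  qed
  have surj: "\<exists>x. \<phi> x - c *\<^sub>C x = v" for c v
  proof -
    have "submodule_of Y (range (\<lambda>v. \<phi> v - c *\<^sub>C v))"
      unfolding submodule_of_def
    proof (intro conjI allI ballI)
      show "cvec.subspace (range (\<lambda>v. \<phi> v - c *\<^sub>C v))"
        by (rule clinear_subspace_image [OF diff cvec.subspace_UNIV])
    qed (auto simp: Y_diff)
    then have "range (\<lambda>v. \<phi> v - c *\<^sub>C v) = {0} \<or> range (\<lambda>v. \<phi> v - c *\<^sub>C v) = UNIV"
      by (rule irreducible_submodule [OF irr])
    then show ?thesis
    proof
      assume "range (\<lambda>v. \<phi> v - c *\<^sub>C v) = {0}"
      then have "\<forall>v. \<phi> v = c *\<^sub>C v"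
        by (metis eq_iff_diff_eq_0 rangeI singletonD)
      then have "\<exists>c. \<forall>v. \<phi> v = c *\<^sub>C v"
        by (rule exI)
      with neg show ?thesis
        by contradiction
    next
      assume "range (\<lambda>v. \<phi> v - c *\<^sub>C v) = UNIV"
      then have "v \<in> range (\<lambda>v. \<phi> v - c *\<^sub>C v)"
        by simp
      then show ?thesis
        by (elim rangeE) (rule exI, erule sym)
    qed
  qed
  define e where "e c = (SOME x. \<phi> x - c *\<^sub>C x = vac)" for c
  have e: "\<phi> (e c) - c *\<^sub>C e c = vac" for c
    unfolding e_def by (rule someI_ex) (rule surj)
  obtain S :: "'v set" where S: "countable S" "cvec.span S = UNIV"
    using dim by (auto simp: countable_dim_def)
  have "cvec.independent (range e)"
    by (rule resolvents_independent(2) [OF \<phi> _ e vac_nonzero [OF irr]]) (erule inj)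
  then have "countable (range e)"
    by (rule countable_independent [OF S(1)]) (unfold S(2), rule subset_UNIV)
  moreover have "inj e"
    by (rule resolvents_independent(1) [OF \<phi> _ e vac_nonzero [OF irr]]) (erule inj)
  ultimately have "countable (UNIV :: complex set)"
    by (rule countable_image_inj_on)
  then show False
    using uncountable_UNIV_complex by blast
qed

text \<open>Jacobson's density theorem, stated for any stable set of tuples instead of a cyclic
  submodule, since it will be applied to \<open>relations\<close>. In the inductive step, the
  entries at k of the tuples that vanish on the rest of J form a submodule; it must be all of V, as
  otherwise \<open>t0 k\<close> would be a combination of the other entries.\<close>

lemma density:
  assumes N: "stable_tuples N" and t0: "t0 \<in> N"
  shows "finite J \<Longrightarrow> (\<And>c. (\<Sum>j\<in>J. c j *\<^sub>C t0 j) = 0 \<Longrightarrow> \<forall>j\<in>J. c j = 0) \<Longrightarrow> k \<in> J \<Longrightarrow>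
    \<exists>t\<in>N. t k = x \<and> (\<forall>j\<in>J - {k}. t j = 0)"
proof (induction "card J" arbitrary: J k x)
  case (Suc m)
  define I where "I = J - {k}"
  have J: "J = insert k I" "k \<notin> I" "finite I" "m = card I"
    using Suc.prems Suc.hyps(2) by (auto simp: I_def)
  have ind: "c k = 0 \<and> (\<forall>j\<in>I. c j = 0)" if "c k *\<^sub>C t0 k + (\<Sum>j\<in>I. c j *\<^sub>C t0 j) = 0" for c
    using Suc.prems(2) [of c] that J by simp
  have IH: "\<exists>t\<in>N. t i = y \<and> (\<forall>j\<in>I - {i}. t j = 0)" if "i \<in> I" for i y
  proof (rule Suc.hyps(1) [OF J(4) J(3) _ that])
    fix c
    assume "(\<Sum>j\<in>I. c j *\<^sub>C t0 j) = 0"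
    moreover have "(\<Sum>j\<in>I. (c(k := 0)) j *\<^sub>C t0 j) = (\<Sum>j\<in>I. c j *\<^sub>C t0 j)"
      by (rule sum.cong) (use J in auto)
    ultimately show "\<forall>j\<in>I. c j = 0"
      using ind [of "c(k := 0)"] J(2) by (auto split: if_splits)
  qed
  have sub: "cvec.subspace N" and stable: "\<And>t u n. t \<in> N \<Longrightarrow> (\<lambda>j. Y u n (t j)) \<in> N"
    using N by (auto simp: stable_tuples_def)
  note add = cvec.subspace_add [OF sub] and scale = cvec.subspace_scale [OF sub]
    and minus = cvec.subspace_diff [OF sub] and zero = cvec.subspace_0 [OF sub]
  define M where "M = (\<lambda>t. t k) ` {t \<in> N. \<forall>j\<in>I. t j = 0}"
  have "submodule_of Y M"
    unfolding submodule_of_def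
  proof (intro conjI ballI allI)
    have "cvec.subspace {t \<in> N. \<forall>j\<in>I. t j = 0}"
      using add scale zero by (simp add: cvec.subspace_def fun_ops scaleC_fun_apply)
    then show "cvec.subspace M"
      unfolding M_def by (rule clinear_subspace_image [rotated]) (simp add: clinearI fun_ops scaleC_fun_apply)
  next
    fix u n v
    assume "v \<in> M"
    then obtain t where "t \<in> N" "v = t k" "\<forall>j\<in>I. t j = 0"
      by (auto simp: M_def)
    then show "Y u n v \<in> M"
      unfolding M_def by (intro image_eqI [of _ _ "\<lambda>j. Y u n (t j)"]) (simp_all add: stable)
  qed
  then have "M = {0} \<or> M = UNIV"
    by (rule irreducible_submodule [OF irr])
  moreover have "M \<noteq> {0}"
  proof
    assume "M = {0}"
    then have uniq: "t k = 0" if "t \<in> N" "\<forall>j\<in>I. t j = 0" for t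
      using that by (auto simp: M_def)
    \<comment> \<open>An arbitrary tuple with entry y at i and 0 elsewhere on I. By
      \<open>uniq\<close> its entry at k does not depend on the choice, which makes that entry
      linear in y and compatible with the modes.\<close>
    define T where "T i y = (SOME t. t \<in> N \<and> t i = y \<and> (\<forall>j\<in>I - {i}. t j = 0))" for i y
    have "T i y \<in> N \<and> T i y i = y \<and> (\<forall>j\<in>I - {i}. T i y j = 0)" if "i \<in> I" for i y
    proof -
      have "\<exists>t. t \<in> N \<and> t i = y \<and> (\<forall>j\<in>I - {i}. t j = 0)"
        using IH [OF that] by blast
      then show ?thesis
        unfolding T_def by (rule someI_ex)
    qed
    then have T: "T i y \<in> N" "T i y i = y" "\<And>j. j \<in> I \<Longrightarrow> j \<noteq> i \<Longrightarrow> T i y j = 0"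
      if "i \<in> I" for i y
      using that by auto
    have Tk: "T i y k = t k" if "i \<in> I" "t \<in> N" "t i = y" "\<And>j. j \<in> I \<Longrightarrow> j \<noteq> i \<Longrightarrow> t j = 0" for i t y
    proof -
      have "(T i y - t) k = 0"
      proof (rule uniq)
        show "T i y - t \<in> N"
          by (intro minus that T(1))
        show "\<forall>j\<in>I. (T i y - t) j = 0"
        proof
          fix j
          assume "j \<in> I"
          then show "(T i y - t) j = 0"
            using that(3,4) T(2,3) [OF that(1)] by (cases "j = i") simp_all
        qed
      qed
      then show ?thesis
        by simp
    qed
    have "\<exists>c. \<forall>y. T i y k = c *\<^sub>C y" if i: "i \<in> I" for i
    proof (rule Schur)
      show "clinear (\<lambda>y. T i y k)"
      proof (rule clinearI)
        fix x y
        have "T i (x + y) k = (T i x + T i y) k"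
        proof (rule Tk [OF i])
          show "T i x + T i y \<in> N"
            by (intro add T(1) i)
        qed (simp_all add: fun_ops T(2,3) [OF i])
        then show "T i (x + y) k = T i x k + T i y k"
          by (simp add: fun_ops)
      next
        fix c x
        have "T i (c *\<^sub>C x) k = (c *\<^sub>C T i x) k"
        proof (rule Tk [OF i])
          show "c *\<^sub>C T i x \<in> N"
            by (intro scale T(1) i)
        qed (simp_all add: scaleC_fun_apply T(2,3) [OF i])
        then show "T i (c *\<^sub>C x) k = c *\<^sub>C T i x k"
          by (simp add: scaleC_fun_apply)
      qed
      fix u n y
      show "T i (Y u n y) k = Y u n (T i y k)"
      proof (rule Tk [OF i, of "\<lambda>j. Y u n (T i y j)"])
        show "(\<lambda>j. Y u n (T i y j)) \<in> N"
          by (intro stable T(1) i)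
      qed (simp_all add: T(2,3) [OF i])
    qed
    then obtain c where c: "T i y k = c i *\<^sub>C y" if "i \<in> I" for i y
      by metis
    \<comment> \<open>Subtracting these tuples clears all entries of \<open>t0\<close> on I, hence
      also the one at k; by \<open>c\<close> this writes \<open>t0 k\<close> as a combination of the
      other entries.\<close>
    have "(t0 - (\<Sum>i\<in>I. T i (t0 i))) k = 0"
    proof (rule uniq)
      show "t0 - (\<Sum>i\<in>I. T i (t0 i)) \<in> N"
        by (intro minus t0 cvec.subspace_sum [OF sub]) (simp add: T)
      show "\<forall>j\<in>I. (t0 - (\<Sum>i\<in>I. T i (t0 i))) j = 0"
      proof
        fix j
        assume j: "j \<in> I"
        have "(\<Sum>i\<in>I. T i (t0 i) j) = (\<Sum>i\<in>{j}. T i (t0 i) j)"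
        proof (rule sum.mono_neutral_right [OF J(3)])
          show "\<forall>i\<in>I - {j}. T i (t0 i) j = 0"
            using j by (auto intro: T(3))
        qed (use j in simp)
        then show "(t0 - (\<Sum>i\<in>I. T i (t0 i))) j = 0"
          using j by (simp add: sum_apply T)
      qed
    qed
    then have "t0 k - (\<Sum>i\<in>I. c i *\<^sub>C t0 i) = 0"
      by (simp add: sum_apply c)
    moreover have "(\<Sum>i\<in>I. (\<lambda>i. if i = k then 1 else - c i) i *\<^sub>C t0 i) = (\<Sum>i\<in>I. - (c i *\<^sub>C t0 i))"
      by (rule sum.cong) (use J(2) in auto)
    ultimately show False
      using ind [of "\<lambda>i. if i = k then 1 else - c i"] by (simp add: scaleC_one sum_negf)
  qed
  ultimately have "x \<in> M"
    by simp
  then show ?case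
    unfolding M_def I_def by blast
qed simp

end

end

section \<open>Substitution and multiplication by powers of \<open>x\<^sub>0 + x\<^sub>2\<close>\<close>

lemma binomial_mult_alt:
  "binomial_mult l F p q = (\<Sum>j\<le>l. of_nat (l choose j) *\<^sub>C F (p - int l + int j) (q - int j))"
  unfolding binomial_mult_def by (rule sum.cong) (auto simp: of_nat_diff algebra_simps)

lemma binomial_mult_0 [simp]: "binomial_mult 0 F p q = F p q"
  by (simp add: binomial_mult_def scaleC_one)

lemma binomial_mult_Suc:
  "binomial_mult (Suc l) F p q = binomial_mult l F (p - 1) q + binomial_mult l F p (q - 1)"
proof -
  let ?F = "\<lambda>j. F (p - 1 - int l + int j) (q - int j)"
  have "binomial_mult (Suc l) F p q = (\<Sum>j\<le>Suc l. of_nat (Suc l choose j) *\<^sub>C ?F j)"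
    by (simp add: binomial_mult_alt algebra_simps del: sum.atMost_Suc binomial_Suc_Suc)
  also have "\<dots> = ?F 0 + (\<Sum>j\<le>l. of_nat (l choose Suc j) *\<^sub>C ?F (Suc j))
      + (\<Sum>j\<le>l. of_nat (l choose j) *\<^sub>C ?F (Suc j))"
    unfolding sum.atMost_Suc_shift by (simp add: scaleC_add_left sum.distrib scaleC_one)
  also have "?F 0 + (\<Sum>j\<le>l. of_nat (l choose Suc j) *\<^sub>C ?F (Suc j))
      = (\<Sum>j\<le>Suc l. of_nat (l choose j) *\<^sub>C ?F j)"
    unfolding sum.atMost_Suc_shift by (simp add: scaleC_one)
  also have "\<dots> = binomial_mult l F (p - 1) q"
    by (simp add: binomial_mult_alt)
  also have "(\<Sum>j\<le>l. of_nat (l choose j) *\<^sub>C ?F (Suc j)) = binomial_mult l F p (q - 1)"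
    unfolding binomial_mult_alt by (rule sum.cong) (simp_all add: algebra_simps)
  finally show ?thesis .
qed

lemma binomial_mult_translate:
  "binomial_mult l (\<lambda>p q. F (p + a) (q + b)) p q = binomial_mult l F (p + a) (q + b)"
  by (simp add: binomial_mult_def algebra_simps)

lemma binomial_mult_add:
  "binomial_mult l (\<lambda>p q. F p q + G p q) p q = binomial_mult l F p q + binomial_mult l G p q"
  by (simp add: binomial_mult_def scaleC_add_right sum.distrib)

lemma binomial_mult_sum:
  "binomial_mult l (\<lambda>p q. \<Sum>i\<in>A. F i p q) p q = (\<Sum>i\<in>A. binomial_mult l (F i) p q)"
  unfolding binomial_mult_def cvec.scale_sum_right by (rule sum.swap)

lemma binomial_mult_linear:
  "clinear \<phi> \<Longrightarrow> binomial_mult l (\<lambda>p q. \<phi> (F p q)) p q = \<phi> (binomial_mult l F p q)"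
  by (simp add: binomial_mult_def clinear_sum clinear_scaleC)

lemma binomial_mult_commute: "binomial_mult i (binomial_mult l F) = binomial_mult l (binomial_mult i F)"
proof (induction i)
  case (Suc i)
  have "binomial_mult l (binomial_mult (Suc i) F) p q
      = binomial_mult l (\<lambda>p q. binomial_mult i F (p + -1) (q + 0) + binomial_mult i F (p + 0) (q + -1)) p q" for p q
    by (rule arg_cong [of _ _ "\<lambda>F. binomial_mult l F p q"]) (simp add: fun_eq_iff binomial_mult_Suc)
  then show ?case
    by (simp add: fun_eq_iff binomial_mult_Suc Suc binomial_mult_add
      binomial_mult_translate [of l _ "-1" 0, simplified] binomial_mult_translate [of l _ 0 "-1", simplified])
qed (simp add: fun_eq_iff binomial_mult_def scaleC_one)

lemma binomial_mult_mono:
  assumes "binomial_mult l F = binomial_mult l G" "l \<le> l'"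
  shows "binomial_mult l' F = binomial_mult l' G"
  using assms(2,1) by (induction rule: dec_induct) (simp_all add: fun_eq_iff binomial_mult_Suc)

text \<open>In the lowest power of x0 present, (x0 + x2)^l acts as x2^l. Without a lower bound the
  claim fails: x0 + x2 kills the sum of (-1)^n x0^n x2^(-n-1) over all integers n.\<close>

lemma binomial_mult_cancel:
  assumes zero: "\<And>p q. binomial_mult l F p q = 0" and p0: "\<And>p q. p < p0 \<Longrightarrow> F p q = 0"
  shows "F p q = 0"
proof -
  have "F (p0 + int n) q = 0" for n q
  proof (induction n arbitrary: q rule: less_induct)
    case (less n)
    have below: "F p' q' = 0" if "p' < p0 + int n" for p' q'
      using that p0 [of p' q'] less.IH [of "nat (p' - p0)" q'] by (cases "p' < p0") auto
    \<comment> \<open>The shift of q by l compensates the factor x2^l of the term j = l; all other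
      terms have a smaller power of x0.\<close>
    have "binomial_mult l F (p0 + int n) (q + int l)
       = (\<Sum>j\<in>{l}. of_nat (l choose j) *\<^sub>C F (p0 + int n - int l + int j) (q + int l - int j))"
      unfolding binomial_mult_alt
      by (rule sum.mono_neutral_right) (auto intro!: below)
    then show ?case
      by (simp add: zero scaleC_one)
  qed
  from this [of "nat (p - p0)" q] show ?thesis
    using p0 [of p q] by (cases "p < p0") auto
qed

text \<open>\<open>Tsub F\<close> is \<open>F(x\<^sub>0 + x\<^sub>2, x\<^sub>2)\<close>.\<close>

definition Tsub :: "(int \<Rightarrow> int \<Rightarrow> 'v::complex_vector) \<Rightarrow> int \<Rightarrow> int \<Rightarrow> 'v" where
  "Tsub F p q = Sum_any (\<lambda>i::nat. ichoose (p + int i) i *\<^sub>C F (p + int i) (q - int i))"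

text \<open>The lower bound on the powers of x2 is uniform in those of x1. Expanding (x0 + x2)^p in
  nonnegative powers of x2 then gives finite sums as coefficients.\<close>

definition qbounded :: "(int \<Rightarrow> int \<Rightarrow> 'v::complex_vector) \<Rightarrow> bool" where
  "qbounded F \<longleftrightarrow> (\<exists>q0. \<forall>q<q0. \<forall>p. F p q = 0)"

lemma qbounded_eventually:
  assumes "qbounded F"
  shows "\<forall>\<^sub>F I in sequentially. \<forall>i\<ge>I. \<forall>p. \<forall>q\<le>Q. F p (q - int i) = 0"
proof -
  obtain q0 where "\<forall>q<q0. \<forall>p. F p q = 0"
    using assms by (auto simp: qbounded_def)
  then show ?thesis
    by (intro eventually_nat_ge [of "nat (Q - q0 + 1)"]) auto
qed

lemma Tsub_eventually:
  assumes "qbounded F"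
  shows "\<forall>\<^sub>F I in sequentially. \<forall>p. \<forall>q\<le>Q. Tsub F p q =
    (\<Sum>i<I. ichoose (p + int i) i *\<^sub>C F (p + int i) (q - int i))"
  using qbounded_eventually [OF assms, of Q]
proof eventually_elim
  case (elim I)
  then show ?case
    unfolding Tsub_def
    by (intro allI impI Sum_any.expand_superset) (auto simp: not_less [symmetric])
qed

lemma qbounded_shift: "qbounded F \<Longrightarrow> qbounded (\<lambda>p q. F (p - a) (q - b))"
  unfolding qbounded_def by (metis diff_less_eq)

lemma Tsub_add:
  assumes "qbounded F" "qbounded G"
  shows "Tsub (\<lambda>p q. F p q + G p q) p q = Tsub F p q + Tsub G p q" and "qbounded (\<lambda>p q. F p q + G p q)"
proof -
  obtain a b where "\<forall>q<a. \<forall>p. F p q = 0" "\<forall>q<b. \<forall>p. G p q = 0"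
    using assms by (auto simp: qbounded_def)
  then show FG: "qbounded (\<lambda>p q. F p q + G p q)"
    unfolding qbounded_def by (intro exI [of _ "min a b"]) auto
  have "\<forall>\<^sub>F I in sequentially. Tsub (\<lambda>p q. F p q + G p q) p q = Tsub F p q + Tsub G p q"
    using Tsub_eventually [OF FG, of q] Tsub_eventually [OF assms(1), of q] Tsub_eventually [OF assms(2), of q]
    by eventually_elim (simp add: scaleC_add_right sum.distrib)
  then show "Tsub (\<lambda>p q. F p q + G p q) p q = Tsub F p q + Tsub G p q"
    by simp
qed

text \<open>The substitution turns the factor x1 into x0 + x2; on coefficients this is Pascal's
  rule.\<close>

lemma Tsub_shift_first:
  assumes "qbounded F"
  shows "Tsub (\<lambda>p q. F (p - 1) q) p q = Tsub F (p - 1) q + Tsub F p (q - 1)"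
proof -
  have sh: "qbounded (\<lambda>p q. F (p - 1) q)"
    using qbounded_shift [OF assms, of 1 0] by simp
  let ?F = "\<lambda>i. F (p - 1 + int i) (q - int i)"
  have "\<forall>\<^sub>F I::nat in sequentially. ?thesis"
    using Tsub_eventually [OF sh, of q] Tsub_eventually [OF assms, of q]
      eventually_all_ge_at_top [OF Tsub_eventually [OF assms, of q]]
      eventually_all_ge_at_top [OF Tsub_eventually [OF sh, of q]]
  proof eventually_elim
    case (elim I)
    \<comment> \<open>One term more than I: once i = 0 is split off, the rest is indexed by
      \<open>Suc i\<close> with i < I.\<close>
    have "Tsub (\<lambda>p q. F (p - 1) q) p q = (\<Sum>i<Suc I. ichoose (p + int i) i *\<^sub>C ?F i)"
      using elim(4) by (simp add: algebra_simps del: sum.lessThan_Suc of_int_add)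
    also have "\<dots> = ?F 0 + (\<Sum>i<I. (ichoose (p + int (Suc i)) (Suc i)) *\<^sub>C ?F (Suc i))"
      by (subst sum.lessThan_Suc_shift) (simp add: scaleC_one)
    also have "\<dots> = ?F 0 + (\<Sum>i<I. (ichoose (p + int i) (Suc i)) *\<^sub>C ?F (Suc i))
      + (\<Sum>i<I. ichoose (p + int i) i *\<^sub>C ?F (Suc i))"
    proof -
      have "(ichoose (p + int (Suc i)) (Suc i))
        = (ichoose (p + int i) i) + (ichoose (p + int i) (Suc i))" for i
        using gbinomial_Suc_Suc [of "of_int (p + int i) :: complex" i] by (simp add: add_ac)
      then show ?thesis
        by (simp add: scaleC_add_left sum.distrib add_ac del: of_int_add of_nat_Suc)
    qed
    also have "?F 0 + (\<Sum>i<I. (ichoose (p + int i) (Suc i)) *\<^sub>C ?F (Suc i))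
      = (\<Sum>i<Suc I. ichoose (p - 1 + int i) i *\<^sub>C ?F i)"
      by (subst sum.lessThan_Suc_shift) (simp add: scaleC_one)
    also have "\<dots> = Tsub F (p - 1) q"
      by (rule elim(3) [rule_format, symmetric]) simp_all
    also have "(\<Sum>i<I. ichoose (p + int i) i *\<^sub>C ?F (Suc i)) = Tsub F p (q - 1)"
      using elim(2) by (simp add: algebra_simps del: of_int_add)
    finally show ?case .
  qed
  then show ?thesis
    by simp
qed

lemma Tsub_shift:
  assumes "qbounded F"
  shows "Tsub (\<lambda>p q. F (p - int i) (q - int j)) p q = binomial_mult i (Tsub F) p (q - int j)"
proof -
  have "Tsub (\<lambda>p q. F (p - int i) q) p q = binomial_mult i (Tsub F) p q" for p q
  proof (induction i arbitrary: p q)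
    case (Suc i)
    have "Tsub (\<lambda>p q. (\<lambda>p q. F (p - int i) q) (p - 1) q) p q
       = Tsub (\<lambda>p q. F (p - int i) q) (p - 1) q + Tsub (\<lambda>p q. F (p - int i) q) p (q - 1)"
      by (rule Tsub_shift_first) (use qbounded_shift [OF assms, of "int i" 0] in simp)
    then show ?case
      by (simp add: binomial_mult_Suc Suc algebra_simps)
  qed (simp)
  moreover have "Tsub (\<lambda>p q. F (p - int i) (q - int j)) p q = Tsub (\<lambda>p q. F (p - int i) q) p (q - int j)"
    by (simp add: Tsub_def algebra_simps)
  ultimately show ?thesis
    by simp
qed

section \<open>Nondegeneracy\<close>

context vertex_structure
begin

lemma shifted_product_Tsub:
  "shifted_product_coeff Y u v w = Tsub (\<lambda>p q. Y u (- p - 1) (Y v (- q - 1) w))"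
  by (simp add: shifted_product_coeff_def Tsub_def fun_eq_iff)

lemma qbounded_product: "qbounded (\<lambda>p q. Y u (- p - 1) (Y v (- q - 1) w))"
proof -
  obtain N where "\<forall>n\<ge>N. Y v n w = 0"
    using truncation by blast
  then show ?thesis
    unfolding qbounded_def by (intro exI [of _ "- N"]) auto
qed

text \<open>The coefficient of x^(-n-1) in h(x)Y(u, x)w, where h is a power series with coefficients
  \<open>h a\<close>.\<close>

definition Ysum :: "(nat \<Rightarrow> complex) \<Rightarrow> 'v \<Rightarrow> int \<Rightarrow> 'v \<Rightarrow> 'v" where
  "Ysum h u n w = Sum_any (\<lambda>a::nat. h a *\<^sub>C Y u (n + int a) w)"

lemma Ysum_eventually:
  "\<forall>\<^sub>F I in sequentially. \<forall>r. Ysum h u (n + int r) w = (\<Sum>a<I. h a *\<^sub>C Y u (n + int r + int a) w)"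
  using Y_vanishes [of u n w]
proof eventually_elim
  case (elim I)
  then have "Y u (n + int r + int a) w = 0" if "a \<ge> I" for a r
    using spec [OF elim, of "r + a"] that by (simp add: add.assoc)
  then show ?case
    unfolding Ysum_def
    by (intro allI Sum_any.expand_superset) (auto simp: not_less [symmetric])
qed

lemma Ysum_eventually0: "\<forall>\<^sub>F I in sequentially. Ysum h u n w = (\<Sum>a<I. h a *\<^sub>C Y u (n + int a) w)"
  using Ysum_eventually [of h u n w] by eventually_elim (metis add.right_neutral of_nat_0)

lemma Ysum_add: "Ysum h (u + u') n w = Ysum h u n w + Ysum h u' n w"
proof -
  have "\<forall>\<^sub>F I::nat in sequentially. ?thesis"
    using Ysum_eventually0 [of h "u + u'" n w] Ysum_eventually0 [of h u n w] Ysum_eventually0 [of h u' n w]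
    by eventually_elim (simp add: Y_add_state scaleC_add_right sum.distrib)
  then show ?thesis
    by simp
qed

lemma Ysum_scaleC: "Ysum h (c *\<^sub>C u) n w = c *\<^sub>C Ysum h u n w"
proof -
  have "\<forall>\<^sub>F I::nat in sequentially. ?thesis"
    using Ysum_eventually0 [of h "c *\<^sub>C u" n w] Ysum_eventually0 [of h u n w]
    by eventually_elim (simp add: Y_scaleC_state scaleC_scaleC cvec.scale_sum_right mult.commute)
  then show ?thesis
    by simp
qed

lemma Ysum_0 [simp]: "Ysum h 0 n w = 0"
  by (simp add: Ysum_def)

lemma Ysum_vac: "Ysum h vac (- 1 - int a) w = h a *\<^sub>C w"
proof -
  have "Ysum h vac (- 1 - int a) w = Sum_any (\<lambda>b. if b = a then h b *\<^sub>C w else 0)"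
    unfolding Ysum_def by (rule Sum_any.cong) (auto simp: vacuum)
  then show ?thesis
    by simp
qed

lemma Ysum_iterate:
  "\<forall>\<^sub>F I in sequentially. binomial_mult l (\<lambda>p q. Ysum h (Y u (- p - 1) x) (- q - 1) w) p q =
    (\<Sum>a<I. h a *\<^sub>C binomial_mult l (iterate_coeff Y u x w) p (q - int a))"
proof -
  have "\<forall>\<^sub>F I in sequentially. \<forall>j\<in>{..l}.
      Ysum h (Y u (- (p - int (l - j)) - 1) x) (- (q - int j) - 1) w =
      (\<Sum>a<I. h a *\<^sub>C Y (Y u (- (p - int (l - j)) - 1) x) (- (q - int j) - 1 + int a) w)"
    by (intro eventually_ball_finite ballI Ysum_eventually0) simp
  then show ?thesis
  proof eventually_elim
    case (elim I)
    then have "binomial_mult l (\<lambda>p q. Ysum h (Y u (- p - 1) x) (- q - 1) w) p q =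
       (\<Sum>j\<le>l. \<Sum>a<I. h a *\<^sub>C of_nat (l choose j) *\<^sub>C
          iterate_coeff Y u x w (p - int (l - j)) (q - int a - int j))"
      by (simp add: binomial_mult_def cvec.scale_sum_right iterate_coeff_def algebra_simps scaleC_scaleC)
    then show ?case
      by (subst (asm) sum.swap) (simp add: binomial_mult_def cvec.scale_sum_right)
  qed
qed

text \<open>The scalar series h(x2) commutes with the modes of u and is absorbed into the inner
  factor, where a relation can be applied.\<close>

lemma Ysum_product:
  "\<forall>\<^sub>F I in sequentially. (\<Sum>a<I. h a *\<^sub>C shifted_product_coeff Y u x w p (q - int a)) =
    (\<Sum>r<I. ichoose (p + int r) r *\<^sub>C
      Y u (- (p + int r) - 1) (Ysum h x (- (q - int r) - 1) w))"
  using Tsub_eventually [OF qbounded_product [of u x w], of q] Ysum_eventually [of h x "- q - 1" w]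
proof eventually_elim
  case (elim I)
  have "(\<Sum>a<I. h a *\<^sub>C shifted_product_coeff Y u x w p (q - int a)) =
    (\<Sum>a<I. \<Sum>r<I. ichoose (p + int r) r *\<^sub>C h a *\<^sub>C
      Y u (- (p + int r) - 1) (Y x (- q - 1 + int r + int a) w))"
    using elim(1) by (simp add: shifted_product_Tsub cvec.scale_sum_right scaleC_scaleC algebra_simps)
  also have "\<dots> = (\<Sum>r<I. \<Sum>a<I. ichoose (p + int r) r *\<^sub>C h a *\<^sub>C
      Y u (- (p + int r) - 1) (Y x (- q - 1 + int r + int a) w))"
    by (rule sum.swap)
  also have "\<dots> = (\<Sum>r<I. ichoose (p + int r) r *\<^sub>C
      Y u (- (p + int r) - 1) (Ysum h x (- q - 1 + int r) w))"
    using elim(2) by (simp add: Y_sum_arg Y_scaleC_arg cvec.scale_sum_right)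
  finally show ?case
    by (simp add: algebra_simps)
qed

end

context nonlocal_vertex_algebra
begin

lemma weak_associativity_finite:
  assumes "finite X"
  shows "\<exists>l. \<forall>(u, v, w)\<in>X. binomial_mult l (shifted_product_coeff Y u v w) = binomial_mult l (iterate_coeff Y u v w)"
  using assms
proof (induction X)
  case (insert x X)
  obtain u v w where x: "x = (u, v, w)"
    using prod_cases3 by blast
  obtain k where k: "binomial_mult k (shifted_product_coeff Y u v w) = binomial_mult k (iterate_coeff Y u v w)"
    using weak_associativity by blast
  obtain l where l: "\<forall>(u, v, w)\<in>X. binomial_mult l (shifted_product_coeff Y u v w) = binomial_mult l (iterate_coeff Y u v w)"
    using insert.IH by blast
  have "\<forall>(u, v, w)\<in>insert x X. binomial_mult (max k l) (shifted_product_coeff Y u v w) = binomial_mult (max k l) (iterate_coeff Y u v w)"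
    using l binomial_mult_mono [OF k, of "max k l"]
    by (auto simp: x intro: binomial_mult_mono [of l _ _ "max k l"])
  then show ?case
    by blast
qed simp

text \<open>The tuples are indexed by the vectors of A themselves: the identity function stands for
  the original relation, and other tuples replace the vectors while \<open>C\<close> and
  \<open>H\<close> stay fixed.\<close>

definition relations :: "'v set \<Rightarrow> 'v set \<Rightarrow> ('v \<Rightarrow> 'v \<Rightarrow> nat \<Rightarrow> complex) \<Rightarrow> ('v \<Rightarrow> 'v) set" where
  "relations A C H = {t. \<forall>n. (\<Sum>v\<in>A. \<Sum>w\<in>C. Ysum (H v w) (t v) n w) = 0}"

text \<open>By weak associativity, \<open>\<Sum> h\<^sub>v\<^sub>w(x) Y(t v, x) w = 0\<close> implies
  \<open>\<Sum> h\<^sub>v\<^sub>w(x) Y(u\<^sub>m (t v), x) w = 0\<close>.\<close>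

lemma relations_stable:
  assumes "finite A" "finite C" "t \<in> relations A C H"
  shows "(\<lambda>v. Y u m (t v)) \<in> relations A C H"
proof -
  define E where "E p q = (\<Sum>v\<in>A. \<Sum>w\<in>C. Ysum (H v w) (Y u (- p - 1) (t v)) (- q - 1) w)" for p q
  have "finite ((\<lambda>(v, w). (u, t v, w)) ` (A \<times> C))"
    using assms by simp
  from weak_associativity_finite [OF this] obtain l where l: "\<And>v w. v \<in> A \<Longrightarrow> w \<in> C \<Longrightarrow>
      binomial_mult l (shifted_product_coeff Y u (t v) w) = binomial_mult l (iterate_coeff Y u (t v) w)"
    by fastforce
  \<comment> \<open>Multiplication by (x0 + x2)^l turns the iterates into Y(u, x0 + x2) applied to
    the given relation.\<close>
  have zero: "binomial_mult l E p q = 0" for p q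
  proof -
    let ?S = "\<lambda>v w j a. shifted_product_coeff Y u (t v) w (p - int (l - j)) (q - int j - int a)"
    let ?c = "\<lambda>j r. ichoose (p - int (l - j) + int r) r"
    let ?q = "\<lambda>j r. - (q - int j - int r) - 1"
    let ?U = "\<lambda>j r. Y u (- (p - int (l - j) + int r) - 1)"
    have "\<forall>\<^sub>F I in sequentially. \<forall>v\<in>A. \<forall>w\<in>C.
        binomial_mult l (\<lambda>p q. Ysum (H v w) (Y u (- p - 1) (t v)) (- q - 1) w) p q =
        (\<Sum>a<I. H v w a *\<^sub>C binomial_mult l (iterate_coeff Y u (t v) w) p (q - int a))"
      by (intro eventually_ball_finite ballI Ysum_iterate assms(1,2))
    moreover have "\<forall>\<^sub>F I in sequentially. \<forall>v\<in>A. \<forall>w\<in>C. \<forall>j\<in>{..l}.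
        (\<Sum>a<I. H v w a *\<^sub>C ?S v w j a) = (\<Sum>r<I. ?c j r *\<^sub>C ?U j r (Ysum (H v w) (t v) (?q j r) w))"
      by (intro eventually_ball_finite ballI Ysum_product assms(1,2)) simp
    ultimately have "\<forall>\<^sub>F I::nat in sequentially. binomial_mult l E p q = 0"
    proof eventually_elim
      case (elim I)
      have "binomial_mult l E p q = (\<Sum>v\<in>A. \<Sum>w\<in>C. \<Sum>a<I. H v w a *\<^sub>C
          binomial_mult l (iterate_coeff Y u (t v) w) p (q - int a))"
        unfolding E_def [abs_def] by (simp add: binomial_mult_sum elim(1))
      also have "\<dots> = (\<Sum>v\<in>A. \<Sum>w\<in>C. \<Sum>a<I. \<Sum>j\<le>l. of_nat (l choose j) *\<^sub>C H v w a *\<^sub>C ?S v w j a)"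
        by (intro sum.cong refl)
           (simp add: l [symmetric] binomial_mult_def cvec.scale_sum_right scaleC_scaleC algebra_simps)
      also have "\<dots> = (\<Sum>v\<in>A. \<Sum>w\<in>C. \<Sum>j\<le>l. of_nat (l choose j) *\<^sub>C (\<Sum>r<I. ?c j r *\<^sub>C ?U j r (Ysum (H v w) (t v) (?q j r) w)))"
      proof (rule sum.cong [OF refl], rule sum.cong [OF refl])
        fix v w
        assume vw: "v \<in> A" "w \<in> C"
        show "(\<Sum>a<I. \<Sum>j\<le>l. of_nat (l choose j) *\<^sub>C H v w a *\<^sub>C ?S v w j a) =
          (\<Sum>j\<le>l. of_nat (l choose j) *\<^sub>C (\<Sum>r<I. ?c j r *\<^sub>C ?U j r (Ysum (H v w) (t v) (?q j r) w)))"
          by (subst sum.swap, unfold cvec.scale_sum_right [symmetric])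
             (intro sum.cong refl arg_cong [of _ _ "scaleC _"] elim(2) [rule_format] vw)
      qed
      also have "\<dots> = (\<Sum>j\<le>l. \<Sum>r<I. of_nat (l choose j) *\<^sub>C ?c j r *\<^sub>C ?U j r (\<Sum>v\<in>A. \<Sum>w\<in>C. Ysum (H v w) (t v) (?q j r) w))"
        unfolding Y_sum_arg cvec.scale_sum_right
        by (simp only: sum.swap [of _ "{..l}" C] sum.swap [of _ "{..l}" A] sum.swap [of _ "{..<I}" C] sum.swap [of _ "{..<I}" A])
      also have "\<dots> = 0"
        using assms(3) by (simp add: relations_def)
      finally show ?case .
    qed
    then show ?thesis
      by simp
  qed
  have "\<forall>\<^sub>F i in sequentially. \<forall>v\<in>A. \<forall>j\<ge>i. Y u (0 + int j) (t v) = 0"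
    by (intro eventually_ball_finite ballI Y_vanishes assms(1))
  then obtain K where K: "\<And>v j. v \<in> A \<Longrightarrow> j \<ge> K \<Longrightarrow> Y u (int j) (t v) = 0"
    by (auto simp: eventually_sequentially)
  \<comment> \<open>Since A is finite, the powers of x0 in E are bounded below, so (x0 + x2)^l may
    be cancelled.\<close>
  have "E p q = 0" for p q
  proof (rule binomial_mult_cancel [of l E "- int K - 1", OF zero])
    fix p q :: int
    assume "p < - int K - 1"
    then have "Y u (- p - 1) (t v) = 0" if "v \<in> A" for v
      using K [OF that, of "nat (- p - 1)"] by simp
    then show "E p q = 0"
      by (simp add: E_def)
  qed
  from this [of "- m - 1" "- _ - 1"] show ?thesis
    by (simp add: relations_def E_def)
qed

lemma nondegenerate:
  assumes irr: "adjoint_irreducible Y" and dim: "countable_dim (UNIV :: 'v set)"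
    and A: "finite A" "cvec.independent A" and C: "finite C" "cvec.independent C"
    and zero: "\<And>n. (\<Sum>v\<in>A. \<Sum>w\<in>C. Ysum (H v w) v n w) = 0"
    and k: "k \<in> A" and w: "w \<in> C"
  shows "H k w a = 0"
proof -
  have stable: "stable_tuples (relations A C H)"
    unfolding stable_tuples_def
  proof (intro conjI ballI allI relations_stable A C)
    show "cvec.subspace (relations A C H)"
      by (auto simp: cvec.subspace_def relations_def fun_ops scaleC_fun_apply Ysum_add Ysum_scaleC
        sum.distrib simp flip: cvec.scale_sum_right)
  qed
  have "(\<lambda>v. v) \<in> relations A C H"
    by (simp add: relations_def zero)
  then have "\<exists>t\<in>relations A C H. t k = vac \<and> (\<forall>j\<in>A - {k}. t j = 0)"
    by (rule density [OF irr dim stable _ A(1) _ k]) (use cvec.independentD [OF A(2,1) subset_refl] in blast)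
  then obtain t where t: "t \<in> relations A C H" "t k = vac" "\<And>j. j \<in> A \<Longrightarrow> j \<noteq> k \<Longrightarrow> t j = 0"
    by blast
  have "(\<Sum>v\<in>A. \<Sum>w\<in>C. Ysum (H v w) (t v) n w) = (\<Sum>v\<in>{k}. \<Sum>w\<in>C. Ysum (H v w) (t v) n w)" for n
    by (rule sum.mono_neutral_right) (use A k t(3) in auto)
  \<comment> \<open>As Y(vac, x) = 1, this mode reads off the coefficient of x^a.\<close>
  then have "(\<Sum>w\<in>C. Ysum (H k w) vac (- 1 - int a) w) = 0"
    using t(1,2) by (simp add: relations_def)
  then have "(\<Sum>w\<in>C. H k w a *\<^sub>C w) = 0"
    by (simp only: Ysum_vac)
  then show ?thesis
    by (rule cvec.independentD [OF C(2,1) subset_refl _ w])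
qed

end

section \<open>Independence of coefficient operators\<close>

text \<open>Differentiate the relation for i and k: the terms with one more derivative on f vanish
  by induction, which is for every i at once, and the factor k + 1 can be divided out.\<close>

lemma sum_hasse_mult:
  assumes zero: "\<And>i. (\<Sum>j\<in>J. hasse i (f j) * g j) = 0"
  shows "(\<Sum>j\<in>J. hasse i (f j) * hasse k (g j)) = 0"
proof (induction k arbitrary: i)
  case (Suc k)
  have "fls_deriv (\<Sum>j\<in>J. hasse i (f j) * hasse k (g j)) =
      of_nat (Suc i) * (\<Sum>j\<in>J. hasse (Suc i) (f j) * hasse k (g j))
      + of_nat (Suc k) * (\<Sum>j\<in>J. hasse i (f j) * hasse (Suc k) (g j))"
    unfolding fls_deriv_sum sum_distrib_left sum.distrib [symmetric]
    by (rule sum.cong) (simp_all add: deriv_hasse algebra_simps del: of_nat_Suc)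
  then have "of_nat (Suc k) * (\<Sum>j\<in>J. hasse i (f j) * hasse (Suc k) (g j)) = 0"
    by (simp add: Suc del: of_nat_Suc)
  then show ?case
    by (simp del: of_nat_Suc)
qed (simp add: zero)

text \<open>If \<open>\<Sum> f\<^sub>j(x\<^sub>1 - x\<^sub>2) g\<^sub>j(x\<^sub>1) = 0\<close>, then \<open>\<Sum> f\<^sub>j(x) g\<^sub>j(y) = 0\<close> for independent \<open>x\<close>, \<open>y\<close>.\<close>

lemma sum_nth_mult:
  assumes J: "finite J" and zero: "\<And>i. (\<Sum>j\<in>J. hasse i (f j) * g j) = 0"
  shows "(\<Sum>j\<in>J. f j $$ p * g j $$ q) = 0"
proof -
  have "\<exists>M. \<forall>m<M. h $$ m = 0" for h :: "complex fls"
    using fls_bounded_below by metis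
  then obtain L where L: "\<And>h m. m < L h \<Longrightarrow> (h :: complex fls) $$ m = 0"
    by metis
  \<comment> \<open>A common bound for the pole orders: multiplication by x^M makes every series a
    power series.\<close>
  define M where "M = Max (insert 0 ((\<lambda>j. \<bar>L (f j)\<bar> + \<bar>L (g j)\<bar>) ` J))"
  have M: "f j $$ m = 0 \<and> g j $$ m = 0" if "j \<in> J" "m < - M" for j m
  proof -
    have "\<bar>L (f j)\<bar> + \<bar>L (g j)\<bar> \<le> M"
      unfolding M_def by (rule Max_ge) (use J that in auto)
    then show ?thesis
      using that(2) by (auto intro!: L)
  qed
  let ?x = "fls_X_intpow M :: complex fls"
  \<comment> \<open>By Leibniz' rule the relation survives multiplication of both factors by
    x^M.\<close>
  have "(\<Sum>j\<in>J. hasse i (?x * f j) * (?x * g j)) = 0" for i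
  proof -
    have "(\<Sum>j\<in>J. hasse i (?x * f j) * (?x * g j)) = (\<Sum>p\<le>i. hasse p ?x * ?x * (\<Sum>j\<in>J. hasse (i - p) (f j) * g j))"
      unfolding hasse_mult sum_distrib_left sum_distrib_right
      by (subst sum.swap) (simp add: mult_ac)
    then show ?thesis
      by (simp add: zero)
  qed
  then have all: "(\<Sum>j\<in>J. hasse i (?x * f j) * hasse k (?x * g j)) = 0" for i k
    by (rule sum_hasse_mult)
  show ?thesis
  proof (cases "p < - M \<or> q < - M")
    case True
    then show ?thesis
      by (intro sum.neutral ballI) (auto simp: M)
  next
    case False
    \<comment> \<open>Every coefficient of a power series is the constant term of a Hasse
      derivative, and constant terms of power series multiply.\<close>
    have const: "hasse i h $$ 0 = h $$ int i" for i h
      by (simp add: hasse_nth flip: binomial_gbinomial)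
    have hf: "hasse (nat (p + M)) (?x * f j) $$ 0 = f j $$ p" "hasse (nat (q + M)) (?x * g j) $$ 0 = g j $$ q" for j
      using False unfolding const by (simp_all add: fls_X_intpow_times_conv_shift)
    have below: "hasse i (?x * f j) $$ m = 0" "hasse i (?x * g j) $$ m = 0" if "j \<in> J" "m < 0" for i j m
    proof -
      have "(of_int (m + int i) gchoose i :: complex) = 0" if "m + int i \<ge> 0"
      proof -
        have "(of_int (m + int i) :: complex) = of_nat (nat (m + int i))"
          using that by (simp add: of_nat_nat)
        then have "(of_int (m + int i) gchoose i :: complex) = of_nat (nat (m + int i) choose i)"
          by (simp only: binomial_gbinomial)
        then show ?thesis
          using that \<open>m < 0\<close> by (simp add: binomial_eq_0 del: of_int_add)
      qed
      moreover have "(?x * f j) $$ (m + int i) = 0" "(?x * g j) $$ (m + int i) = 0" if "m + int i < 0"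
        using M [OF \<open>j \<in> J\<close>] that by (simp_all add: fls_X_intpow_times_conv_shift)
      ultimately show "hasse i (?x * f j) $$ m = 0" "hasse i (?x * g j) $$ m = 0"
        by (cases "m + int i < 0"; simp add: hasse_nth)+
    qed
    have prod: "(hasse i (?x * f j) * hasse k (?x * g j)) $$ 0 = hasse i (?x * f j) $$ 0 * hasse k (?x * g j) $$ 0"
      if "j \<in> J" for i j k
    proof -
      have "Sum_any (\<lambda>l. hasse i (?x * f j) $$ (0 - l) * hasse k (?x * g j) $$ l)
        = (\<Sum>l\<in>{0}. hasse i (?x * f j) $$ (0 - l) * hasse k (?x * g j) $$ l)"
      proof (rule Sum_any.expand_superset)
        show "{l. hasse i (?x * f j) $$ (0 - l) * hasse k (?x * g j) $$ l \<noteq> 0} \<subseteq> {0}"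
        proof
          fix l
          assume l: "l \<in> {l. hasse i (?x * f j) $$ (0 - l) * hasse k (?x * g j) $$ l \<noteq> 0}"
          have "\<not> l < 0"
            using l below(2) [OF that, of l k] by auto
          moreover have "\<not> 0 - l < 0"
            using l below(1) [OF that, of "0 - l" i] by auto
          ultimately show "l \<in> {0}"
            by simp
        qed
      qed simp
      then show ?thesis
        by (simp add: fls_times_nth_Sum_any)
    qed
    have "(\<Sum>j\<in>J. f j $$ p * g j $$ q) =
      (\<Sum>j\<in>J. hasse (nat (p + M)) (?x * f j) * hasse (nat (q + M)) (?x * g j)) $$ 0"
      by (simp add: fls_nth_sum prod hf)
    then show ?thesis
      by (simp add: all)
  qed
qed

section \<open>Finite expansions over common independent vectors\<close>

lemma laurent_tensor_expansion:
  assumes "s \<in> laurent_tensor"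
  shows "\<exists>A f. finite A \<and> s = (\<Sum>v\<in>A. gen (f v) v)"
  using assms
proof (induction rule: laurent_tensor_induct)
  case (add s t)
  then obtain A f B g where A: "finite A" "s = (\<Sum>v\<in>A. gen (f v) v)" and B: "finite B" "t = (\<Sum>v\<in>B. gen (g v) v)"
    by blast
  have "s = (\<Sum>v\<in>A \<union> B. gen (if v \<in> A then f v else 0) v)" "t = (\<Sum>v\<in>A \<union> B. gen (if v \<in> B then g v else 0) v)"
    unfolding A(2) B(2) by (rule sum.mono_neutral_cong_left; use A B in auto)+
  then have "s + t = (\<Sum>v\<in>A \<union> B. gen ((if v \<in> A then f v else 0) + (if v \<in> B then g v else 0)) v)"
    by (simp only: gen_add_left sum.distrib)
  then show ?case
    using A(1) B(1) by (intro exI [of _ "A \<union> B"] exI) auto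
next
  case (gen f v)
  show ?case
    by (intro exI [of _ "{v}"] exI [of _ "\<lambda>_. f"]) simp
next
  case zero
  show ?case
    by (intro exI [of _ "{}"]) simp
qed

text \<open>Finitely many tensors involve finitely many vectors, which are rewritten in one
  independent subset. \<open>nondegenerate\<close> speaks only about independent vectors.\<close>

lemma laurent_tensor_basis:
  assumes R: "finite R" and s: "\<And>r. r \<in> R \<Longrightarrow> s r \<in> laurent_tensor"
  shows "\<exists>A f. finite A \<and> cvec.independent A \<and> (\<forall>r\<in>R. s r = (\<Sum>v\<in>A. gen (f r v) v))"
proof -
  have "\<forall>r\<in>R. \<exists>A f. finite A \<and> s r = (\<Sum>v\<in>A. gen (f v) v)"
    using laurent_tensor_expansion s by blast
  then obtain B g where B: "\<And>r. r \<in> R \<Longrightarrow> finite (B r)" "\<And>r. r \<in> R \<Longrightarrow> s r = (\<Sum>v\<in>B r. gen (g r v) v)"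
    by metis
  define B0 where "B0 = (\<Union>r\<in>R. B r)"
  obtain A where A: "A \<subseteq> B0" "cvec.independent A" "B0 \<subseteq> cvec.span A"
    using cvec.maximal_independent_subset .
  have fin: "finite A"
    using A(1) R B(1) by (auto simp: B0_def intro: finite_subset)
  have "s r = (\<Sum>b\<in>A. gen (\<Sum>v\<in>B r. fls_const (cvec.representation A v b) * g r v) b)" if r: "r \<in> R" for r
  proof -
    have "s r = (\<Sum>v\<in>B r. gen (g r v) (\<Sum>b\<in>A. cvec.representation A v b *\<^sub>C b))"
      unfolding B(2) [OF r]
    proof (rule sum.cong [OF refl])
      fix v
      assume "v \<in> B r"
      then have "v \<in> cvec.span A"
        using r A(3) by (auto simp: B0_def)
      then have "(\<Sum>b\<in>A. cvec.representation A v b *\<^sub>C b) = v"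
        by (rule cvec.sum_representation_eq [OF A(2) _ fin subset_refl])
      then show "gen (g r v) v = gen (g r v) (\<Sum>b\<in>A. cvec.representation A v b *\<^sub>C b)"
        by simp
    qed
    then show ?thesis
      by (simp add: gen_sum_right gen_sum_left gen_scaleC_right sum.swap [of _ A])
  qed
  then show ?thesis
    using fin A(2)
    by (intro exI [of _ A] exI [of _ "\<lambda>r b. \<Sum>v\<in>B r. fls_const (cvec.representation A v b) * g r v"]) simp
qed

context nonlocal_vertex_algebra
begin

text \<open>The core of uniqueness, with R as a basis of the right tensor factors: every coefficient
  of the left entries yields a linear relation within R. The left entries are arbitrary Laurent
  tensors and not only values b(x)v, so that for triple tensors they can themselves be
  products.\<close>

lemma sh_independent:
  assumes irr: "adjoint_irreducible Y" and dim: "countable_dim (UNIV :: 'v set)"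
    and R: "finite R" "cvec.independent R" "R \<subseteq> laurent_hom"
    and s: "\<And>r. r \<in> R \<Longrightarrow> s r \<in> laurent_tensor"
    and zero: "\<And>w n. (\<Sum>r\<in>R. sh Y (s r) (r w) n) = 0"
    and r: "r \<in> R"
  shows "s r = 0"
proof -
  obtain A f where A: "finite A" "cvec.independent A" and f: "\<And>r. r \<in> R \<Longrightarrow> s r = (\<Sum>v\<in>A. gen (f r v) v)"
    using laurent_tensor_basis [OF R(1), of s] s by auto
  have "(\<Sum>r\<in>R. (f r v $$ p) *\<^sub>C r) = 0" if v: "v \<in> A" for v p
  proof (rule ext, rule ext)
    fix w q
    have "\<exists>C g. finite C \<and> cvec.independent C \<and> (\<forall>r\<in>R. r w = (\<Sum>w'\<in>C. gen (g r w') w'))"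
      by (rule laurent_tensor_basis [OF R(1)]) (use R(3) laurent_homD in auto)
    then obtain C g where C: "finite C" "cvec.independent C" and g: "\<And>r. r \<in> R \<Longrightarrow> r w = (\<Sum>w'\<in>C. gen (g r w') w')"
      by auto
    have "(\<Sum>r\<in>R. f r v $$ p * g r c $$ q) = 0" if c: "c \<in> C" for c
    proof (rule sum_nth_mult [OF R(1)])
      fix i
      \<comment> \<open>Nondegeneracy has scalar coefficients. Fixing the power m of x1 turns each
        Laurent series in x1 into a number; a is the power of x2.\<close>
      define H where "H m v w' a = (\<Sum>r\<in>R. (alt a * (hasse a (f r v) * g r w')) $$ m)" for m v w' a
      have "H m v c i = 0" for m
      proof (rule nondegenerate [OF irr dim A C _ v c, of "H m"])
        fix n
        have "\<forall>\<^sub>F I in sequentially. \<forall>r\<in>R. \<forall>v\<in>A. \<forall>w'\<in>C. sh Y (gen (f r v) v) (gen (g r w') w') n =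
            (\<Sum>a<I. gen (alt a * (hasse a (f r v) * g r w')) (Y v (n + int a) w'))"
          by (intro eventually_ball_finite ballI sh_gen R A C)
        moreover have "\<forall>\<^sub>F I in sequentially. \<forall>v\<in>A. \<forall>w'\<in>C. Ysum (H m v w') v n w' =
            (\<Sum>a<I. H m v w' a *\<^sub>C Y v (n + int a) w')"
          by (intro eventually_ball_finite ballI Ysum_eventually0 A C)
        ultimately have "\<forall>\<^sub>F I::nat in sequentially. (\<Sum>v\<in>A. \<Sum>w'\<in>C. Ysum (H m v w') v n w') = 0"
        proof eventually_elim
          case (elim I)
          have "(\<Sum>v\<in>A. \<Sum>w'\<in>C. Ysum (H m v w') v n w') = (\<Sum>v\<in>A. \<Sum>w'\<in>C. \<Sum>a<I. \<Sum>r\<in>R.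
              gen (alt a * (hasse a (f r v) * g r w')) (Y v (n + int a) w') m)"
            by (simp add: elim(2) H_def gen_nth cvec.scale_sum_left)
          also have "\<dots> = (\<Sum>r\<in>R. \<Sum>v\<in>A. \<Sum>w'\<in>C. \<Sum>a<I.
              gen (alt a * (hasse a (f r v) * g r w')) (Y v (n + int a) w') m)"
            by (simp only: sum.swap [of _ R "{..<I}"] sum.swap [of _ R C] sum.swap [of _ R A])
          also have "\<dots> = (\<Sum>r\<in>R. \<Sum>v\<in>A. \<Sum>w'\<in>C. sh Y (gen (f r v) v) (gen (g r w') w') n) m"
            by (simp add: elim(1) sum_apply)
          also have "(\<Sum>r\<in>R. \<Sum>v\<in>A. \<Sum>w'\<in>C. sh Y (gen (f r v) v) (gen (g r w') w') n)
              = (\<Sum>r\<in>R. sh Y (s r) (r w) n)"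
            by (rule sum.cong) (simp_all add: f g sh_sum_left sh_sum_right laurent_tensor_sum sum.swap [of _ C A])
          finally show ?case
            by (simp add: zero fun_ops)
        qed
        then show "(\<Sum>v\<in>A. \<Sum>w'\<in>C. Ysum (H m v w') v n w') = 0"
          by simp
      qed
      then show "(\<Sum>r\<in>R. hasse i (f r v) * g r c) = 0"
        by (intro fls_eqI) (simp add: H_def fls_nth_sum flip: sum_distrib_left)
    qed
    then have "(\<Sum>c\<in>C. (\<Sum>r\<in>R. f r v $$ p * g r c $$ q) *\<^sub>C c) = 0"
      by simp
    also have "(\<Sum>c\<in>C. (\<Sum>r\<in>R. f r v $$ p * g r c $$ q) *\<^sub>C c)
        = (\<Sum>r\<in>R. (f r v $$ p) *\<^sub>C (\<Sum>c\<in>C. gen (g r c) c) q)"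
      by (simp add: cvec.scale_sum_left cvec.scale_sum_right sum_apply gen_nth scaleC_scaleC sum.swap [of _ R C])
    also have "\<dots> = (\<Sum>r\<in>R. (f r v $$ p) *\<^sub>C r) w q"
      by (simp add: sum_apply scaleC_fun_apply g)
    finally show "(\<Sum>r\<in>R. (f r v $$ p) *\<^sub>C r) w q = 0 w q"
      by (simp add: fun_ops)
  qed
  then have "f r v = 0" if "v \<in> A" for v
    using cvec.independentD [OF R(2,1) subset_refl _ r] that by (intro fls_eqI) fastforce
  then show ?thesis
    by (simp add: f [OF r])
qed

end

section \<open>Tensors\<close>

lemma tensor_null_generators:
  "Poly_Mapping.single (a + a', b) 1 - Poly_Mapping.single (a, b) 1 - Poly_Mapping.single (a', b) 1 \<in> tensor_null"
  "Poly_Mapping.single (a, b + b') 1 - Poly_Mapping.single (a, b) 1 - Poly_Mapping.single (a, b') 1 \<in> tensor_null"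
  "Poly_Mapping.single (c *\<^sub>C a, b) 1 - c *\<^sub>C Poly_Mapping.single (a, b) 1 \<in> tensor_null"
  "Poly_Mapping.single (a, c *\<^sub>C b) 1 - c *\<^sub>C Poly_Mapping.single (a, b) 1 \<in> tensor_null"
  unfolding tensor_null_def by (rule cvec.span_base, blast)+

lemma pure_tensor_add_left: "(a + a') \<otimes> b = a \<otimes> b + a' \<otimes> b"
  by transfer (simp only: tensor_eq_def diff_diff_eq [symmetric] tensor_null_generators)

lemma pure_tensor_add_right: "a \<otimes> (b + b') = a \<otimes> b + a \<otimes> b'"
  by transfer (simp only: tensor_eq_def diff_diff_eq [symmetric] tensor_null_generators)

lemma pure_tensor_scaleC_left: "(c *\<^sub>C a) \<otimes> b = c *\<^sub>C (a \<otimes> b)"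
  by transfer (simp only: tensor_eq_def tensor_null_generators)

lemma pure_tensor_scaleC_right: "a \<otimes> (c *\<^sub>C b) = c *\<^sub>C (a \<otimes> b)"
  by transfer (simp only: tensor_eq_def tensor_null_generators)

definition bilinear_on :: "'a::complex_vector set \<Rightarrow> 'b::complex_vector set \<Rightarrow> ('a \<Rightarrow> 'b \<Rightarrow> 'c::complex_vector) \<Rightarrow> bool" where
  "bilinear_on S T \<beta> \<longleftrightarrow> (\<forall>a\<in>S. linear_on T (\<beta> a)) \<and> (\<forall>b\<in>T. linear_on S (\<lambda>a. \<beta> a b))"

lemma bilinear_onD:
  assumes "bilinear_on S T \<beta>"
  shows "a \<in> S \<Longrightarrow> a' \<in> S \<Longrightarrow> b \<in> T \<Longrightarrow> \<beta> (a + a') b = \<beta> a b + \<beta> a' b"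
    and "a \<in> S \<Longrightarrow> b \<in> T \<Longrightarrow> b' \<in> T \<Longrightarrow> \<beta> a (b + b') = \<beta> a b + \<beta> a b'"
    and "a \<in> S \<Longrightarrow> b \<in> T \<Longrightarrow> \<beta> (c *\<^sub>C a) b = c *\<^sub>C \<beta> a b"
    and "a \<in> S \<Longrightarrow> b \<in> T \<Longrightarrow> \<beta> a (c *\<^sub>C b) = c *\<^sub>C \<beta> a b"
  using assms by (auto simp: bilinear_on_def linear_on_def)

lemma bilinear_on_pure_tensor: "bilinear_on S T (\<otimes>)"
  by (simp add: bilinear_on_def linear_on_def pure_tensor_add_left pure_tensor_add_right
    pure_tensor_scaleC_left pure_tensor_scaleC_right)

section \<open>Universal property of the tensor product\<close>

definition poly_mapping_lift :: "('k \<Rightarrow> 'c::complex_vector) \<Rightarrow> ('k \<Rightarrow>\<^sub>0 complex) \<Rightarrow> 'c" where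
  "poly_mapping_lift \<gamma> p = Sum_any (\<lambda>k. Poly_Mapping.lookup p k *\<^sub>C \<gamma> k)"

lemma lookup_scaleC: "Poly_Mapping.lookup (c *\<^sub>C p) k = c *\<^sub>C Poly_Mapping.lookup p k" for p :: "'k \<Rightarrow>\<^sub>0 'v::complex_vector"
  by (simp add: scaleC_poly_mapping_def Poly_Mapping.map.rep_eq when_def)

lemma finite_poly_mapping_lift: "finite {k. Poly_Mapping.lookup p k *\<^sub>C \<gamma> k \<noteq> 0}"
  for \<gamma> :: "'k \<Rightarrow> 'c::complex_vector"
  by (rule finite_subset [OF _ finite_lookup [of p]]) auto

lemma clinear_poly_mapping_lift: "clinear (poly_mapping_lift \<gamma>)"
proof (rule clinearI)
  fix p q
  show "poly_mapping_lift \<gamma> (p + q) = poly_mapping_lift \<gamma> p + poly_mapping_lift \<gamma> q"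
    by (simp add: poly_mapping_lift_def lookup_add scaleC_add_left Sum_any.distrib finite_poly_mapping_lift)
next
  fix c p
  have "Sum_any (\<lambda>k. Poly_Mapping.lookup (c *\<^sub>C p) k *\<^sub>C \<gamma> k) = (\<Sum>k | Poly_Mapping.lookup p k \<noteq> 0. Poly_Mapping.lookup (c *\<^sub>C p) k *\<^sub>C \<gamma> k)"
    by (rule Sum_any.expand_superset) (auto simp: lookup_scaleC scaleC_complex_def)
  moreover have "Sum_any (\<lambda>k. Poly_Mapping.lookup p k *\<^sub>C \<gamma> k) = (\<Sum>k | Poly_Mapping.lookup p k \<noteq> 0. Poly_Mapping.lookup p k *\<^sub>C \<gamma> k)"
    by (rule Sum_any.expand_superset) auto
  ultimately show "poly_mapping_lift \<gamma> (c *\<^sub>C p) = c *\<^sub>C poly_mapping_lift \<gamma> p"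
    by (simp add: poly_mapping_lift_def lookup_scaleC scaleC_complex_def cvec.scale_sum_right scaleC_scaleC)
qed

lemma poly_mapping_lift_single: "poly_mapping_lift \<gamma> (Poly_Mapping.single k 1) = \<gamma> k"
proof -
  have "Sum_any (\<lambda>k'. Poly_Mapping.lookup (Poly_Mapping.single k (1::complex)) k' *\<^sub>C \<gamma> k') = Sum_any (\<lambda>k'. if k' = k then \<gamma> k' else 0)"
    by (rule Sum_any.cong) (simp add: lookup_single when_def scaleC_one)
  then show ?thesis
    by (simp add: poly_mapping_lift_def)
qed

lemma tensor_lift:
  assumes "bilinear_on UNIV UNIV \<beta>"
  shows "\<exists>L. clinear L \<and> (\<forall>a b. L (a \<otimes> b) = \<beta> a b)"
proof -
  define P where "P = poly_mapping_lift (\<lambda>(a, b). \<beta> a b)"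
  have lin: "clinear P"
    unfolding P_def by (rule clinear_poly_mapping_lift)
  have single: "P (Poly_Mapping.single (a, b) 1) = \<beta> a b" for a b
    by (simp add: P_def poly_mapping_lift_single)
  note \<beta> = bilinear_onD(1,2) [OF assms UNIV_I UNIV_I UNIV_I] bilinear_onD(3,4) [OF assms UNIV_I UNIV_I]
  have null: "P p = 0" if "p \<in> tensor_null" for p
    using that unfolding tensor_null_def
  proof (induction rule: cvec.span_induct_alt)
    case base
    show ?case
      using lin by (rule clinear_0)
  next
    case (step c x y)
    from step(1) have "P x = 0"
      by (auto simp: clinear_diff [OF lin] clinear_scaleC [OF lin] single \<beta>)
    then show ?case
      by (simp add: clinear_add [OF lin] clinear_scaleC [OF lin] step)
  qed
  have eq: "P p = P q" if "tensor_eq p q" for p q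
    using null [of "p - q"] that by (simp add: tensor_eq_def clinear_diff [OF lin])
  \<comment> \<open>P is constant on equivalence classes, so the representative picked by
    \<open>rep_tensor\<close> does not matter.\<close>
  have rep: "P (rep_tensor (abs_tensor p)) = P p" for p
    by (rule eq) (rule Quotient3_rep_abs [OF Quotient3_tensor], simp add: tensor_eq_def tensor_null_zero)
  have abs: "\<exists>p. t = abs_tensor p" for t :: "('a, 'b) tensor"
    using Quotient3_abs_rep [OF Quotient3_tensor] by metis
  have "clinear (\<lambda>t. P (rep_tensor t))"
  proof (rule clinearI)
    fix s t :: "('a, 'b) tensor"
    obtain p q where "s = abs_tensor p" "t = abs_tensor q"
      using abs by metis
    then show "P (rep_tensor (s + t)) = P (rep_tensor s) + P (rep_tensor t)"
      by (simp add: plus_tensor.abs_eq rep clinear_add [OF lin])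
  next
    fix c and t :: "('a, 'b) tensor"
    obtain p where "t = abs_tensor p"
      using abs by metis
    then show "P (rep_tensor (c *\<^sub>C t)) = c *\<^sub>C P (rep_tensor t)"
      by (simp add: scaleC_tensor.abs_eq rep clinear_scaleC [OF lin])
  qed
  moreover have "P (rep_tensor (a \<otimes> b)) = \<beta> a b" for a b
    by (simp add: pure_tensor.abs_eq rep single)
  ultimately show ?thesis
    by blast
qed

lemma subspace_projection:
  fixes S :: "'a::complex_vector set"
  assumes "cvec.subspace S"
  obtains \<pi> where "clinear \<pi>" "\<And>x. \<pi> x \<in> S" "\<And>x. x \<in> S \<Longrightarrow> \<pi> x = x"
proof -
  interpret vector_space_pair "scaleC :: complex \<Rightarrow> 'a \<Rightarrow> 'a" "scaleC :: complex \<Rightarrow> 'a \<Rightarrow> 'a" ..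
  have "clinear (\<lambda>x::'a. x)"
    by (rule clinearI) simp_all
  then show ?thesis
    using linear_exists_left_inverse_on [OF _ assms, of "\<lambda>x. x"] that by auto
qed

text \<open>\<beta> is bilinear only on S and T. Composed with linear projections onto S and T it
  becomes bilinear everywhere, so the universal property applies; the projections fix all entries of
  both lists.\<close>

lemma tensor_sum_eq_bilinear:
  assumes S: "cvec.subspace S" and T: "cvec.subspace T" and \<beta>: "bilinear_on S T \<beta>"
    and xs: "set xs \<subseteq> S \<times> T" and ys: "set ys \<subseteq> S \<times> T"
    and eq: "(\<Sum>(a, b)\<leftarrow>xs. a \<otimes> b) = (\<Sum>(a, b)\<leftarrow>ys. a \<otimes> b)"
  shows "(\<Sum>(a, b)\<leftarrow>xs. \<beta> a b) = (\<Sum>(a, b)\<leftarrow>ys. \<beta> a b)"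
proof -
  obtain \<pi> \<rho> where \<pi>: "clinear \<pi>" "\<And>x. \<pi> x \<in> S" "\<And>x. x \<in> S \<Longrightarrow> \<pi> x = x"
    and \<rho>: "clinear \<rho>" "\<And>x. \<rho> x \<in> T" "\<And>x. x \<in> T \<Longrightarrow> \<rho> x = x"
    using subspace_projection S T by metis
  have "bilinear_on UNIV UNIV (\<lambda>a b. \<beta> (\<pi> a) (\<rho> b))"
    by (auto simp: bilinear_on_def linear_on_def clinear_add [OF \<pi>(1)] clinear_add [OF \<rho>(1)]
      clinear_scaleC [OF \<pi>(1)] clinear_scaleC [OF \<rho>(1)] bilinear_onD [OF \<beta>] \<pi>(2) \<rho>(2))
  then obtain L where L: "clinear L" "\<And>a b. L (a \<otimes> b) = \<beta> (\<pi> a) (\<rho> b)"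
    using tensor_lift by blast
  have "L (\<Sum>(a, b)\<leftarrow>zs. a \<otimes> b) = (\<Sum>(a, b)\<leftarrow>zs. \<beta> a b)" if "set zs \<subseteq> S \<times> T" for zs
    using that by (induction zs) (auto simp: clinear_0 [OF L(1)] clinear_add [OF L(1)] L(2) \<pi>(3) \<rho>(3))
  from this [OF xs] this [OF ys] eq show ?thesis
    by metis
qed

lemma tensor_expansion_in: "tensor_expansion B t xs \<Longrightarrow> t \<in> tensor_of B B"
proof -
  assume "tensor_expansion B t xs"
  then have xs: "set xs \<subseteq> B \<times> B" and t: "t = (\<Sum>(b, c)\<leftarrow>xs. b \<otimes> c)"
    by (auto simp: tensor_expansion_def)
  show ?thesis
    unfolding t tensor_of_def using xs
  proof (induction xs)
    case (Cons x xs)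
    then obtain a b where "x = (a, b)" "a \<in> B" "b \<in> B"
      by auto
    moreover from this have "a \<otimes> b \<in> cvec.span {a \<otimes> b | a b. a \<in> B \<and> b \<in> B}"
      by (intro cvec.span_base) blast
    ultimately show ?case
      using Cons by (simp add: cvec.span_add)
  qed (simp add: cvec.span_zero)
qed

section \<open>Uniqueness of coproducts\<close>

lemma eventually_sequentiallyD: "eventually P sequentially \<Longrightarrow> \<exists>i. P i"
  using eventually_happens' [OF sequentially_bot] .

lemma linear_on_sum:
  assumes "linear_on T f" "cvec.subspace T" "\<And>i. i \<in> A \<Longrightarrow> x i \<in> T"
  shows "f (\<Sum>i\<in>A. x i) = (\<Sum>i\<in>A. f (x i))"
proof -
  have f0: "f 0 = 0"
  proof -
    have "f (0 *\<^sub>C 0) = 0 *\<^sub>C f 0"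
      using assms(1) cvec.subspace_0 [OF assms(2)] unfolding linear_on_def by blast
    then show ?thesis
      by simp
  qed
  show ?thesis
    using assms(3)
  proof (induction A rule: infinite_finite_induct)
    case (insert i A)
    then have "f (x i + (\<Sum>i\<in>A. x i)) = f (x i) + f (\<Sum>i\<in>A. x i)"
      using assms(1) cvec.subspace_sum [OF assms(2), of A x] unfolding linear_on_def by auto
    with insert show ?case
      by simp
  qed (simp_all add: f0)
qed

text \<open>Gathers the left entries that belong to each basis vector of the right ones, the shape
  required by \<open>sh_independent\<close>. A general \<beta> covers \<otimes> and
  \<open>sh\<close> alike.\<close>

lemma bilinear_expand:
  assumes \<beta>: "bilinear_on S T \<beta>" and S: "cvec.subspace S" and T: "cvec.subspace T"
    and xs: "set xs \<subseteq> S \<times> T" and R: "finite R" "cvec.independent R" "R \<subseteq> T" "snd ` set xs \<subseteq> cvec.span R"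
  shows "(\<Sum>(b, c)\<leftarrow>xs. \<beta> b c) = (\<Sum>r\<in>R. \<beta> (\<Sum>(b, c)\<leftarrow>xs. cvec.representation R c r *\<^sub>C b) r)"
  using xs R(4)
proof (induction xs)
  case Nil
  have "\<beta> 0 r = 0" if "r \<in> R" for r
    using bilinear_onD(3) [OF \<beta>, of 0 r 0] cvec.subspace_0 [OF S] that R(3) by auto
  then show ?case
    by simp
next
  case (Cons x xs)
  obtain b c where x: "x = (b, c)"
    by force
  with Cons.prems have bc: "b \<in> S" "c \<in> T" "c \<in> cvec.span R"
    by auto
  have sub: "(\<Sum>(b, c)\<leftarrow>xs. cvec.representation R c r *\<^sub>C b) \<in> S" for r
    using Cons.prems(1)
    by (induction xs) (auto intro: cvec.subspace_add [OF S] cvec.subspace_scale [OF S] cvec.subspace_0 [OF S])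
  have "\<beta> b c = \<beta> b (\<Sum>r\<in>R. cvec.representation R c r *\<^sub>C r)"
    by (simp add: cvec.sum_representation_eq [OF R(2) bc(3) R(1) subset_refl])
  also have "\<dots> = (\<Sum>r\<in>R. \<beta> b (cvec.representation R c r *\<^sub>C r))"
    using \<beta> bc(1) R(3) by (intro linear_on_sum [OF _ T] cvec.subspace_scale [OF T]) (auto simp: bilinear_on_def)
  also have "\<dots> = (\<Sum>r\<in>R. \<beta> (cvec.representation R c r *\<^sub>C b) r)"
    using bilinear_onD(3,4) [OF \<beta> bc(1)] R(3) by (intro sum.cong) auto
  finally have "\<beta> b c = (\<Sum>r\<in>R. \<beta> (cvec.representation R c r *\<^sub>C b) r)" .
  moreover have "\<beta> (cvec.representation R c r *\<^sub>C b + (\<Sum>(b, c)\<leftarrow>xs. cvec.representation R c r *\<^sub>C b)) r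
      = \<beta> (cvec.representation R c r *\<^sub>C b) r + \<beta> (\<Sum>(b, c)\<leftarrow>xs. cvec.representation R c r *\<^sub>C b) r" if "r \<in> R" for r
    using that R(3) by (intro bilinear_onD(1) [OF \<beta>] cvec.subspace_scale [OF S] bc(1) sub) auto
  ultimately show ?case
    using Cons by (simp add: x sum.distrib)
qed

lemma finite_independent_generators:
  assumes "finite X"
  obtains R where "R \<subseteq> X" "finite R" "cvec.independent R" "X \<subseteq> cvec.span R"
proof -
  obtain R where "R \<subseteq> X" "cvec.independent R" "X \<subseteq> cvec.span R"
    using cvec.maximal_independent_subset .
  moreover from this(1) assms have "finite R"
    by (rule finite_subset)
  ultimately show ?thesis
    using that by metis
qed

context vertex_structure
begin

lemma bilinear_on_sh: "bilinear_on laurent_hom laurent_hom (\<lambda>b c. sh Y (b v) (c w) n)"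
  by (simp add: bilinear_on_def linear_on_def fun_ops scaleC_fun_apply laurent_homD
    sh_add_left sh_add_right sh_scaleC_left sh_scaleC_right)

lemma bilinear_on_sh_left: "bilinear_on laurent_tensor laurent_hom (\<lambda>s c. sh Y s (c w) n)"
  by (simp add: bilinear_on_def linear_on_def fun_ops scaleC_fun_apply laurent_homD
    sh_add_left sh_add_right sh_scaleC_left sh_scaleC_right)

end

context nonlocal_vertex_algebra
begin

context
  assumes irr: "adjoint_irreducible Y" and dim: "countable_dim (UNIV :: 'v set)"
begin

text \<open>The same regrouping is used twice: for \<open>sh\<close> it shows that every collected
  left entry vanishes, for \<otimes> it then gives the conclusion.\<close>

lemma tensor_zero:
  assumes xs: "set xs \<subseteq> laurent_hom \<times> laurent_hom"
    and zero: "\<And>v w n. (\<Sum>(b, c)\<leftarrow>xs. sh Y (b v) (c w) n) = 0"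
  shows "(\<Sum>(b, c)\<leftarrow>xs. b \<otimes> c) = 0"
proof -
  obtain R where R: "R \<subseteq> snd ` set xs" "finite R" "cvec.independent R" "snd ` set xs \<subseteq> cvec.span R"
    using finite_independent_generators [of "snd ` set xs"] by auto
  have RT: "R \<subseteq> laurent_hom"
    using R(1) xs by force
  define h where "h r = (\<Sum>(b, c)\<leftarrow>xs. cvec.representation R c r *\<^sub>C b)" for r
  have h: "h r \<in> laurent_hom" for r
    unfolding h_def using xs
    by (induction xs) (auto intro: cvec.subspace_add [OF subspace_laurent_hom]
      cvec.subspace_scale [OF subspace_laurent_hom] cvec.subspace_0 [OF subspace_laurent_hom])
  note expand = bilinear_expand [OF _ subspace_laurent_hom subspace_laurent_hom xs R(2,3) RT R(4), folded h_def]
  have "h r v = 0" if "r \<in> R" for r v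
  proof (rule sh_independent [OF irr dim R(2,3) RT _ _ that, of "\<lambda>r. h r v"])
    show "(\<Sum>r\<in>R. sh Y (h r v) (r w) n) = 0" for w n
      using zero [of v w n] unfolding expand [OF bilinear_on_sh] .
  qed (rule laurent_homD [OF h])
  then have "h r = 0" if "r \<in> R" for r
    using that by (simp add: fun_eq_iff fun_ops)
  moreover have "(0 :: 'v \<Rightarrow> int \<Rightarrow> 'v) \<otimes> r = 0" for r :: "'v \<Rightarrow> int \<Rightarrow> 'v"
    using pure_tensor_scaleC_left [of 0 0 r] by simp
  ultimately show ?thesis
    unfolding expand [OF bilinear_on_pure_tensor] by simp
qed

text \<open>The third factor is peeled off first. \<open>sh_independent\<close>, with products as
  left entries, leaves for each basis vector r a relation between the first two factors, which is
  settled by \<open>tensor_zero\<close>.\<close>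

lemma tensor_zero3:
  assumes zs: "set zs \<subseteq> laurent_hom \<times> laurent_hom \<times> laurent_hom"
    and zero: "\<And>u v w m n. (\<Sum>(p, q, c)\<leftarrow>zs. sh Y (sh Y (p u) (q v) m) (c w) n) = 0"
  shows "(\<Sum>(p, q, c)\<leftarrow>zs. p \<otimes> (q \<otimes> c)) = 0"
proof -
  obtain R where R: "R \<subseteq> (snd \<circ> snd) ` set zs" "finite R" "cvec.independent R" "(snd \<circ> snd) ` set zs \<subseteq> cvec.span R"
    using finite_independent_generators [of "(snd \<circ> snd) ` set zs"] by auto
  have RT: "R \<subseteq> laurent_hom"
    using R(1) zs by force
  let ?rep = "cvec.representation R"
  have rep: "(\<Sum>r\<in>R. ?rep c r *\<^sub>C r) = c" if "(p, q, c) \<in> set zs" for p q c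
    using that R(4) by (intro cvec.sum_representation_eq [OF R(3) _ R(2) subset_refl]) force
  have LH: "p \<in> laurent_hom" "q \<in> laurent_hom" "c \<in> laurent_hom" if "(p, q, c) \<in> set zs" for p q c
    using that zs by auto
  have "(\<Sum>(p, q, c)\<leftarrow>zs. (?rep c r *\<^sub>C p) \<otimes> q) = 0" if r: "r \<in> R" for r
  proof -
    define ys where "ys = map (\<lambda>(p, q, c). (?rep c r *\<^sub>C p, q)) zs"
    have "(\<Sum>(p, q)\<leftarrow>ys. p \<otimes> q) = 0"
    proof (rule tensor_zero)
      show "set ys \<subseteq> laurent_hom \<times> laurent_hom"
        by (auto simp: ys_def LH cvec.subspace_scale [OF subspace_laurent_hom])
    next
      fix u v m
      define g where "g r = (\<Sum>(p, q, c)\<leftarrow>zs. ?rep c r *\<^sub>C sh Y (p u) (q v) m)" for r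
      define us where "us = map (\<lambda>(p, q, c). (sh Y (p u) (q v) m, c)) zs"
      have us: "set us \<subseteq> laurent_tensor \<times> laurent_hom" "snd ` set us \<subseteq> cvec.span R"
        using R(4) by (auto simp: us_def LH laurent_homD)
      have g: "g r = (\<Sum>(b, c)\<leftarrow>us. ?rep c r *\<^sub>C b)" for r
        by (simp add: g_def us_def split_def o_def)
      have "g r = 0"
      proof (rule sh_independent [OF irr dim R(2,3) RT _ _ r, of g])
        show "g r \<in> laurent_tensor" for r
          unfolding g_def by (rule laurent_tensor_sum_list) (auto simp: LH laurent_homD)
        show "(\<Sum>r\<in>R. sh Y (g r) (r w) n) = 0" for w n
          using bilinear_expand [OF bilinear_on_sh_left subspace_laurent_tensor subspace_laurent_hom us(1) R(2,3) RT us(2), of w n]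
            zero [of u v m w n]
          by (simp add: g [symmetric], simp add: us_def split_def o_def)
      qed
      moreover have "(\<Sum>(p, q)\<leftarrow>ys. sh Y (p u) (q v) m) = g r"
        unfolding g_def ys_def
        by (simp add: o_def split_def, rule arg_cong [of _ _ sum_list], rule map_cong [OF refl])
           (auto simp: scaleC_fun_apply LH laurent_homD sh_scaleC_left)
      ultimately show "(\<Sum>(p, q)\<leftarrow>ys. sh Y (p u) (q v) m) = 0"
        by simp
    qed
    then show ?thesis
      by (simp add: ys_def o_def split_def)
  qed
  note zero_r = this
  have "(\<Sum>(p, q, c)\<leftarrow>zs. (?rep c r *\<^sub>C p) \<otimes> (q \<otimes> r)) = 0" if r: "r \<in> R" for r
  proof -
    \<comment> \<open>Puts r back in the bracketing in which triple tensors are compared.\<close>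
    have "bilinear_on UNIV UNIV (\<lambda>(a :: 'v \<Rightarrow> int \<Rightarrow> 'v) (b :: 'v \<Rightarrow> int \<Rightarrow> 'v). a \<otimes> (b \<otimes> r))"
      by (simp add: bilinear_on_def linear_on_def pure_tensor_add_left pure_tensor_add_right
        pure_tensor_scaleC_left pure_tensor_scaleC_right)
    from tensor_lift [OF this] obtain L where L: "clinear L"
        "\<And>(a :: 'v \<Rightarrow> int \<Rightarrow> 'v) (b :: 'v \<Rightarrow> int \<Rightarrow> 'v). L (a \<otimes> b) = a \<otimes> (b \<otimes> r)"
      by blast
    have "L (\<Sum>(p, q, c)\<leftarrow>zs. (?rep c r *\<^sub>C p) \<otimes> q) = (\<Sum>(p, q, c)\<leftarrow>zs. (?rep c r *\<^sub>C p) \<otimes> (q \<otimes> r))"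
      by (simp add: clinear_sum_list [OF L(1)] split_def L(2))
    then show ?thesis
      by (simp add: zero_r [OF r] clinear_0 [OF L(1)])
  qed
  then have "(\<Sum>r\<in>R. \<Sum>(p, q, c)\<leftarrow>zs. (?rep c r *\<^sub>C p) \<otimes> (q \<otimes> r)) = 0"
    by simp
  moreover have "(\<Sum>r\<in>R. \<Sum>(p, q, c)\<leftarrow>zs. (?rep c r *\<^sub>C p) \<otimes> (q \<otimes> r)) = (\<Sum>(p, q, c)\<leftarrow>zs. p \<otimes> (q \<otimes> c))"
    using rep
  proof (induction zs)
    case (Cons z zs)
    obtain p q c where z: "z = (p, q, c)"
      using prod_cases3 by blast
    have c: "(\<Sum>r\<in>R. ?rep c r *\<^sub>C r) = c"
      by (rule Cons.prems [of p q]) (simp add: z)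
    have sum_right: "a \<otimes> (\<Sum>r\<in>R. x r) = (\<Sum>r\<in>R. a \<otimes> x r)"
      for a :: "'x::complex_vector" and x :: "('v \<Rightarrow> int \<Rightarrow> 'v) \<Rightarrow> 'y::complex_vector"
      by (rule linear_on_sum [of UNIV "\<lambda>b. a \<otimes> b"])
         (simp_all add: linear_on_def pure_tensor_add_right pure_tensor_scaleC_right)
    have "p \<otimes> (q \<otimes> c) = p \<otimes> (q \<otimes> (\<Sum>r\<in>R. ?rep c r *\<^sub>C r))"
      by (simp add: c)
    also have "\<dots> = (\<Sum>r\<in>R. (?rep c r *\<^sub>C p) \<otimes> (q \<otimes> r))"
      by (simp add: sum_right pure_tensor_scaleC_right pure_tensor_scaleC_left)
    finally have "p \<otimes> (q \<otimes> c) = (\<Sum>r\<in>R. (?rep c r *\<^sub>C p) \<otimes> (q \<otimes> r))" .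
    moreover have "(\<Sum>r\<in>R. \<Sum>(p, q, c)\<leftarrow>zs. (?rep c r *\<^sub>C p) \<otimes> (q \<otimes> r)) = (\<Sum>(p, q, c)\<leftarrow>zs. p \<otimes> (q \<otimes> c))"
      by (rule Cons.IH) (rule Cons.prems, rule list.set_intros(2))
    ultimately show ?case
      by (simp add: z sum.distrib)
  qed simp
  ultimately show ?thesis
    by simp
qed

end

end

section \<open>Weak associativity with Laurent coefficients\<close>

context vertex_structure
begin

text \<open>Coefficients of \<open>x\<^sub>2\<^sup>p x\<^sub>3\<^sup>q\<close> in \<open>Y(s(x\<^sub>1 - x\<^sub>2), x\<^sub>2) Y(t(x\<^sub>1 - x\<^sub>3), x\<^sub>3) r(x\<^sub>1)\<close>, and of \<open>x\<^sub>0\<^sup>p x\<^sub>3\<^sup>q\<close> in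
  \<open>Y(Y(s(x\<^sub>1 - x\<^sub>3 - x\<^sub>0), x\<^sub>0) t(x\<^sub>1 - x\<^sub>3), x\<^sub>3) r(x\<^sub>1)\<close>.\<close>

definition prodF :: "(int \<Rightarrow> 'v) \<Rightarrow> (int \<Rightarrow> 'v) \<Rightarrow> (int \<Rightarrow> 'v) \<Rightarrow> int \<Rightarrow> int \<Rightarrow> int \<Rightarrow> 'v" where
  "prodF s t r p q = sh Y s (sh Y t r (- q - 1)) (- p - 1)"

definition iterF :: "(int \<Rightarrow> 'v) \<Rightarrow> (int \<Rightarrow> 'v) \<Rightarrow> (int \<Rightarrow> 'v) \<Rightarrow> int \<Rightarrow> int \<Rightarrow> int \<Rightarrow> 'v" where
  "iterF s t r p q = sh Y (sh Y s t (- p - 1)) r (- q - 1)"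

lemma qbounded_prodF:
  assumes "s \<in> laurent_tensor" "t \<in> laurent_tensor" "r \<in> laurent_tensor"
  shows "qbounded (prodF s t r)"
proof -
  obtain N where "\<forall>n\<ge>N. sh Y t r n = 0"
    using sh_vanishes assms(2,3) by blast
  then show ?thesis
    unfolding qbounded_def prodF_def by (intro exI [of _ "- N"]) (simp add: assms)
qed

lemma iterF_bounded:
  assumes "s \<in> laurent_tensor" "t \<in> laurent_tensor" "r \<in> laurent_tensor"
  shows "\<exists>p0. \<forall>p<p0. \<forall>q. iterF s t r p q = 0"
proof -
  obtain N where "\<forall>n\<ge>N. sh Y s t n = 0"
    using sh_vanishes assms(1,2) by blast
  then show ?thesis
    unfolding iterF_def by (intro exI [of _ "- N"]) (simp add: assms)
qed

section \<open>Taylor expansions of products and iterates\<close>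

lemma sh_product_gen:
  "\<forall>\<^sub>F I in sequentially. sh Y (gen f u) (sh Y (gen g v) (gen e w) n) m =
    (\<Sum>i<I. \<Sum>j<I. gen (alt (i + j) * (hasse i f * hasse j g * e)) (Y u (m + int i) (Y v (n + int j) w)))"
proof -
  let ?X = "\<lambda>i j. gen (alt (i + j) * (hasse i f * hasse j g * e)) (Y u (m + int i) (Y v (n + int j) w))"
  have "\<forall>\<^sub>F J in sequentially. sh Y (gen g v) (gen e w) n =
      (\<Sum>j<J. gen (alt j * (hasse j g * e)) (Y v (n + int j) w)) \<and>
      (\<forall>j\<ge>J. Y v (n + int j) w = 0)"
    using sh_gen Y_vanishes by (rule eventually_conj)
  then obtain J where J: "sh Y (gen g v) (gen e w) n =
      (\<Sum>j<J. gen (alt j * (hasse j g * e)) (Y v (n + int j) w))"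
      and vanish: "\<And>j. j \<ge> J \<Longrightarrow> Y v (n + int j) w = 0"
    by (auto dest!: eventually_sequentiallyD)
  have "\<forall>\<^sub>F I in sequentially. \<forall>j\<in>{..<J}.
      sh Y (gen f u) (gen (alt j * (hasse j g * e)) (Y v (n + int j) w)) m =
      (\<Sum>i<I. gen (alt i * (hasse i f * (alt j * (hasse j g * e))))
        (Y u (m + int i) (Y v (n + int j) w)))"
    by (intro eventually_ball_finite ballI sh_gen) simp
  then show ?thesis
    using eventually_ge_at_top [of J]
  proof eventually_elim
    case (elim I)
    have "sh Y (gen f u) (sh Y (gen g v) (gen e w) n) m =
      (\<Sum>j<J. \<Sum>i<I. ?X i j)"
      using elim(1) by (simp add: J sh_sum_right power_add fls_const_mult_const [symmetric] mult_ac
        del: fls_const_mult_const)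
    also have "\<dots> = (\<Sum>j<I. \<Sum>i<I. ?X i j)"
      by (rule sum.mono_neutral_left) (use elim(2) vanish in auto)
    finally show ?case
      by (subst sum.swap)
  qed
qed

text \<open>With x2 = x0 + x3 the Taylor factor (-x2)^i of f becomes (-1)^i (x0 + x3)^i, hence
  \<open>binomial_mult i\<close>; the factor x3^j from g shifts q.\<close>

lemma Tsub_prodF_gen:
  "\<forall>\<^sub>F I in sequentially. Tsub (prodF (gen f u) (gen g v) (gen e w)) p q =
    (\<Sum>i<I. \<Sum>j<I. gen (alt (i + j) * (hasse i f * hasse j g * e))
      (binomial_mult i (shifted_product_coeff Y u v w) p (q - int j)))"
proof -
  let ?P = "prodF (gen f u) (gen g v) (gen e w)"
  let ?c = "\<lambda>i j. alt (i + j) * (hasse i f * hasse j g * e)"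
  define F0 where "F0 p q = Y u (- p - 1) (Y v (- q - 1) w)" for p q
  have F0: "qbounded F0"
    using qbounded_product [of u v w] by (simp add: F0_def [abs_def])
  have T0: "shifted_product_coeff Y u v w = Tsub F0"
    by (simp add: shifted_product_Tsub F0_def [abs_def])
  have F: "qbounded ?P"
    by (simp add: qbounded_prodF)
  have "\<forall>\<^sub>F R in sequentially. (\<forall>p q'. q' \<le> q \<longrightarrow> Tsub ?P p q' =
      (\<Sum>r<R. ichoose (p + int r) r *\<^sub>C ?P (p + int r) (q' - int r))) \<and>
      (\<forall>r\<ge>R. \<forall>p. \<forall>q'\<le>q. F0 p (q' - int r) = 0)"
    using Tsub_eventually [OF F, of q] qbounded_eventually [OF F0, of q]
    by eventually_elim simp
  then obtain R where R: "Tsub ?P p q =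
      (\<Sum>r<R. ichoose (p + int r) r *\<^sub>C ?P (p + int r) (q - int r))"
    and vanish: "\<And>r p q'. r \<ge> R \<Longrightarrow> q' \<le> q \<Longrightarrow> F0 p (q' - int r) = 0"
    by (auto dest!: eventually_sequentiallyD)
  have "\<forall>\<^sub>F I in sequentially. \<forall>r\<in>{..<R}. ?P (p + int r) (q - int r) =
      (\<Sum>i<I. \<Sum>j<I. gen (?c i j) (Y u (- (p + int r) - 1 + int i) (Y v (- (q - int r) - 1 + int j) w)))"
    unfolding prodF_def by (intro eventually_ball_finite ballI sh_product_gen) simp
  then show ?thesis
  proof eventually_elim
    case (elim I)
    have Tsub_F0: "Tsub (\<lambda>p q. F0 (p - int i) (q - int j)) p q =
      (\<Sum>r<R. ichoose (p + int r) r *\<^sub>C F0 (p + int r - int i) (q - int r - int j))" for i j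
    proof -
      have "F0 p' (q - int r - int j) = 0" if "r \<ge> R" for p' r
        using vanish [OF that, of "q - int j" p'] by (simp add: algebra_simps)
      then show ?thesis
        unfolding Tsub_def by (intro Sum_any.expand_superset) (auto simp: not_less [symmetric])
    qed
    have "Tsub ?P p q =
      (\<Sum>r<R. \<Sum>i<I. \<Sum>j<I. gen (?c i j) (ichoose (p + int r) r *\<^sub>C F0 (p + int r - int i) (q - int r - int j)))"
      unfolding R
      by (rule sum.cong [OF refl])
         (simp add: elim F0_def cvec.scale_sum_right scaleC_gen gen_scaleC_right algebra_simps)
    also have "\<dots> = (\<Sum>i<I. \<Sum>j<I. gen (?c i j) (Tsub (\<lambda>p q. F0 (p - int i) (q - int j)) p q))"
      unfolding Tsub_F0 gen_sum_right
      by (simp only: sum.swap [of _ _ "{..<R}"])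
    finally show ?case
      by (simp only: Tsub_shift [OF F0] T0)
  qed
qed

text \<open>The coefficients agree with those of \<open>Tsub_prodF_gen\<close>, so weak
  associativity of vectors carries over with the same exponent. Here (x0 + x3)^i has to be
  reassembled from two successive Taylor expansions, in x0 and then in x3.\<close>

lemma iterF_gen:
  "\<forall>\<^sub>F I in sequentially. iterF (gen f u) (gen g v) (gen e w) p q =
    (\<Sum>i<I. \<Sum>j<I. gen (alt (i + j) * (hasse i f * hasse j g * e))
      (binomial_mult i (iterate_coeff Y u v w) p (q - int j)))"
proof -
  define m n where "m = - p - 1" and "n = - q - 1"
  define G where "G a b = Y (Y u (m + int a) v) (n + int b) w" for a b :: nat
  have "\<forall>\<^sub>F A in sequentially. sh Y (gen f u) (gen g v) m =
      (\<Sum>a<A. gen (alt a * (hasse a f * g)) (Y u (m + int a) v)) \<and>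
      (\<forall>a\<ge>A. Y u (m + int a) v = 0)"
    using sh_gen Y_vanishes by (rule eventually_conj)
  then obtain A where A: "sh Y (gen f u) (gen g v) m =
      (\<Sum>a<A. gen (alt a * (hasse a f * g)) (Y u (m + int a) v))"
      and "\<And>a. a \<ge> A \<Longrightarrow> Y u (m + int a) v = 0"
    by (auto dest!: eventually_sequentiallyD)
  then have GA: "G a b = 0" if "a \<ge> A" for a b
    using that by (simp add: G_def)
  have "\<forall>\<^sub>F B in sequentially. \<forall>a\<in>{..<A}. \<forall>b\<ge>B. G a b = 0"
    unfolding G_def by (intro eventually_ball_finite ballI Y_vanishes) simp
  then obtain B where B: "\<forall>a\<in>{..<A}. \<forall>b\<ge>B. G a b = 0"
    by (auto dest!: eventually_sequentiallyD)
  have GB: "G a b = 0" if "b \<ge> B" for a b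
    using B GA [of a b] that by (cases "a < A") auto
  have "\<forall>\<^sub>F I in sequentially. \<forall>a\<in>{..<A}.
      sh Y (gen (alt a * (hasse a f * g)) (Y u (m + int a) v)) (gen e w) n =
      (\<Sum>b<I. gen (alt b * (hasse b (alt a * (hasse a f * g)) * e)) (Y (Y u (m + int a) v) (n + int b) w))"
    by (intro eventually_ball_finite ballI sh_gen) simp
  then show ?thesis
    using eventually_ge_at_top [of "A + B"]
  proof eventually_elim
    case (elim I)
    \<comment> \<open>a counts powers of x0; of the powers of x3, s come from f and j from g. With i
      = a + s the binomial coefficient from \<open>hasse_hasse\<close> is the one in (x0 +
      x3)^i.\<close>
    define X where "X a s j = of_nat ((a + s) choose s) *\<^sub>C
      gen (alt (a + s + j) * (hasse (a + s) f * hasse j g * e)) (G a (s + j))" for a s j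
    have X0: "X a s j = 0" if "a \<ge> A \<or> s + j \<ge> B" for a s j
      using that GA GB by (auto simp: X_def)
    have summand: "gen (alt b * (hasse b (alt a * (hasse a f * g)) * e)) (G a b)
        = (\<Sum>s\<le>b. X a s (b - s))" for a b
    proof -
      have "alt b * (hasse b (alt a * (hasse a f * g)) * e)
        = (\<Sum>s\<le>b. fls_const (of_nat ((a + s) choose s)) * (alt (a + b) * (hasse (a + s) f * hasse (b - s) g * e)))"
        unfolding hasse_const_mult hasse_mult [of b "hasse a f"] hasse_hasse sum_distrib_left sum_distrib_right
        by (intro sum.cong refl)
           (simp add: power_add fls_of_nat binomial_symmetric [of a] mult_ac fls_const_mult_const [symmetric] del: fls_const_mult_const)
      then show ?thesis
        by (simp add: gen_sum_left X_def scaleC_gen)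
    qed
    have "iterF (gen f u) (gen g v) (gen e w) p q =
      (\<Sum>a<A. \<Sum>b<I. gen (alt b * (hasse b (alt a * (hasse a f * g)) * e)) (G a b))"
      using elim(1) by (simp add: iterF_def m_def [symmetric] n_def [symmetric] A sh_sum_left G_def)
    also have "\<dots> = (\<Sum>a<A. \<Sum>s<I. \<Sum>j<I. X a s j)"
      unfolding summand by (intro sum.cong refl sum_triangle [symmetric] X0) (use elim(2) in simp)
    also have "\<dots> = (\<Sum>a<I. \<Sum>s<I. \<Sum>j<I. X a s j)"
      by (rule sum.mono_neutral_left) (use elim(2) X0 in auto)
    also have "\<dots> = (\<Sum>s<I. \<Sum>a<I. \<Sum>j<I. X a s j)"
      by (rule sum.swap)
    also have "\<dots> = (\<Sum>s<I. \<Sum>j<I. \<Sum>a<I. X a s j)"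
      by (rule sum.cong [OF refl], rule sum.swap)
    also have "\<dots> = (\<Sum>j<I. \<Sum>s<I. \<Sum>a<I. X a s j)"
      by (rule sum.swap)
    also have "\<dots> = (\<Sum>j<I. \<Sum>i<I. \<Sum>s\<le>i. X (i - s) s j)"
      by (intro sum.cong refl sum_triangle X0) (use elim(2) in auto)
    also have "\<dots> = (\<Sum>j<I. \<Sum>i<I. gen (alt (i + j) * (hasse i f * hasse j g * e))
      (binomial_mult i (iterate_coeff Y u v w) p (q - int j)))"
    proof (intro sum.cong refl)
      fix i j
      have "binomial_mult i (iterate_coeff Y u v w) p (q - int j) = (\<Sum>s\<le>i. of_nat (i choose s) *\<^sub>C G (i - s) (s + j))"
        unfolding binomial_mult_def iterate_coeff_def G_def m_def n_def
        by (intro sum.cong refl) (simp add: algebra_simps)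
      then show "(\<Sum>s\<le>i. X (i - s) s j) = gen (alt (i + j) * (hasse i f * hasse j g * e))
        (binomial_mult i (iterate_coeff Y u v w) p (q - int j))"
        by (simp add: X_def gen_sum_right scaleC_gen gen_scaleC_right)
    qed
    finally show ?case
      by (subst sum.swap)
  qed
qed

text \<open>Powers of x0 + x3 commute, so the outer exponent l can be moved onto G, where weak
  associativity applies.\<close>

lemma binomial_mult_gen_expansion:
  assumes "\<And>p q. \<forall>\<^sub>F I in sequentially. X p q = (\<Sum>i<I. \<Sum>j<I. gen (c i j) (binomial_mult i G p (q - int j)))"
  shows "\<forall>\<^sub>F I in sequentially. binomial_mult l X p q =
    (\<Sum>i<I. \<Sum>j<I. gen (c i j) (binomial_mult i (binomial_mult l G) p (q - int j)))"
proof -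
  have "\<forall>\<^sub>F I in sequentially. \<forall>k\<in>{..l}. X (p - int (l - k)) (q - int k) =
      (\<Sum>i<I. \<Sum>j<I. gen (c i j) (binomial_mult i G (p - int (l - k)) (q - int k - int j)))"
    by (intro eventually_ball_finite ballI assms) simp
  then show ?thesis
  proof eventually_elim
    case (elim I)
    then have "binomial_mult l X p q =
      binomial_mult l (\<lambda>p q. \<Sum>i<I. \<Sum>j<I. gen (c i j) (binomial_mult i G p (q - int j))) p q"
      by (simp add: binomial_mult_def)
    also have "\<dots> = (\<Sum>i<I. \<Sum>j<I. gen (c i j) (binomial_mult l (\<lambda>p q. binomial_mult i G p (q - int j)) p q))"
      by (simp add: binomial_mult_sum binomial_mult_linear [OF clinear_gen])
    also have "\<dots> = (\<Sum>i<I. \<Sum>j<I. gen (c i j) (binomial_mult i (binomial_mult l G) p (q - int j)))"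
    proof -
      have "binomial_mult l (\<lambda>p q. binomial_mult i G p (q - int j)) p q
          = binomial_mult i (binomial_mult l G) p (q - int j)" for i j
        using binomial_mult_translate [of l "binomial_mult i G" 0 "- int j" p q]
        by (simp add: binomial_mult_commute [of i])
      then show ?thesis
        by simp
    qed
    finally show ?case .
  qed
qed

lemma associativity_add:
  assumes "qbounded F" "qbounded F'" "binomial_mult l (Tsub F) = binomial_mult l G" "binomial_mult l' (Tsub F') = binomial_mult l' G'"
  shows "\<exists>k. binomial_mult k (Tsub (\<lambda>p q. F p q + F' p q)) = binomial_mult k (\<lambda>p q. G p q + G' p q)"
proof -
  have eq: "Tsub (\<lambda>p q. F p q + F' p q) = (\<lambda>p q. Tsub F p q + Tsub F' p q)"
    by (simp add: fun_eq_iff Tsub_add assms)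
  have "binomial_mult (max l l') (Tsub F) = binomial_mult (max l l') G"
    by (rule binomial_mult_mono [OF assms(3)]) simp
  moreover have "binomial_mult (max l l') (Tsub F') = binomial_mult (max l l') G'"
    by (rule binomial_mult_mono [OF assms(4)]) simp
  ultimately show ?thesis
    unfolding eq by (intro exI [of _ "max l l'"] ext) (simp add: binomial_mult_add)
qed

end

context nonlocal_vertex_algebra
begin

lemma weak_associativity_gen:
  "\<exists>l. binomial_mult l (Tsub (prodF (gen f u) (gen g v) (gen e w))) = binomial_mult l (iterF (gen f u) (gen g v) (gen e w))"
    (is "\<exists>l. binomial_mult l ?P = binomial_mult l ?I")
proof -
  obtain l where l: "binomial_mult l (shifted_product_coeff Y u v w) = binomial_mult l (iterate_coeff Y u v w)"
    using weak_associativity by blast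
  have "binomial_mult l ?P p q = binomial_mult l ?I p q" for p q
  proof -
    have "\<forall>\<^sub>F I::nat in sequentially. ?thesis"
      using binomial_mult_gen_expansion [OF Tsub_prodF_gen, of l f u g v e w p q]
        binomial_mult_gen_expansion [OF iterF_gen, of l f u g v e w p q]
      by eventually_elim (simp add: l)
    then show ?thesis
      by simp
  qed
  then show ?thesis
    by blast
qed

text \<open>Finitely many generators occur, and the maximum of their exponents works for the
  sum.\<close>

lemma weak_associativity_laurent:
  assumes "s \<in> laurent_tensor" "t \<in> laurent_tensor" "r \<in> laurent_tensor"
  shows "\<exists>l. binomial_mult l (Tsub (prodF s t r)) = binomial_mult l (iterF s t r)"
  using assms
proof (induction s t arbitrary: r rule: laurent_tensor_induct2)
  case (zero_left t)
  then show ?case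
    by (intro exI [of _ 0]) (simp add: prodF_def iterF_def Tsub_def fun_eq_iff)
next
  case (zero_right f v)
  then show ?case
    by (intro exI [of _ 0]) (simp add: prodF_def iterF_def Tsub_def fun_eq_iff)
next
  case (add_left s s' t)
  obtain l l' where l: "binomial_mult l (Tsub (prodF s t r)) = binomial_mult l (iterF s t r)"
      "binomial_mult l' (Tsub (prodF s' t r)) = binomial_mult l' (iterF s' t r)"
    using add_left(4) [OF add_left(6)] add_left(5) [OF add_left(6)] by blast
  have eq: "prodF (s + s') t r = (\<lambda>p q. prodF s t r p q + prodF s' t r p q)"
    "iterF (s + s') t r = (\<lambda>p q. iterF s t r p q + iterF s' t r p q)"
    using add_left by (simp_all add: prodF_def iterF_def fun_eq_iff sh_add_left)
  show ?case
    unfolding eq by (rule associativity_add [OF qbounded_prodF qbounded_prodF l]) (use add_left in simp_all)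
next
  case (add_right f v t t')
  obtain l l' where l: "binomial_mult l (Tsub (prodF (gen f v) t r)) = binomial_mult l (iterF (gen f v) t r)"
      "binomial_mult l' (Tsub (prodF (gen f v) t' r)) = binomial_mult l' (iterF (gen f v) t' r)"
    using add_right(3) [OF add_right(5)] add_right(4) [OF add_right(5)] by blast
  have eq: "prodF (gen f v) (t + t') r = (\<lambda>p q. prodF (gen f v) t r p q + prodF (gen f v) t' r p q)"
    "iterF (gen f v) (t + t') r = (\<lambda>p q. iterF (gen f v) t r p q + iterF (gen f v) t' r p q)"
    using add_right by (simp_all add: prodF_def iterF_def fun_eq_iff sh_add_left sh_add_right)
  show ?case
    unfolding eq by (rule associativity_add [OF qbounded_prodF qbounded_prodF l]) (use add_right in simp_all)
next
  case (gen f u g v)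
  from gen show ?case
  proof (induction r rule: laurent_tensor_induct)
    case zero
    show ?case
      by (intro exI [of _ 0]) (simp add: prodF_def iterF_def Tsub_def fun_eq_iff)
  next
    case (add r r')
    obtain l l' where l: "binomial_mult l (Tsub (prodF (gen f u) (gen g v) r)) = binomial_mult l (iterF (gen f u) (gen g v) r)"
        "binomial_mult l' (Tsub (prodF (gen f u) (gen g v) r')) = binomial_mult l' (iterF (gen f u) (gen g v) r')"
      using add(3,4) by blast
    have eq: "prodF (gen f u) (gen g v) (r + r') = (\<lambda>p q. prodF (gen f u) (gen g v) r p q + prodF (gen f u) (gen g v) r' p q)"
      "iterF (gen f u) (gen g v) (r + r') = (\<lambda>p q. iterF (gen f u) (gen g v) r p q + iterF (gen f u) (gen g v) r' p q)"
      using add by (simp_all add: prodF_def iterF_def fun_eq_iff sh_add_right)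
    show ?case
      unfolding eq by (rule associativity_add [OF qbounded_prodF qbounded_prodF l]) (use add in simp_all)
  qed (rule weak_associativity_gen)
qed

end

section \<open>Coassociativity\<close>

lemma Tsub_linear:
  assumes \<phi>: "clinear \<phi>" and F: "qbounded F"
  shows "\<phi> (Tsub F p q) = Tsub (\<lambda>p q. \<phi> (F p q)) p q"
proof -
  have F': "qbounded (\<lambda>p q. \<phi> (F p q))"
    using F clinear_0 [OF \<phi>] by (force simp: qbounded_def)
  have "\<forall>\<^sub>F I::nat in sequentially. ?thesis"
    using Tsub_eventually [OF F, of q] Tsub_eventually [OF F', of q]
    by eventually_elim (simp add: clinear_sum [OF \<phi>] clinear_scaleC [OF \<phi>])
  then show ?thesis
    by simp
qed

lemma binomial_mult_diff:
  "binomial_mult l (\<lambda>p q. F p q - G p q) p q = binomial_mult l F p q - binomial_mult l G p q"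
  by (simp add: binomial_mult_def cvec.scale_right_diff_distrib sum_subtractf)

lemma sum_list_concat_map: "(\<Sum>z\<leftarrow>concat (map f xs). g z) = (\<Sum>x\<leftarrow>xs. \<Sum>z\<leftarrow>f x. g z)"
  by (induction xs) simp_all

lemma sum_list_swap: "(\<Sum>x\<leftarrow>xs. \<Sum>y\<leftarrow>ys. f x y) = (\<Sum>y\<leftarrow>ys. \<Sum>x\<leftarrow>xs. f x y)"
  for f :: "'a \<Rightarrow> 'b \<Rightarrow> 'c::comm_monoid_add"
  by (induction xs) (simp_all add: sum_list_addf)

lemma sum_list_cong: "(\<And>x. x \<in> set xs \<Longrightarrow> f x = g x) \<Longrightarrow> (\<Sum>x\<leftarrow>xs. f x) = (\<Sum>x\<leftarrow>xs. g x)"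
  by (rule arg_cong [of _ _ sum_list], rule map_cong [OF refl])

context nonlocal_vertex_algebra
begin

text \<open>One induction for three claims: additivity of \<open>Tsub\<close> uses the first at each
  step, and the third is the bound for cancelling powers of x0 + x2.\<close>

lemma weak_associativity_list:
  assumes "set zs \<subseteq> laurent_hom \<times> laurent_hom \<times> laurent_hom"
  shows "qbounded (\<lambda>p q. \<Sum>(b, c, d)\<leftarrow>zs. prodF (b u) (c v) (d w) p q) \<and>
    (\<exists>l. binomial_mult l (Tsub (\<lambda>p q. \<Sum>(b, c, d)\<leftarrow>zs. prodF (b u) (c v) (d w) p q)) =
      binomial_mult l (\<lambda>p q. \<Sum>(b, c, d)\<leftarrow>zs. iterF (b u) (c v) (d w) p q)) \<and>
    (\<exists>p0. \<forall>p<p0. \<forall>q. (\<Sum>(b, c, d)\<leftarrow>zs. iterF (b u) (c v) (d w) p q) = 0)"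
  using assms
proof (induction zs)
  case Nil
  then show ?case
    by (auto intro!: exI [of _ 0] simp: qbounded_def Tsub_def fun_eq_iff)
next
  case (Cons z zs)
  obtain b c d where z: "z = (b, c, d)"
    using prod_cases3 by blast
  with Cons.prems have mem: "b u \<in> laurent_tensor" "c v \<in> laurent_tensor" "d w \<in> laurent_tensor"
    by (auto intro: laurent_homD)
  obtain l where l: "binomial_mult l (Tsub (prodF (b u) (c v) (d w))) = binomial_mult l (iterF (b u) (c v) (d w))"
    using weak_associativity_laurent [OF mem] by blast
  obtain l' p0 where IH: "qbounded (\<lambda>p q. \<Sum>(b, c, d)\<leftarrow>zs. prodF (b u) (c v) (d w) p q)"
    "binomial_mult l' (Tsub (\<lambda>p q. \<Sum>(b, c, d)\<leftarrow>zs. prodF (b u) (c v) (d w) p q)) =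
      binomial_mult l' (\<lambda>p q. \<Sum>(b, c, d)\<leftarrow>zs. iterF (b u) (c v) (d w) p q)"
    "\<forall>p<p0. \<forall>q. (\<Sum>(b, c, d)\<leftarrow>zs. iterF (b u) (c v) (d w) p q) = 0"
    using Cons by auto
  obtain p1 where p1: "\<forall>p<p1. \<forall>q. iterF (b u) (c v) (d w) p q = 0"
    using iterF_bounded [OF mem] by blast
  have "\<exists>p0. \<forall>p<p0. \<forall>q. (\<Sum>(b, c, d)\<leftarrow>z # zs. iterF (b u) (c v) (d w) p q) = 0"
    using p1 IH(3) by (intro exI [of _ "min p0 p1"]) (simp add: z)
  then show ?case
    using Tsub_add(2) [OF qbounded_prodF [OF mem] IH(1)]
      associativity_add [OF qbounded_prodF [OF mem] IH(1) l IH(2)]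
    by (simp add: z)
qed

text \<open>Weak associativity enters twice. For u, v, w under a, it links the iterates that expand
  the left entries to the products that expand the right ones; with Laurent coefficients, it takes
  those products back to iterates. Only then are both sides bounded below in x0.\<close>

lemma coassociativity_eval:
  assumes a: "a \<in> laurent_hom" and xs: "set xs \<subseteq> B \<times> B" and via: "commutes_via Y a xs"
    and B: "B \<subseteq> laurent_hom" and D: "\<And>b. b \<in> B \<Longrightarrow> set (D b) \<subseteq> B \<times> B" "\<And>b. b \<in> B \<Longrightarrow> commutes_via Y b (D b)"
  shows "(\<Sum>(b, c)\<leftarrow>xs. \<Sum>(p, q)\<leftarrow>D b. sh Y (sh Y (p u) (q v) m) (c w) n) =
    (\<Sum>(b, c)\<leftarrow>xs. \<Sum>(p, q)\<leftarrow>D c. sh Y (sh Y (b u) (p v) m) (q w) n)"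
proof -
  define zl where "zl = concat (map (\<lambda>(b, c). map (\<lambda>(p, q). (p, q, c)) (D b)) xs)"
  define zr where "zr = concat (map (\<lambda>(b, c). map (\<lambda>(p, q). (b, p, q)) (D c)) xs)"
  have lh: "b u \<in> laurent_tensor" if "b \<in> B" for b u
    using that B laurent_homD by blast
  have xsB: "b \<in> B" "c \<in> B" if "(b, c) \<in> set xs" for b c
    using that xs by auto
  have DB: "p \<in> B" "q \<in> B" if "(p, q) \<in> set (D b)" "b \<in> B" for b p q
    using that D(1) by blast+
  have zl: "set zl \<subseteq> laurent_hom \<times> laurent_hom \<times> laurent_hom"
    unfolding zl_def using B xsB DB by fastforce
  have zr: "set zr \<subseteq> laurent_hom \<times> laurent_hom \<times> laurent_hom"
    unfolding zr_def using B xsB DB by fastforce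
  have zl_sum: "(\<Sum>(b, c, d)\<leftarrow>zl. f b c d) = (\<Sum>(b, c)\<leftarrow>xs. \<Sum>(p, q)\<leftarrow>D b. f p q c)" for f :: "_ \<Rightarrow> _ \<Rightarrow> _ \<Rightarrow> int \<Rightarrow> 'v"
    unfolding zl_def sum_list_concat_map by (simp add: split_def o_def)
  have zr_sum: "(\<Sum>(b, c, d)\<leftarrow>zr. f b c d) = (\<Sum>(b, c)\<leftarrow>xs. \<Sum>(p, q)\<leftarrow>D c. f b p q)" for f :: "_ \<Rightarrow> _ \<Rightarrow> _ \<Rightarrow> int \<Rightarrow> 'v"
    unfolding zr_def sum_list_concat_map by (simp add: split_def o_def)
  define IL where "IL p q = (\<Sum>(b, c, d)\<leftarrow>zl. iterF (b u) (c v) (d w) p q)" for p q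
  define IR where "IR p q = (\<Sum>(b, c, d)\<leftarrow>zr. iterF (b u) (c v) (d w) p q)" for p q
  define P where "P p q = (\<Sum>(b, c, d)\<leftarrow>zr. prodF (b u) (c v) (d w) p q)" for p q
  have D_eq: "b (Y x k y) = (\<Sum>(p, q)\<leftarrow>D b. sh Y (p x) (q y) k)" if "b \<in> B" for b x y k
    using D(2) [OF that] unfolding commutes_via_eq by blast
  have a_eq: "a (Y x k y) = (\<Sum>(b, c)\<leftarrow>xs. sh Y (b x) (c y) k)" for x y k
    using via unfolding commutes_via_eq by blast
  have IL: "a (iterate_coeff Y u v w p q) = IL p q" for p q
  proof -
    have "a (iterate_coeff Y u v w p q) = (\<Sum>(b, c)\<leftarrow>xs. sh Y (b (Y u (- p - 1) v)) (c w) (- q - 1))"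
      by (simp add: iterate_coeff_def a_eq)
    also have "\<dots> = (\<Sum>(b, c)\<leftarrow>xs. \<Sum>(p', q')\<leftarrow>D b. sh Y (sh Y (p' u) (q' v) (- p - 1)) (c w) (- q - 1))"
    proof (rule sum_list_cong, clarify)
      fix b c
      assume bc: "(b, c) \<in> set xs"
      show "sh Y (b (Y u (- p - 1) v)) (c w) (- q - 1) =
          (\<Sum>(p', q')\<leftarrow>D b. sh Y (sh Y (p' u) (q' v) (- p - 1)) (c w) (- q - 1))"
        using DB [OF _ xsB(1) [OF bc]] xsB [OF bc]
        by (subst D_eq) (auto simp: split_def lh intro!: sh_sum_list_left)
    qed
    finally show ?thesis
      by (simp add: IL_def zl_sum iterF_def)
  qed
  have P: "a (Y u (- p - 1) (Y v (- q - 1) w)) = P p q" for p q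
  proof -
    have "a (Y u (- p - 1) (Y v (- q - 1) w)) = (\<Sum>(b, c)\<leftarrow>xs. sh Y (b u) (c (Y v (- q - 1) w)) (- p - 1))"
      by (simp add: a_eq)
    also have "\<dots> = (\<Sum>(b, c)\<leftarrow>xs. \<Sum>(p', q')\<leftarrow>D c. sh Y (b u) (sh Y (p' v) (q' w) (- q - 1)) (- p - 1))"
    proof (rule sum_list_cong, clarify)
      fix b c
      assume bc: "(b, c) \<in> set xs"
      show "sh Y (b u) (c (Y v (- q - 1) w)) (- p - 1) =
          (\<Sum>(p', q')\<leftarrow>D c. sh Y (b u) (sh Y (p' v) (q' w) (- q - 1)) (- p - 1))"
        using DB [OF _ xsB(2) [OF bc]] xsB [OF bc]
        by (subst D_eq) (auto simp: split_def lh intro!: sh_sum_list_right)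
    qed
    finally show ?thesis
      by (simp add: P_def zr_sum prodF_def)
  qed
  obtain k where k: "binomial_mult k (shifted_product_coeff Y u v w) = binomial_mult k (iterate_coeff Y u v w)"
    using weak_associativity by blast
  obtain l p1 where l: "binomial_mult l (Tsub P) = binomial_mult l IR" and p1: "\<forall>p<p1. \<forall>q. IR p q = 0"
    using weak_associativity_list [OF zr, of u v w] unfolding P_def [abs_def] IR_def [abs_def] by blast
  obtain p2 where p2: "\<forall>p<p2. \<forall>q. IL p q = 0"
    using weak_associativity_list [OF zl, of u v w] unfolding IL_def [abs_def] by blast
  \<comment> \<open>One exponent large enough for both uses of weak associativity.\<close>
  let ?n = "max k l"
  have lin: "clinear a"
    using a by (rule laurent_hom_clinear)
  have TP: "a (shifted_product_coeff Y u v w p q) = Tsub P p q" for p q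
    by (simp add: shifted_product_Tsub Tsub_linear [OF lin qbounded_product] P)
  have "binomial_mult ?n IL p q = binomial_mult ?n IR p q" for p q
  proof -
    have "binomial_mult ?n IL p q = a (binomial_mult ?n (iterate_coeff Y u v w) p q)"
      using binomial_mult_linear [OF lin, of ?n "iterate_coeff Y u v w" p q] by (simp add: IL)
    also have "\<dots> = a (binomial_mult ?n (shifted_product_coeff Y u v w) p q)"
      using binomial_mult_mono [OF k, of ?n] by simp
    also have "\<dots> = binomial_mult ?n (Tsub P) p q"
      using binomial_mult_linear [OF lin, of ?n "shifted_product_coeff Y u v w" p q] by (simp add: TP)
    also have "\<dots> = binomial_mult ?n IR p q"
      using binomial_mult_mono [OF l, of ?n] by simp
    finally show ?thesis .
  qed
  then have "binomial_mult ?n (\<lambda>p q. IL p q - IR p q) p q = 0" for p q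
    by (simp add: binomial_mult_diff)
  from binomial_mult_cancel [OF this, of "min p1 p2"] have "IL p q - IR p q = 0" for p q
    using p1 p2 by simp
  from this [of "- m - 1" "- n - 1"] show ?thesis
    by (simp add: IL_def IR_def zl_sum zr_sum iterF_def)
qed

end

section \<open>The bialgebra\<close>

lemma vacuum_eigenvalue_eq: "vacuum_eigenvalue vac a c \<longleftrightarrow> a vac = gen (fls_const c) vac"
  by (auto simp: vacuum_eigenvalue_def gen_def fun_eq_iff)

lemma lh_mult_hom: "a \<in> laurent_hom \<Longrightarrow> b \<in> laurent_hom \<Longrightarrow> lh_mult a b \<in> laurent_hom"
  using act_lh_mult(2) [of a b 0] by (simp add: lh_mult_eq [abs_def])

lemma lh_one_hom: "lh_one \<in> laurent_hom"
  using gen_laurent_hom [of 1] by (simp add: lh_one_eq [abs_def])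

lemma lh_deriv_hom: "a \<in> laurent_hom \<Longrightarrow> lh_deriv a \<in> laurent_hom"
  using lh_deriv_laurent_hom [of a] by (simp add: lh_deriv_eq [abs_def])

lemma act_lh_deriv: "act (lh_deriv a) s = act (\<lambda>w. deriv (a w)) s"
  by (simp add: lh_deriv_eq [abs_def])

context vertex_structure
begin

lemma commutes_via_add:
  "commutes_via Y a xs \<Longrightarrow> commutes_via Y b ys \<Longrightarrow> commutes_via Y (a + b) (xs @ ys)"
  by (simp add: commutes_via_eq fun_ops)

lemma commutes_via_scaleC:
  assumes "set xs \<subseteq> laurent_hom \<times> laurent_hom" "commutes_via Y a xs"
  shows "commutes_via Y (k *\<^sub>C a) (map (\<lambda>(b, c). (k *\<^sub>C b, c)) xs)"
proof -
  have "k *\<^sub>C (\<Sum>(b, c)\<leftarrow>xs. sh Y (b v) (c w) n) = (\<Sum>(b, c)\<leftarrow>map (\<lambda>(b, c). (k *\<^sub>C b, c)) xs. sh Y (b v) (c w) n)" for v w n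
    using assms(1)
    by (induction xs) (auto simp: scaleC_add_right scaleC_fun_apply laurent_homD sh_scaleC_left)
  then show ?thesis
    using assms(2) by (simp add: commutes_via_eq scaleC_fun_apply)
qed

text \<open>Apply a to the expansion of b; \<open>act_sh\<close> distributes a over each
  summand.\<close>

lemma commutes_via_mult:
  assumes a: "a \<in> laurent_hom" and xs: "set xs \<subseteq> laurent_hom \<times> laurent_hom" "commutes_via Y a xs"
    and ys: "set ys \<subseteq> laurent_hom \<times> laurent_hom" "commutes_via Y b ys"
  shows "commutes_via Y (lh_mult a b) (concat (map (\<lambda>(p, q). map (\<lambda>(r, s). (lh_mult p r, lh_mult q s)) ys) xs))"
  unfolding commutes_via_eq
proof (intro allI)
  fix v w n
  have "lh_mult a b (Y v n w) = (\<Sum>(r, s)\<leftarrow>ys. act a (sh Y (r v) (s w) n))"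
  proof -
    have "(\<lambda>(r, s). sh Y (r v) (s w) n) x \<in> laurent_tensor" if "x \<in> set ys" for x
    proof -
      have "fst x \<in> laurent_hom" "snd x \<in> laurent_hom"
        using that ys(1) by auto
      then show ?thesis
        by (simp add: split_def laurent_homD)
    qed
    then have "act a (\<Sum>(r, s)\<leftarrow>ys. sh Y (r v) (s w) n) = (\<Sum>x\<leftarrow>ys. act a ((\<lambda>(r, s). sh Y (r v) (s w) n) x))"
      by (rule act_sum_list [OF a])
    then show ?thesis
      using ys(2) by (simp add: lh_mult_eq commutes_via_eq split_def)
  qed
  also have "\<dots> = (\<Sum>(r, s)\<leftarrow>ys. \<Sum>(p, q)\<leftarrow>xs. sh Y (lh_mult p r v) (lh_mult q s w) n)"
    by (rule sum_list_cong) (use ys(1) in \<open>auto simp: act_sh [OF a xs] laurent_homD lh_mult_eq\<close>)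
  also have "\<dots> = (\<Sum>(p, q)\<leftarrow>xs. \<Sum>(r, s)\<leftarrow>ys. sh Y (lh_mult p r v) (lh_mult q s w) n)"
    unfolding split_def by (rule sum_list_swap)
  also have "\<dots> = (\<Sum>(b, c)\<leftarrow>concat (map (\<lambda>(p, q). map (\<lambda>(r, s). (lh_mult p r, lh_mult q s)) ys) xs). sh Y (b v) (c w) n)"
    unfolding sum_list_concat_map by (simp add: split_def o_def)
  finally show "lh_mult a b (Y v n w) = \<dots>" .
qed

lemma commutes_via_one: "commutes_via Y lh_one [(lh_one, lh_one)]"
  using sh_const [of 1 _ 1] by (simp add: commutes_via_eq lh_one_eq)

lemma commutes_via_deriv:
  assumes xs: "set xs \<subseteq> laurent_hom \<times> laurent_hom" "commutes_via Y a xs"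
  shows "commutes_via Y (lh_deriv a) (concat (map (\<lambda>(b, c). [(lh_deriv b, c), (b, lh_deriv c)]) xs))"
  unfolding commutes_via_eq
proof (intro allI)
  fix v w n
  have "deriv (\<Sum>(b, c)\<leftarrow>xs. sh Y (b v) (c w) n) = (\<Sum>(b, c)\<leftarrow>xs. sh Y (lh_deriv b v) (c w) n + sh Y (b v) (lh_deriv c w) n)"
    using xs(1) by (induction xs) (auto simp: deriv_add deriv_sh laurent_homD lh_deriv_eq)
  then show "lh_deriv a (Y v n w) = (\<Sum>(b, c)\<leftarrow>concat (map (\<lambda>(b, c). [(lh_deriv b, c), (b, lh_deriv c)]) xs). sh Y (b v) (c w) n)"
    using xs(2) unfolding sum_list_concat_map by (simp add: commutes_via_eq lh_deriv_eq split_def)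
qed

section \<open>Closure properties of B(V)\<close>

definition admissible :: "('v \<Rightarrow> int \<Rightarrow> 'v) set \<Rightarrow> bool" where
  "admissible U \<longleftrightarrow> cvec.subspace U \<and> U \<subseteq> laurent_hom \<and> Delta_closed Y U \<and> (\<forall>a\<in>U. \<exists>c. vacuum_eigenvalue vac a c)"

lemma BV_eq: "BV Y vac = cvec.span (\<Union>{U. admissible U})"
  by (simp add: BV_def admissible_def)

text \<open>Stated for a set X of generators, so that membership in B(V) can be shown by exhibiting
  a convenient set: products, derivatives, or a single operator.\<close>

lemma admissible_span:
  assumes X: "X \<subseteq> laurent_hom" and closed: "\<And>a. a \<in> X \<Longrightarrow> \<exists>xs. set xs \<subseteq> X \<times> X \<and> commutes_via Y a xs"
    and vac: "\<And>a. a \<in> X \<Longrightarrow> \<exists>c. vacuum_eigenvalue vac a c"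
  shows "admissible (cvec.span X)"
proof -
  have LH: "cvec.span X \<subseteq> laurent_hom"
    by (rule cvec.span_minimal [OF X subspace_laurent_hom])
  have "(\<exists>xs. set xs \<subseteq> cvec.span X \<times> cvec.span X \<and> commutes_via Y a xs) \<and> (\<exists>c. vacuum_eigenvalue vac a c)"
    if "a \<in> cvec.span X" for a
    using that
  proof (induction rule: cvec.span_induct_alt)
    case base
    show ?case
      by (intro conjI exI [of _ "[]"] exI [of _ 0])
        (simp_all add: commutes_via_eq vacuum_eigenvalue_eq fun_ops fun_eq_iff)
  next
    case (step k x y)
    obtain xs where xs: "set xs \<subseteq> X \<times> X" "commutes_via Y x xs"
      using closed [OF step(1)] by blast
    obtain ys where ys: "set ys \<subseteq> cvec.span X \<times> cvec.span X" "commutes_via Y y ys"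
      using step(2) by blast
    have "set (map (\<lambda>(b, c). (k *\<^sub>C b, c)) xs @ ys) \<subseteq> cvec.span X \<times> cvec.span X"
    proof -
      have "set xs \<subseteq> cvec.span X \<times> cvec.span X"
        using xs(1) cvec.span_superset [of X] by blast
      then show ?thesis
        using ys(1) by (auto intro: cvec.span_scale)
    qed
    moreover have "set xs \<subseteq> laurent_hom \<times> laurent_hom"
      using xs(1) X by auto
    then have "commutes_via Y (k *\<^sub>C x + y) (map (\<lambda>(b, c). (k *\<^sub>C b, c)) xs @ ys)"
      using xs(2) ys(2) by (intro commutes_via_add commutes_via_scaleC)
    moreover obtain c d where "vacuum_eigenvalue vac x c" "vacuum_eigenvalue vac y d"
      using vac [OF step(1)] step(2) by blast
    then have "vacuum_eigenvalue vac (k *\<^sub>C x + y) (k * c + d)"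
      by (simp add: vacuum_eigenvalue_eq fun_ops scaleC_fun_apply scaleC_gen gen_add_left [symmetric] fls_plus_const)
    ultimately show ?case
      by blast
  qed
  then show ?thesis
    using LH by (simp add: admissible_def Delta_closed_def)
qed

lemma admissible_BV: "admissible (BV Y vac)"
  unfolding BV_eq
proof (rule admissible_span)
  fix a
  assume "a \<in> \<Union>{U. admissible U}"
  then obtain U where U: "admissible U" "a \<in> U"
    by blast
  then obtain xs where "set xs \<subseteq> U \<times> U" "commutes_via Y a xs"
    by (auto simp: admissible_def Delta_closed_def)
  with U(1) show "\<exists>xs. set xs \<subseteq> \<Union>{U. admissible U} \<times> \<Union>{U. admissible U} \<and> commutes_via Y a xs"
    by (intro exI [of _ xs]) blast
  show "\<exists>c. vacuum_eigenvalue vac a c"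
    using U by (simp add: admissible_def)
qed (auto simp: admissible_def)

lemma BV_superset:
  assumes "X \<subseteq> laurent_hom" "\<And>a. a \<in> X \<Longrightarrow> \<exists>xs. set xs \<subseteq> X \<times> X \<and> commutes_via Y a xs"
    "\<And>a. a \<in> X \<Longrightarrow> \<exists>c. vacuum_eigenvalue vac a c"
  shows "X \<subseteq> BV Y vac"
  unfolding BV_eq using admissible_span [OF assms] by (blast intro: cvec.span_base)

lemma subspace_BV: "cvec.subspace (BV Y vac)"
  using admissible_BV by (simp add: admissible_def)

lemma BV_laurent_hom: "BV Y vac \<subseteq> laurent_hom"
  using admissible_BV by (simp add: admissible_def)

lemma BV_homD: "a \<in> BV Y vac \<Longrightarrow> a \<in> laurent_hom"
  using BV_laurent_hom by blast

lemma BV_pairs: "set xs \<subseteq> BV Y vac \<times> BV Y vac \<Longrightarrow> set xs \<subseteq> laurent_hom \<times> laurent_hom"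
  using BV_laurent_hom by blast

lemma BV_closed: "a \<in> BV Y vac \<Longrightarrow> \<exists>xs. set xs \<subseteq> BV Y vac \<times> BV Y vac \<and> commutes_via Y a xs"
  using admissible_BV by (simp add: admissible_def Delta_closed_def)

lemma BV_vac: "a \<in> BV Y vac \<Longrightarrow> \<exists>c. a vac = gen (fls_const c) vac"
  using admissible_BV by (simp add: admissible_def vacuum_eigenvalue_eq)

lemma lh_one_vac: "lh_one vac = gen (fls_const 1) vac"
  by (simp add: lh_one_eq)

lemma lh_mult_vac:
  "a \<in> laurent_hom \<Longrightarrow> a vac = gen (fls_const c) vac \<Longrightarrow> b vac = gen (fls_const d) vac \<Longrightarrow>
    lh_mult a b vac = gen (fls_const (c * d)) vac"
  by (simp add: lh_mult_eq act_gen_right act_gen_gen mult.commute)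

lemma lh_deriv_vac: "a vac = gen (fls_const c) vac \<Longrightarrow> lh_deriv a vac = 0"
  by (simp add: lh_deriv_eq deriv_gen)

lemma lh_one_BV: "lh_one \<in> BV Y vac"
proof -
  have "{lh_one} \<subseteq> BV Y vac"
  proof (rule BV_superset)
    fix a :: "'v \<Rightarrow> int \<Rightarrow> 'v"
    assume a: "a \<in> {lh_one}"
    then show "\<exists>xs. set xs \<subseteq> {lh_one} \<times> {lh_one} \<and> commutes_via Y a xs"
      using commutes_via_one by (intro exI [of _ "[(lh_one, lh_one)]"]) simp
    show "\<exists>c. vacuum_eigenvalue vac a c"
      using a lh_one_vac unfolding vacuum_eigenvalue_eq by blast
  qed (simp add: lh_one_hom)
  then show ?thesis
    by simp
qed

lemma lh_mult_BV:
  assumes "a \<in> BV Y vac" "b \<in> BV Y vac"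
  shows "lh_mult a b \<in> BV Y vac"
proof -
  let ?X = "{lh_mult a b | a b. a \<in> BV Y vac \<and> b \<in> BV Y vac}"
  have "?X \<subseteq> BV Y vac"
  proof (rule BV_superset)
    fix x
    assume "x \<in> ?X"
    then obtain a b where x: "x = lh_mult a b" "a \<in> BV Y vac" "b \<in> BV Y vac"
      by blast
    obtain xs ys where xs: "set xs \<subseteq> BV Y vac \<times> BV Y vac" "commutes_via Y a xs"
      and ys: "set ys \<subseteq> BV Y vac \<times> BV Y vac" "commutes_via Y b ys"
      using BV_closed x by metis
    have "set (concat (map (\<lambda>(p, q). map (\<lambda>(r, s). (lh_mult p r, lh_mult q s)) ys) xs)) \<subseteq> ?X \<times> ?X"
      using xs(1) ys(1) by fastforce
    then show "\<exists>xs. set xs \<subseteq> ?X \<times> ?X \<and> commutes_via Y x xs"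
      unfolding x(1) using commutes_via_mult [OF BV_homD [OF x(2)] BV_pairs [OF xs(1)] xs(2) BV_pairs [OF ys(1)] ys(2)]
      by blast
    show "\<exists>c. vacuum_eigenvalue vac x c"
      unfolding x(1) vacuum_eigenvalue_eq
      using BV_vac [OF x(2)] BV_vac [OF x(3)] lh_mult_vac [OF BV_homD [OF x(2)]] by blast
  qed (auto simp: lh_mult_hom BV_homD)
  then show ?thesis
    using assms by blast
qed

lemma lh_deriv_BV:
  assumes "a \<in> BV Y vac"
  shows "lh_deriv a \<in> BV Y vac"
proof -
  \<comment> \<open>B(V) itself is included because each term of the coproduct of a derivative has
    one undifferentiated factor.\<close>
  let ?X = "BV Y vac \<union> lh_deriv ` BV Y vac"
  have "?X \<subseteq> BV Y vac"
  proof (rule BV_superset)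
    fix x
    assume x: "x \<in> ?X"
    show "\<exists>xs. set xs \<subseteq> ?X \<times> ?X \<and> commutes_via Y x xs"
    proof (cases "x \<in> BV Y vac")
      case True
      then show ?thesis
        using BV_closed by blast
    next
      case False
      with x obtain a where a: "x = lh_deriv a" "a \<in> BV Y vac"
        by blast
      obtain xs where xs: "set xs \<subseteq> BV Y vac \<times> BV Y vac" "commutes_via Y a xs"
        using BV_closed a by metis
      have "set (concat (map (\<lambda>(b, c). [(lh_deriv b, c), (b, lh_deriv c)]) xs)) \<subseteq> ?X \<times> ?X"
        using xs(1) by auto
      then show ?thesis
        unfolding a(1) using commutes_via_deriv [OF BV_pairs [OF xs(1)] xs(2)] by blast
    qed
    show "\<exists>c. vacuum_eigenvalue vac x c"
    proof (cases "x \<in> BV Y vac")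
      case True
      then show ?thesis
        using BV_vac unfolding vacuum_eigenvalue_eq by blast
    next
      case False
      with x obtain a where a: "x = lh_deriv a" "a \<in> BV Y vac"
        by blast
      then obtain c where "a vac = gen (fls_const c) vac"
        using BV_vac by blast
      then have "x vac = 0"
        unfolding a(1) by (rule lh_deriv_vac)
      then show ?thesis
        unfolding vacuum_eigenvalue_eq by (intro exI [of _ 0]) simp
    qed
  qed (auto simp: lh_deriv_hom BV_homD)
  then show ?thesis
    using assms by blast
qed

end

lemma scaleC_sum_list: "k *\<^sub>C (\<Sum>x\<leftarrow>xs. f x) = (\<Sum>x\<leftarrow>xs. k *\<^sub>C f x)"
  for f :: "'a \<Rightarrow> 'b::complex_vector"
  by (induction xs) (simp_all add: scaleC_add_right)

lemma pure_tensor_sum_scaleC: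
  "(\<Sum>(b, c)\<leftarrow>map (\<lambda>(b, c). (k *\<^sub>C b, c)) xs. b \<otimes> c) = k *\<^sub>C (\<Sum>(b, c)\<leftarrow>xs. b \<otimes> c)"
  by (induction xs) (auto simp: scaleC_add_right pure_tensor_scaleC_left)

context vertex_structure
begin

section \<open>Counit, coproduct and their uniqueness\<close>

definition counit :: "('v \<Rightarrow> int \<Rightarrow> 'v) \<Rightarrow> complex" where
  "counit a = (SOME c. vacuum_eigenvalue vac a c)"

text \<open>A choice among the tensors that satisfy the relation. One exists for every element of
  B(V), and \<open>comult_unique\<close> shows that there is no other when V is irreducible and of
  countable dimension.\<close>

definition comult :: "('v \<Rightarrow> int \<Rightarrow> 'v) \<Rightarrow> ('v \<Rightarrow> int \<Rightarrow> 'v, 'v \<Rightarrow> int \<Rightarrow> 'v) tensor" where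
  "comult a = (SOME t. comult_relation Y vac a t)"

lemma counit: "a \<in> BV Y vac \<Longrightarrow> a vac = gen (fls_const (counit a)) vac"
  unfolding counit_def vacuum_eigenvalue_eq [symmetric]
  by (rule someI_ex) (simp add: vacuum_eigenvalue_eq BV_vac)

lemma counit_eqI:
  assumes "adjoint_irreducible Y" "a \<in> BV Y vac" "a vac = gen (fls_const c) vac"
  shows "counit a = c"
proof -
  have "gen (fls_const (counit a)) vac 0 = gen (fls_const c) vac 0"
    using counit [OF assms(2)] assms(3) by simp
  then have "(counit a - c) *\<^sub>C vac = 0"
    by (simp add: gen_nth cvec.scale_left_diff_distrib)
  then show ?thesis
    using vac_nonzero [OF assms(1)] by simp
qed

end

context nonlocal_vertex_algebra
begin

context
  assumes irr: "adjoint_irreducible Y" and dim: "countable_dim (UNIV :: 'v set)"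
begin

text \<open>With a sign on the left entries, the difference of two expansions is again a list, to
  which \<open>tensor_zero\<close> applies.\<close>

lemma commutes_via_unique:
  assumes "set xs \<subseteq> laurent_hom \<times> laurent_hom" "commutes_via Y a xs"
    and "set ys \<subseteq> laurent_hom \<times> laurent_hom" "commutes_via Y a ys"
  shows "(\<Sum>(b, c)\<leftarrow>xs. b \<otimes> c) = (\<Sum>(b, c)\<leftarrow>ys. b \<otimes> c)"
proof -
  define zs where "zs = map (\<lambda>(b, c). (- 1 *\<^sub>C b, c)) ys"
  have zs: "set zs \<subseteq> laurent_hom \<times> laurent_hom"
    unfolding zs_def using assms(3) by (auto intro!: cvec.subspace_neg [OF subspace_laurent_hom])
  have via: "commutes_via Y (- 1 *\<^sub>C a) zs"
    unfolding zs_def using assms(3,4) by (rule commutes_via_scaleC)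
  have "(\<Sum>(b, c)\<leftarrow>xs @ zs. b \<otimes> c) = 0"
  proof (rule tensor_zero [OF irr dim])
    show "set (xs @ zs) \<subseteq> laurent_hom \<times> laurent_hom"
      using assms(1) zs by simp
    have "commutes_via Y (a + - 1 *\<^sub>C a) (xs @ zs)"
      by (rule commutes_via_add [OF assms(2) via])
    then show "(\<Sum>(b, c)\<leftarrow>xs @ zs. sh Y (b v) (c w) n) = 0" for v w n
      unfolding commutes_via_eq by (simp add: fun_ops)
  qed
  moreover have "(\<Sum>(b, c)\<leftarrow>zs. b \<otimes> c) = - (\<Sum>(b, c)\<leftarrow>ys. b \<otimes> c)"
    unfolding zs_def pure_tensor_sum_scaleC by simp
  ultimately show ?thesis
    by simp
qed

text \<open>The bialgebra axioms quantify over all expansions of a tensor; since \<open>sh\<close>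
  is bilinear, the relation does not depend on the expansion.\<close>

lemma commutes_via_expansion:
  assumes xs: "set xs \<subseteq> laurent_hom \<times> laurent_hom" and ys: "set ys \<subseteq> laurent_hom \<times> laurent_hom"
    and eq: "(\<Sum>(b, c)\<leftarrow>xs. b \<otimes> c) = (\<Sum>(b, c)\<leftarrow>ys. b \<otimes> c)" and via: "commutes_via Y a xs"
  shows "commutes_via Y a ys"
  using via tensor_sum_eq_bilinear [OF subspace_laurent_hom subspace_laurent_hom bilinear_on_sh xs ys eq]
  by (simp add: commutes_via_eq)

lemma comult_relation: "a \<in> BV Y vac \<Longrightarrow> comult_relation Y vac a (comult a)"
proof -
  assume "a \<in> BV Y vac"
  then obtain xs where "set xs \<subseteq> BV Y vac \<times> BV Y vac" "commutes_via Y a xs"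
    using BV_closed by blast
  then have "comult_relation Y vac a (\<Sum>(b, c)\<leftarrow>xs. b \<otimes> c)"
    unfolding comult_relation_def tensor_expansion_def by blast
  then show ?thesis
    unfolding comult_def by (rule someI)
qed

lemma comult_unique: "comult_relation Y vac a s \<Longrightarrow> comult_relation Y vac a t \<Longrightarrow> s = t"
  unfolding comult_relation_def tensor_expansion_def
  using commutes_via_unique BV_pairs by metis

lemma comult_eqI:
  assumes "set xs \<subseteq> BV Y vac \<times> BV Y vac" "commutes_via Y a xs" "a \<in> BV Y vac"
  shows "comult a = (\<Sum>(b, c)\<leftarrow>xs. b \<otimes> c)"
proof -
  have "comult_relation Y vac a (\<Sum>(b, c)\<leftarrow>xs. b \<otimes> c)"
    unfolding comult_relation_def tensor_expansion_def using assms(1,2) by blast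
  then show ?thesis
    using comult_relation [OF assms(3)] comult_unique by blast
qed

lemma expansion_comult:
  assumes "a \<in> BV Y vac" "tensor_expansion (BV Y vac) (comult a) xs"
  shows "set xs \<subseteq> BV Y vac \<times> BV Y vac" "commutes_via Y a xs"
proof -
  show xs: "set xs \<subseteq> BV Y vac \<times> BV Y vac"
    using assms(2) by (simp add: tensor_expansion_def)
  obtain ys where "tensor_expansion (BV Y vac) (comult a) ys" "commutes_via Y a ys"
    using comult_relation [OF assms(1)] by (auto simp: comult_relation_def)
  then have ys: "set ys \<subseteq> BV Y vac \<times> BV Y vac" "commutes_via Y a ys"
      "(\<Sum>(b, c)\<leftarrow>ys. b \<otimes> c) = (\<Sum>(b, c)\<leftarrow>xs. b \<otimes> c)"
    using assms(2) by (simp_all add: tensor_expansion_def)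
  show "commutes_via Y a xs"
    by (rule commutes_via_expansion [OF BV_pairs [OF ys(1)] BV_pairs [OF xs] ys(3,2)])
qed

lemma comult_in: "a \<in> BV Y vac \<Longrightarrow> comult a \<in> tensor_of (BV Y vac) (BV Y vac)"
  using comult_relation [of a] by (auto simp: comult_relation_def intro: tensor_expansion_in)

text \<open>Put v = vac and take the coefficient of x2^0: Y(vac, x2) = 1 leaves a, and each left
  entry contributes its vacuum eigenvalue.\<close>

lemma counit_left_eval:
  assumes "a \<in> BV Y vac" "tensor_expansion (BV Y vac) (comult a) xs"
  shows "(\<Sum>(b, c)\<leftarrow>xs. counit b *\<^sub>C c) = a"
proof
  fix w
  note xs = expansion_comult [OF assms]
  have "a w = (\<Sum>(b, c)\<leftarrow>xs. sh Y (b vac) (c w) (-1))"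
    using xs(2) vacuum [of "-1" w] unfolding commutes_via_eq by metis
  also have "\<dots> = (\<Sum>(b, c)\<leftarrow>xs. (counit b *\<^sub>C c) w)"
    by (rule sum_list_cong)
       (use xs(1) in \<open>auto simp: counit sh_vac_left laurent_homD [OF BV_homD] scaleC_fun_apply\<close>)
  finally show "(\<Sum>(b, c)\<leftarrow>xs. counit b *\<^sub>C c) w = a w"
    by (simp add: sum_list_apply split_def)
qed

text \<open>Here w = vac, and the coefficient of x2^0 is the limit in the creation property.\<close>

lemma counit_right_eval:
  assumes "a \<in> BV Y vac" "tensor_expansion (BV Y vac) (comult a) xs"
  shows "(\<Sum>(b, c)\<leftarrow>xs. counit c *\<^sub>C b) = a"
proof
  fix v
  note xs = expansion_comult [OF assms]
  have "a v = (\<Sum>(b, c)\<leftarrow>xs. sh Y (b v) (c vac) (-1))"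
    using xs(2) creation_limit [of v] unfolding commutes_via_eq by metis
  also have "\<dots> = (\<Sum>(b, c)\<leftarrow>xs. (counit c *\<^sub>C b) v)"
    by (rule sum_list_cong)
       (use xs(1) in \<open>auto simp: counit sh_vac_right laurent_homD [OF BV_homD] scaleC_fun_apply\<close>)
  finally show "(\<Sum>(b, c)\<leftarrow>xs. counit c *\<^sub>C b) v = a v"
    by (simp add: sum_list_apply split_def)
qed

lemma comult_coassoc:
  assumes a: "a \<in> BV Y vac" and xs: "tensor_expansion (BV Y vac) (comult a) xs"
    and D: "\<And>b. b \<in> BV Y vac \<Longrightarrow> tensor_expansion (BV Y vac) (comult b) (D b)"
  shows "(\<Sum>(b, c)\<leftarrow>xs. \<Sum>(p, q)\<leftarrow>D b. p \<otimes> (q \<otimes> c)) = (\<Sum>(b, c)\<leftarrow>xs. \<Sum>(p, q)\<leftarrow>D c. b \<otimes> (p \<otimes> q))"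
proof -
  let ?B = "BV Y vac"
  define zl where "zl = concat (map (\<lambda>(b, c). map (\<lambda>(p, q). (p, q, c)) (D b)) xs)"
  \<comment> \<open>The sign that brings both sides of the identity into a single list for
    \<open>tensor_zero3\<close>; it is carried by the first entry.\<close>
  define k :: complex where "k = - 1"
  define zr where "zr = concat (map (\<lambda>(b, c). map (\<lambda>(p, q). (k *\<^sub>C b, p, q)) (D c)) xs)"
  note xsB = expansion_comult [OF a xs]
  have DB: "set (D b) \<subseteq> ?B \<times> ?B" "commutes_via Y b (D b)" if "b \<in> ?B" for b
    using expansion_comult [OF that D [OF that]] by blast+
  have lh: "b \<in> laurent_hom" "c \<in> laurent_hom" "k *\<^sub>C b \<in> laurent_hom"
    "\<And>p q. (p, q) \<in> set (D b) \<Longrightarrow> p \<in> laurent_hom \<and> q \<in> laurent_hom"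
    "\<And>p q. (p, q) \<in> set (D c) \<Longrightarrow> p \<in> laurent_hom \<and> q \<in> laurent_hom" if "(b, c) \<in> set xs" for b c
  proof -
    have bc: "b \<in> ?B" "c \<in> ?B"
      using that xsB(1) by auto
    then show "b \<in> laurent_hom" "c \<in> laurent_hom"
      by (simp_all add: BV_homD)
    then show "k *\<^sub>C b \<in> laurent_hom"
      by (intro cvec.subspace_scale [OF subspace_laurent_hom])
    show "p \<in> laurent_hom \<and> q \<in> laurent_hom" if "(p, q) \<in> set (D b)" for p q
      using that DB(1) [OF bc(1)] BV_homD by blast
    show "p \<in> laurent_hom \<and> q \<in> laurent_hom" if "(p, q) \<in> set (D c)" for p q
      using that DB(1) [OF bc(2)] BV_homD by blast
  qed
  have "(\<Sum>(p, q, c)\<leftarrow>zl @ zr. p \<otimes> (q \<otimes> c)) = 0"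
  proof (rule tensor_zero3 [OF irr dim])
    show "set (zl @ zr) \<subseteq> laurent_hom \<times> laurent_hom \<times> laurent_hom"
      unfolding zl_def zr_def using lh by auto
  next
    fix u v w m n
    have "(\<Sum>(p, q, c)\<leftarrow>zl. sh Y (sh Y (p u) (q v) m) (c w) n)
        = (\<Sum>(b, c)\<leftarrow>xs. \<Sum>(p, q)\<leftarrow>D b. sh Y (sh Y (p u) (q v) m) (c w) n)"
      unfolding zl_def sum_list_concat_map by (simp add: split_def o_def)
    also have "\<dots> = (\<Sum>(b, c)\<leftarrow>xs. \<Sum>(p, q)\<leftarrow>D c. sh Y (sh Y (b u) (p v) m) (q w) n)"
      by (rule coassociativity_eval [OF BV_homD [OF a] xsB BV_laurent_hom DB])
    finally have left: "(\<Sum>(p, q, c)\<leftarrow>zl. sh Y (sh Y (p u) (q v) m) (c w) n) = \<dots>" .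
    have "(\<Sum>(p, q, c)\<leftarrow>zr. sh Y (sh Y (p u) (q v) m) (c w) n)
        = (\<Sum>(b, c)\<leftarrow>xs. \<Sum>(p, q)\<leftarrow>D c. sh Y (sh Y ((k *\<^sub>C b) u) (p v) m) (q w) n)"
      unfolding zr_def sum_list_concat_map by (simp add: split_def o_def)
    also have "\<dots> = (\<Sum>(b, c)\<leftarrow>xs. \<Sum>(p, q)\<leftarrow>D c. k *\<^sub>C sh Y (sh Y (b u) (p v) m) (q w) n)"
    proof (rule sum_list_cong, clarify, rule sum_list_cong, clarify)
      fix b c p q
      assume bc: "(b, c) \<in> set xs" and pq: "(p, q) \<in> set (D c)"
      show "sh Y (sh Y ((k *\<^sub>C b) u) (p v) m) (q w) n = k *\<^sub>C sh Y (sh Y (b u) (p v) m) (q w) n"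
        using lh(1) [OF bc] lh(5) [OF bc pq] by (simp add: scaleC_fun_apply sh_scaleC_left laurent_homD)
    qed
    also have "\<dots> = k *\<^sub>C (\<Sum>(b, c)\<leftarrow>xs. \<Sum>(p, q)\<leftarrow>D c. sh Y (sh Y (b u) (p v) m) (q w) n)"
      by (simp add: scaleC_sum_list split_def)
    finally show "(\<Sum>(p, q, c)\<leftarrow>zl @ zr. sh Y (sh Y (p u) (q v) m) (c w) n) = 0"
      by (simp add: left k_def)
  qed
  moreover have "(\<Sum>(p, q, c)\<leftarrow>zl. p \<otimes> (q \<otimes> c)) = (\<Sum>(b, c)\<leftarrow>xs. \<Sum>(p, q)\<leftarrow>D b. p \<otimes> (q \<otimes> c))"
    unfolding zl_def sum_list_concat_map by (simp add: split_def o_def)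
  moreover have "(\<Sum>(p, q, c)\<leftarrow>zr. p \<otimes> (q \<otimes> c)) = k *\<^sub>C (\<Sum>(b, c)\<leftarrow>xs. \<Sum>(p, q)\<leftarrow>D c. b \<otimes> (p \<otimes> q))"
    unfolding zr_def sum_list_concat_map by (simp add: split_def o_def pure_tensor_scaleC_left scaleC_sum_list)
  ultimately show ?thesis
    by (simp add: k_def)
qed

lemma comult_linear: "linear_on (BV Y vac) comult"
proof (unfold linear_on_def, intro conjI ballI allI)
  fix a b
  assume ab: "a \<in> BV Y vac" "b \<in> BV Y vac"
  obtain xs ys where xs: "set xs \<subseteq> BV Y vac \<times> BV Y vac" "commutes_via Y a xs"
    and ys: "set ys \<subseteq> BV Y vac \<times> BV Y vac" "commutes_via Y b ys"
    using BV_closed ab by metis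
  have "comult (a + b) = (\<Sum>(b, c)\<leftarrow>xs @ ys. b \<otimes> c)"
    using xs ys ab by (intro comult_eqI commutes_via_add cvec.subspace_add [OF subspace_BV]) auto
  then show "comult (a + b) = comult a + comult b"
    using comult_eqI [OF xs ab(1)] comult_eqI [OF ys ab(2)] by simp
next
  fix k a
  assume a: "a \<in> BV Y vac"
  obtain xs where xs: "set xs \<subseteq> BV Y vac \<times> BV Y vac" "commutes_via Y a xs"
    using BV_closed a by metis
  have "comult (k *\<^sub>C a) = (\<Sum>(b, c)\<leftarrow>map (\<lambda>(b, c). (k *\<^sub>C b, c)) xs. b \<otimes> c)"
    using xs a by (intro comult_eqI commutes_via_scaleC BV_pairs)
      (auto intro: cvec.subspace_scale [OF subspace_BV])
  also have "\<dots> = k *\<^sub>C (\<Sum>(b, c)\<leftarrow>xs. b \<otimes> c)"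
    by (rule pure_tensor_sum_scaleC)
  finally show "comult (k *\<^sub>C a) = k *\<^sub>C comult a"
    using comult_eqI [OF xs a] by simp
qed

lemma counit_linear: "linear_on (BV Y vac) counit"
proof (unfold linear_on_def, intro conjI ballI allI)
  fix a b
  assume ab: "a \<in> BV Y vac" "b \<in> BV Y vac"
  show "counit (a + b) = counit a + counit b"
    by (rule counit_eqI [OF irr]) (use ab in \<open>auto simp: fun_ops counit gen_add_left [symmetric] fls_plus_const
      intro: cvec.subspace_add [OF subspace_BV]\<close>)
next
  fix k a
  assume a: "a \<in> BV Y vac"
  show "counit (k *\<^sub>C a) = k *\<^sub>C counit a"
    by (rule counit_eqI [OF irr]) (use a in \<open>auto simp: scaleC_fun_apply counit scaleC_gen scaleC_complex_def
      intro: cvec.subspace_scale [OF subspace_BV]\<close>)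
qed

text \<open>For the product, the unit and the derivation an explicit expansion is written down, and
  \<open>comult_eqI\<close> identifies it with the coproduct. Rules for the counit are read off on
  the vacuum.\<close>

lemma differential_bialgebra_BV:
  "differential_bialgebra_on (BV Y vac) lh_mult lh_one comult counit lh_deriv"
proof unfold_locales
  let ?B = "BV Y vac"
  show "linear_on ?B (\<lambda>a. lh_mult a b)" if "b \<in> ?B" for b
    using that unfolding linear_on_def
    by (auto simp: fun_eq_iff lh_mult_eq scaleC_fun_apply [of _ "lh_mult _ _"] fun_ops(1) [of "lh_mult _ _"]
      act_add_left act_scaleC_left BV_homD laurent_homD)
  show "linear_on ?B (lh_mult a)" if "a \<in> ?B" for a
    using that unfolding linear_on_def
    by (auto simp: fun_eq_iff lh_mult_eq scaleC_fun_apply [of _ "_ :: 'v \<Rightarrow> int \<Rightarrow> 'v"] fun_ops(1) [of "_ :: 'v \<Rightarrow> int \<Rightarrow> 'v"]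
      act_add act_scaleC BV_homD laurent_homD)
  show "lh_mult (lh_mult a b) c = lh_mult a (lh_mult b c)" if "a \<in> ?B" "b \<in> ?B" "c \<in> ?B" for a b c
    using that act_lh_mult(1) [of a b] by (simp add: fun_eq_iff [where 'a = 'v] lh_mult_eq [abs_def] BV_homD laurent_homD)
  show "lh_mult lh_one a = a" if "a \<in> ?B" for a
    using that by (simp add: fun_eq_iff [where 'a = 'v] lh_mult_eq lh_one_eq [abs_def] act_one BV_homD laurent_homD)
  show "lh_mult a lh_one = a" if "a \<in> ?B" for a
    using that by (simp add: fun_eq_iff [where 'a = 'v] lh_mult_eq lh_one_eq act_gen_right act_one BV_homD laurent_homD)
  show "comult (lh_mult a b) = (\<Sum>(p, q)\<leftarrow>xs. \<Sum>(r, s)\<leftarrow>ys. lh_mult p r \<otimes> lh_mult q s)"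
    if a: "a \<in> ?B" and b: "b \<in> ?B" and xs: "tensor_expansion ?B (comult a) xs" and ys: "tensor_expansion ?B (comult b) ys"
    for a b xs ys
  proof -
    note xs = expansion_comult [OF a xs] and ys = expansion_comult [OF b ys]
    let ?zs = "concat (map (\<lambda>(p, q). map (\<lambda>(r, s). (lh_mult p r, lh_mult q s)) ys) xs)"
    have "comult (lh_mult a b) = (\<Sum>(b, c)\<leftarrow>?zs. b \<otimes> c)"
    proof (rule comult_eqI)
      show "set ?zs \<subseteq> ?B \<times> ?B"
        using xs(1) ys(1) by (fastforce intro: lh_mult_BV)
      show "commutes_via Y (lh_mult a b) ?zs"
        by (rule commutes_via_mult [OF BV_homD [OF a] BV_pairs [OF xs(1)] xs(2) BV_pairs [OF ys(1)] ys(2)])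
    qed (rule lh_mult_BV [OF a b])
    then show ?thesis
      unfolding sum_list_concat_map by (simp add: split_def o_def)
  qed
  show "comult lh_one = lh_one \<otimes> lh_one"
    using comult_eqI [OF _ commutes_via_one lh_one_BV] lh_one_BV by simp
  show "counit (lh_mult a b) = counit a * counit b" if "a \<in> ?B" "b \<in> ?B" for a b
    using that by (intro counit_eqI [OF irr] lh_mult_BV lh_mult_vac counit BV_homD)
  show "counit lh_one = 1"
    by (intro counit_eqI [OF irr] lh_one_BV lh_one_vac)
  show "linear_on ?B lh_deriv"
    by (simp add: linear_on_def lh_deriv_def fun_eq_iff fun_ops scaleC_fun_apply scaleC_add_right scaleC_scaleC mult.commute)
  show "lh_deriv (lh_mult a b) = lh_mult (lh_deriv a) b + lh_mult a (lh_deriv b)" if "a \<in> ?B" "b \<in> ?B" for a b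
  proof
    fix w
    have "deriv (act a (b w)) = act (\<lambda>w. deriv (a w)) (b w) + act a (deriv (b w))"
      by (rule deriv_act [OF BV_homD [OF that(1)] laurent_homD [OF BV_homD [OF that(2)]]])
    then show "lh_deriv (lh_mult a b) w = (lh_mult (lh_deriv a) b + lh_mult a (lh_deriv b)) w"
      by (simp add: fun_ops(1) [of "lh_mult (lh_deriv a) b"] lh_mult_eq lh_deriv_eq act_lh_deriv)
  qed
  show "counit (lh_deriv a) = 0" if "a \<in> ?B" for a
    using lh_deriv_vac [of a, OF counit [OF that]] by (intro counit_eqI [OF irr] lh_deriv_BV that) simp
  show "comult (lh_deriv a) = (\<Sum>(b, c)\<leftarrow>xs. lh_deriv b \<otimes> c + b \<otimes> lh_deriv c)"
    if a: "a \<in> ?B" and xs: "tensor_expansion ?B (comult a) xs" for a xs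
  proof -
    note xs = expansion_comult [OF a xs]
    let ?zs = "concat (map (\<lambda>(b, c). [(lh_deriv b, c), (b, lh_deriv c)]) xs)"
    have "comult (lh_deriv a) = (\<Sum>(b, c)\<leftarrow>?zs. b \<otimes> c)"
    proof (rule comult_eqI)
      show "set ?zs \<subseteq> ?B \<times> ?B"
        using xs(1) by (fastforce intro: lh_deriv_BV)
      show "commutes_via Y (lh_deriv a) ?zs"
        by (rule commutes_via_deriv [OF BV_pairs [OF xs(1)] xs(2)])
    qed (rule lh_deriv_BV [OF a])
    then show ?thesis
      unfolding sum_list_concat_map by (simp add: split_def)
  qed
qed (fact subspace_BV lh_one_BV lh_mult_BV lh_deriv_BV comult_in comult_linear counit_linear
  comult_coassoc counit_left_eval counit_right_eval)+

section \<open>Primitive and group-like elements\<close>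

lemma sh_one_left: "t \<in> laurent_tensor \<Longrightarrow> sh Y (lh_one v) t n m = Y v n (t m)"
proof (induction rule: laurent_tensor_induct)
  case zero
  have eq: "sh Y (lh_one v) 0 n = 0"
    by (simp add: lh_one_eq)
  show ?case
    unfolding eq by (simp add: fun_ops)
next
  case (add s t)
  have eq: "sh Y (lh_one v) (s + t) n = sh Y (lh_one v) s n + sh Y (lh_one v) t n"
    using add by (simp add: sh_add_right lh_one_eq)
  show ?case
    unfolding eq using add by (simp add: fun_ops Y_add_arg)
next
  case (gen g w)
  have eq: "sh Y (gen 1 v) (gen g w) n = gen g (Y v n w)"
    using sh_const [of 1 v g w n] by simp
  show ?case
    unfolding lh_one_eq eq by (simp add: gen_nth Y_scaleC_arg)
qed

lemma sh_one_right: "s \<in> laurent_tensor \<Longrightarrow> sh Y s (lh_one w) n = shiftY Y s n w"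
  by (simp add: sh_def lh_one_eq act_gen_right act_one shiftY_in)

text \<open>With the term Y(v, x2)\<psi>(x1) moved to the other side, the commutator formula is the
  commutation rule of \<psi> \<otimes> 1 + 1 \<otimes> \<psi>.\<close>

lemma PDer_minus_eq: "PDer_minus Y = {\<psi>\<in>laurent_hom. commutes_via Y \<psi> [(\<psi>, lh_one), (lh_one, \<psi>)]}"
proof -
  have eq: "(\<forall>v w m n. \<psi> (Y v (- n - 1) w) m - Y v (- n - 1) (\<psi> w m) = Y_shift_coeff Y \<psi> v w m n)
      \<longleftrightarrow> commutes_via Y \<psi> [(\<psi>, lh_one), (lh_one, \<psi>)]" if \<psi>: "\<psi> \<in> laurent_hom" for \<psi>
  proof -
    have "(\<forall>v w m n. \<psi> (Y v (- n - 1) w) m - Y v (- n - 1) (\<psi> w m) = Y_shift_coeff Y \<psi> v w m n) \<longleftrightarrow>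
      (\<forall>v w m n. \<psi> (Y v n w) m - Y v n (\<psi> w m) = Y_shift_coeff Y \<psi> v w m (- n - 1))"
      by (subst all_int_reflect [symmetric, of "\<lambda>n. \<psi> (Y _ n _) _ - Y _ n _ = Y_shift_coeff _ _ _ _ _ (- n - 1)"]) simp
    then show ?thesis
      using \<psi> by (auto simp: commutes_via_eq fun_eq_iff fun_ops Y_shift_coeff_eq sh_one_right sh_one_left laurent_homD
        algebra_simps)
  qed
  show ?thesis
    unfolding PDer_minus_def by (rule Collect_cong, rule conj_cong [OF refl]) (rule eq)
qed

lemma PEnd_minus_eq: "PEnd_minus Y vac = {\<phi>\<in>laurent_hom. \<phi> vac = lh_one vac \<and> commutes_via Y \<phi> [(\<phi>, \<phi>)]}"
  by (auto simp: PEnd_minus_def commutes_via_def)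

lemma PDer_minus_comult: "PDer_minus Y = {a\<in>BV Y vac. comult a = a \<otimes> lh_one + lh_one \<otimes> a}"
proof (intro equalityI subsetI)
  fix \<psi>
  assume "\<psi> \<in> PDer_minus Y"
  then have \<psi>: "\<psi> \<in> laurent_hom" and via: "commutes_via Y \<psi> [(\<psi>, lh_one), (lh_one, \<psi>)]"
    by (auto simp: PDer_minus_eq)
  \<comment> \<open>Taking v = w = vac and the coefficient of x2^0 shows that a derivation kills the
    vacuum.\<close>
  have "\<psi> vac = sh Y (\<psi> vac) (lh_one vac) (-1) + sh Y (lh_one vac) (\<psi> vac) (-1)"
    using via vacuum [of "-1" vac] by (simp add: commutes_via_eq) metis
  also have "\<dots> = \<psi> vac + \<psi> vac"
    by (simp only: lh_one_vac sh_vac_right sh_vac_left laurent_homD [OF \<psi>] scaleC_one)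
  finally have zero: "\<psi> vac = 0"
    by simp
  \<comment> \<open>The unit operator is added because it occurs in the commutation rule of
    \<psi>.\<close>
  have "{\<psi>, lh_one} \<subseteq> BV Y vac"
  proof (rule BV_superset)
    fix a
    assume a: "a \<in> {\<psi>, lh_one}"
    show "\<exists>xs. set xs \<subseteq> {\<psi>, lh_one} \<times> {\<psi>, lh_one} \<and> commutes_via Y a xs"
    proof (cases "a = \<psi>")
      case True
      then show ?thesis
        using via by (intro exI [of _ "[(\<psi>, lh_one), (lh_one, \<psi>)]"]) simp
    next
      case False
      then show ?thesis
        using a commutes_via_one by (intro exI [of _ "[(lh_one, lh_one)]"]) simp
    qed
    have "\<psi> vac = gen (fls_const 0) vac"
      by (simp add: zero)
    then show "\<exists>c. vacuum_eigenvalue vac a c"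
      using a lh_one_vac unfolding vacuum_eigenvalue_eq by blast
  qed (simp add: \<psi> lh_one_hom)
  then have B: "\<psi> \<in> BV Y vac"
    by simp
  then have "comult \<psi> = (\<Sum>(b, c)\<leftarrow>[(\<psi>, lh_one), (lh_one, \<psi>)]. b \<otimes> c)"
    using via lh_one_BV by (intro comult_eqI) auto
  then show "\<psi> \<in> {a\<in>BV Y vac. comult a = a \<otimes> lh_one + lh_one \<otimes> a}"
    using B by simp
next
  fix a
  assume a: "a \<in> {a\<in>BV Y vac. comult a = a \<otimes> lh_one + lh_one \<otimes> a}"
  then have "tensor_expansion (BV Y vac) (comult a) [(a, lh_one), (lh_one, a)]"
    using lh_one_BV by (simp add: tensor_expansion_def)
  then show "a \<in> PDer_minus Y"
    using a expansion_comult(2) by (simp add: PDer_minus_eq BV_homD)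
qed

lemma PEnd_minus_comult: "PEnd_minus Y vac = {a\<in>BV Y vac. a \<noteq> 0 \<and> comult a = a \<otimes> a}"
proof (intro equalityI subsetI)
  fix \<phi>
  assume "\<phi> \<in> PEnd_minus Y vac"
  then have \<phi>: "\<phi> \<in> laurent_hom" "\<phi> vac = lh_one vac" and via: "commutes_via Y \<phi> [(\<phi>, \<phi>)]"
    by (auto simp: PEnd_minus_eq)
  have "{\<phi>} \<subseteq> BV Y vac"
  proof (rule BV_superset)
    fix a
    assume a: "a \<in> {\<phi>}"
    then show "\<exists>xs. set xs \<subseteq> {\<phi>} \<times> {\<phi>} \<and> commutes_via Y a xs"
      using via by (intro exI [of _ "[(\<phi>, \<phi>)]"]) simp
    show "\<exists>c. vacuum_eigenvalue vac a c"
      unfolding vacuum_eigenvalue_eq by (rule exI [of _ 1]) (use a \<phi>(2) lh_one_vac in simp)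
  qed (simp add: \<phi>)
  then have B: "\<phi> \<in> BV Y vac"
    by simp
  then have "comult \<phi> = (\<Sum>(b, c)\<leftarrow>[(\<phi>, \<phi>)]. b \<otimes> c)"
    using via by (intro comult_eqI) auto
  moreover have "\<phi> \<noteq> 0"
  proof
    assume "\<phi> = 0"
    then have "lh_one vac 0 = (0 :: 'v)"
      using \<phi>(2) by (metis fun_ops(2))
    then show False
      using vac_nonzero [OF irr] by (simp add: lh_one_def)
  qed
  ultimately show "\<phi> \<in> {a\<in>BV Y vac. a \<noteq> 0 \<and> comult a = a \<otimes> a}"
    using B by simp
next
  fix a
  assume "a \<in> {a\<in>BV Y vac. a \<noteq> 0 \<and> comult a = a \<otimes> a}"
  then have a: "a \<in> BV Y vac" "a \<noteq> 0" and xs: "tensor_expansion (BV Y vac) (comult a) [(a, a)]"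
    by (simp_all add: tensor_expansion_def)
  \<comment> \<open>The counit identity for a \<otimes> a. As a is nonzero, its vacuum eigenvalue
    must be 1, which is the normalisation required in \<open>PEnd_minus\<close>.\<close>
  have "counit a *\<^sub>C a = a"
    using counit_left_eval [OF a(1) xs] by simp
  then have "(counit a - 1) *\<^sub>C a = 0"
    by (simp add: cvec.scale_left_diff_distrib scaleC_one)
  then have "counit a = 1"
    using a(2) by simp
  then have "a vac = lh_one vac"
    using counit [OF a(1)] lh_one_vac by simp
  then show "a \<in> PEnd_minus Y vac"
    using expansion_comult(2) [OF a(1) xs] by (simp add: PEnd_minus_eq BV_homD a)
qed

lemma BV_bialgebra:
  "differential_bialgebra_on (BV Y vac) lh_mult lh_one comult counit lh_deriv \<and>
    (\<forall>a\<in>BV Y vac. \<forall>c. vacuum_eigenvalue vac a c \<longleftrightarrow> c = counit a) \<and>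
    (\<forall>a\<in>BV Y vac. \<forall>t\<in>tensor_of (BV Y vac) (BV Y vac). comult_relation Y vac a t \<longleftrightarrow> t = comult a) \<and>
    PDer_minus Y = {a\<in>BV Y vac. comult a = a \<otimes> lh_one + lh_one \<otimes> a} \<and>
    PEnd_minus Y vac = {a\<in>BV Y vac. a \<noteq> 0 \<and> comult a = a \<otimes> a}"
proof (intro conjI ballI allI)
  fix a c
  assume a: "a \<in> BV Y vac"
  show "vacuum_eigenvalue vac a c \<longleftrightarrow> c = counit a"
    using counit [OF a] counit_eqI [OF irr a] unfolding vacuum_eigenvalue_eq by blast
next
  fix a t
  assume a: "a \<in> BV Y vac"
  show "comult_relation Y vac a t \<longleftrightarrow> t = comult a"
    using comult_relation [OF a] comult_unique by blast
qed (fact differential_bialgebra_BV PDer_minus_comult PEnd_minus_comult)+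

end

end

section \<open>Vertex operator algebras\<close>

context vertex_algebra
begin

text \<open>Choose \<open>l\<close> with \<open>u\<^sub>m w = 0\<close> for \<open>m \<ge> l\<close>: the second product drops out of the Jacobi identity.\<close>

lemma vertex_algebra_weak_associativity:
  "\<exists>l. binomial_mult l (shifted_product_coeff Y u v w) = binomial_mult l (iterate_coeff Y u v w)"
proof -
  obtain N where N: "\<forall>n\<ge>N. Y u n w = 0"
    using truncation by blast
  define l where "l = nat N"
  have van: "Y u (int l + int i) w = 0" "Y u (int i + int l) w = 0" for i
    using N by (simp_all add: l_def)
  define F where "F p q = Y u (- p - 1) (Y v (- q - 1) w)" for p q
  have "binomial_mult l (shifted_product_coeff Y u v w) p q = binomial_mult l (iterate_coeff Y u v w) p q" for p q
  proof -
    define k n where "k = - p - 1" and "n = - q - 1"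
    have F: "qbounded F"
      using qbounded_product [of u v w] by (simp add: F_def [abs_def])
    \<comment> \<open>Negation of the upper index, with p = -k - 1, produces the signs of the Jacobi
      identity.\<close>
    have sign: "(of_int (p + int i) :: complex) gchoose i = (-1) ^ i * (of_int k gchoose i)" for i
      using gbinomial_negated_upper [of "of_int k :: complex" i]
      by (simp add: k_def power_mult_distrib [symmetric] algebra_simps)
    \<comment> \<open>Multiplying by (x0 + x2)^l after the substitution is multiplying by x1^l
      before it; this gives the first products on the right of the Jacobi identity with m =
      l.\<close>
    have "binomial_mult l (shifted_product_coeff Y u v w) p q = Tsub (\<lambda>p q. F (p - int l) (q - int 0)) p q"
      unfolding Tsub_shift [OF F] by (simp add: shifted_product_Tsub F_def [abs_def])
    also have "\<dots> = Sum_any (\<lambda>i::nat. ((-1) ^ i * ((of_int k :: complex) gchoose i)) *\<^sub>C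
        (Y u (int l + k - int i) (Y v (n + int i) w)
          - ((-1) powi k) *\<^sub>C Y v (n + k - int i) (Y u (int l + int i) w)))"
      unfolding Tsub_def sign by (rule Sum_any.cong) (simp add: van F_def k_def n_def algebra_simps)
    also have "\<dots> = Sum_any (\<lambda>i::nat. ichoose (int l) i *\<^sub>C
        Y (Y u (k + int i) v) (int l + n - int i) w)"
      by (rule jacobi [symmetric])
    \<comment> \<open>l is a natural number, so the binomial coefficients vanish beyond l.\<close>
    also have "\<dots> = (\<Sum>i\<le>l. ichoose (int l) i *\<^sub>C Y (Y u (k + int i) v) (int l + n - int i) w)"
      by (rule Sum_any.expand_superset)
         (auto simp: binomial_eq_0 simp flip: binomial_gbinomial intro!: leI)
    also have "\<dots> = binomial_mult l (iterate_coeff Y u v w) p q"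
      unfolding binomial_mult_def iterate_coeff_def
      by (rule sum.reindex_bij_witness [of _ "\<lambda>i. l - i" "\<lambda>i. l - i"])
         (auto simp: k_def n_def algebra_simps of_nat_diff binomial_symmetric [symmetric] simp flip: binomial_gbinomial)
    finally show ?thesis .
  qed
  then show ?thesis
    by blast
qed

lemma vertex_algebra_nonlocal: "nonlocal_vertex_algebra Y vac"
  by unfold_locales (rule vertex_algebra_weak_associativity)

end

text \<open>There are countably many weights, and each weight space lies in the span of a finite
  set.\<close>

lemma (in vertex_operator_algebra) countable_dim_UNIV: "countable_dim (UNIV :: 'v set)"
proof -
  have "\<exists>S. finite S \<and> {v. Y \<omega> 1 v = of_int n *\<^sub>C v} \<subseteq> cvec.span S" for n :: int
    by (rule finite_dimensional)
  then obtain S where S: "\<And>n::int. finite (S n)" "\<And>n. {v. Y \<omega> 1 v = of_int n *\<^sub>C v} \<subseteq> cvec.span (S n)"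
    by metis
  have "(\<Union>n::int. {v. Y \<omega> 1 v = of_int n *\<^sub>C v}) \<subseteq> cvec.span (\<Union>n. S n)"
    using S(2) cvec.span_mono [of "S _" "\<Union>n. S n"] by blast
  then have span: "cvec.span (\<Union>n. S n) = UNIV"
    using L0_grading cvec.span_minimal [OF _ cvec.subspace_span] by (metis top.extremum_uniqueI)
  obtain B where B: "B \<subseteq> (\<Union>n. S n)" "cvec.independent B" "(\<Union>n. S n) \<subseteq> cvec.span B"
    using cvec.maximal_independent_subset .
  have "countable B"
    by (rule countable_subset [OF B(1)]) (intro countable_UN countableI_type countable_finite S)
  moreover have "cvec.span B = UNIV"
    using span cvec.span_minimal [OF B(3) cvec.subspace_span] by (metis top.extremum_uniqueI)
  ultimately show ?thesis
    using B(2) unfolding countable_dim_def by blast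
qed

text \<open>Uniqueness is carried by the two equivalences, which determine \<epsilon> and \<Delta>
  on B(V). The case of a simple vertex operator algebra is reduced to the general one by
  \<open>vertex_algebra_nonlocal\<close> and \<open>countable_dim_UNIV\<close>.\<close>

theorem corollary3p9:
  fixes Y :: "'v::complex_vector \<Rightarrow> int \<Rightarrow> 'v \<Rightarrow> 'v" and vac :: 'v
  assumes "(nonlocal_vertex_algebra Y vac \<and> countable_dim (UNIV :: 'v set) \<and> adjoint_irreducible Y)
    \<or> (\<exists>\<omega>. vertex_operator_algebra Y vac \<omega> \<and> adjoint_irreducible Y)"
  shows "\<exists>\<Delta> \<epsilon>.
    differential_bialgebra_on (BV Y vac) lh_mult lh_one \<Delta> \<epsilon> lh_deriv \<and>
    (\<forall>a\<in>BV Y vac. \<forall>c. vacuum_eigenvalue vac a c \<longleftrightarrow> c = \<epsilon> a) \<and>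
    (\<forall>a\<in>BV Y vac. \<forall>t\<in>tensor_of (BV Y vac) (BV Y vac). comult_relation Y vac a t \<longleftrightarrow> t = \<Delta> a) \<and>
    PDer_minus Y = {a\<in>BV Y vac. \<Delta> a = a \<otimes> lh_one + lh_one \<otimes> a} \<and>
    PEnd_minus Y vac = {a\<in>BV Y vac. a \<noteq> 0 \<and> \<Delta> a = a \<otimes> a}"
proof -
  have "nonlocal_vertex_algebra Y vac \<and> countable_dim (UNIV :: 'v set) \<and> adjoint_irreducible Y"
    using assms
  proof
    assume "\<exists>\<omega>. vertex_operator_algebra Y vac \<omega> \<and> adjoint_irreducible Y"
    then obtain \<omega> where voa: "vertex_operator_algebra Y vac \<omega>" and irr: "adjoint_irreducible Y"
      by blast
    interpret vertex_operator_algebra Y vac \<omega>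
      by (rule voa)
    show ?thesis
      using vertex_algebra_nonlocal countable_dim_UNIV irr by blast
  qed
  then have irr: "adjoint_irreducible Y" and dim: "countable_dim (UNIV :: 'v set)"
    and nva: "nonlocal_vertex_algebra Y vac"
    by blast+
  interpret nonlocal_vertex_algebra Y vac
    by (rule nva)
  show ?thesis
    using BV_bialgebra [OF irr dim] by blast
qed

end
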